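(* Let $\sum_{i\in\mathbb N}\delta_{U_i}$ be a Poisson point process on $(0,\infty)$ with intensity $u^{-2}du$ and let $W_i$, $i\in\mathbb N$, be independent copies (independent of the $U_i$) of a non-negative process $\{W(t):t\in\mathbb R^d\}$ with continuous sample paths such that $\lim_{\|t\|\to\infty}W(t)=0$ a.s., $\mathbb EW(t)=1$ for all $t$, and $\mathbb E\{\max_{t\in K}W(t)\}<\infty$ for every compact $K\subset\mathbb R^d$. Assume that $\xi(t)=\max_{i\in\mathbb N}U_iW_i(t)$, $t\in\mathbb R^d$, is stationary. Then: (1) The random variables $\tau_i=\inf\{\operatorname{argsup}_{t\in\mathbb R^d}W_i(t)\}$ and $\gamma_i=\sup_{t\in\mathbb R^d}W_i(t)$ are well-defined, and $\sum_{i\in\mathbb N}\delta_{(U_i\gamma_i,\ \tau_i,\ W_i(\cdot+\tau_i)/\gamma_i)}$ is a Poisson point process on $(0,\infty)\times\mathbb R^d\times C(\mathbb R^d)$ with intensity measure $c\,u^{-2}du\,dt\,\mathbb P_{\tilde F}(df)$ for some constant $c>0$ and some probability measure $\mathbb P_{\tilde F}$ on $C(\mathbb R^d)$. (2) $\xi$ has a mixed moving maxima representation: $\xi(t)\overset{d}{=}\max_{i}U'_iF_i(t-T'_i)$, where $\sum_i\delta_{(U'_i,T'_i,F_i)}$ is a Poisson point process with intensity $u^{-2}du\,dt\,\mathbb P_F(df)$ and the shape function $F$ has the law of $c\tilde F$ with $\tilde F\sim\mathbb P_{\tilde F}$. Here $$c=\Big(\int_{\mathbb R^d}\int_{C(\mathbb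 R^d)}f(t)\,\mathbb P_{\tilde F}(df)\,dt\Big)^{-1},$$ and for every Borel set $A\subset C(\mathbb R^d)$ and every compact $K\subset\mathbb R^d$ of positive Lebesgue measure, $$\mathbb P_{\tilde F}(A)=\frac{\int_0^\infty y\,\mathbb P\big(W(\cdot+\tau)/y\in A,\ \tau\in K\,\big|\,\gamma=y\big)\,\mathbb P_\gamma(dy)}{\int_0^\infty y\,\mathbb P(\tau\in K\mid\gamma=y)\,\mathbb P_\gamma(dy)},$$ where $\tau=\inf\{\operatorname{argsup}_tW(t)\}$, $\gamma=\sup_tW(t)$, and $\mathbb P_\gamma$ is the law of $\gamma$.
   Context: $C(\mathbb R^d)$ is the space of non-negative continuous functions on $\mathbb R^d$ with the topology of uniform convergence on compact sets. The infimum of the argsup set is taken in the lexicographic order.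
   Formalization: Well-definedness of τ_i is asserted almost surely only where γ_i>0: if W vanishes identically with positive probability, as the hypotheses allow, the argsup is all of R^d and has no lexicographic infimum; such indices give no point of the process. *)

theory Defs
  imports "HOL-Probability.Probability"
begin

definition Cset :: "('a::topological_space \<Rightarrow> real) set" where
  "Cset = {f. continuous_on UNIV f \<and> (\<forall>t. 0 \<le> f t)}"

definition lu_open :: "('a::metric_space \<Rightarrow> real) set \<Rightarrow> bool" where
  "lu_open U \<longleftrightarrow> U \<subseteq> Cset \<and>
     (\<forall>f\<in>U. \<exists>K e. compact K \<and> e > 0 \<and> {g\<in>Cset. \<forall>t\<in>K. \<bar>g t - f t\<bar> < e} \<subseteq> U)"

definition Cspace :: "('a::metric_space \<Rightarrow> real) measure" where
  "Cspace = sigma Cset {U. lu_open U}"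

text \<open>Number of points X_i falling in A (points outside the state space are not counted).\<close>
definition pp_count :: "(nat \<Rightarrow> 'w \<Rightarrow> 's) \<Rightarrow> 's set \<Rightarrow> 'w \<Rightarrow> ennreal" where
  "pp_count X A \<omega> = emeasure (count_space UNIV) {i. X i \<omega> \<in> A}"

definition poisson_pp :: "'w measure \<Rightarrow> 's measure \<Rightarrow> (nat \<Rightarrow> 'w \<Rightarrow> 's) \<Rightarrow> bool" where
  "poisson_pp M \<mu> X \<longleftrightarrow> prob_space M \<and>
     (\<forall>i. \<forall>A\<in>sets \<mu>. {\<omega>\<in>space M. X i \<omega> \<in> A} \<in> sets M) \<and>
     (\<forall>A\<in>sets \<mu>. emeasure \<mu> A < \<infinity> \<longrightarrow>
        (\<forall>k::nat. measure M {\<omega>\<in>space M. pp_count X A \<omega> = of_nat k}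
            = exp (- enn2real (emeasure \<mu> A)) * enn2real (emeasure \<mu> A) ^ k / fact k)) \<and>
     (\<forall>(n::nat) (A::nat \<Rightarrow> 's set).
        (\<forall>j<n. A j \<in> sets \<mu> \<and> emeasure \<mu> (A j) < \<infinity>) \<and> disjoint_family_on A {..<n} \<longrightarrow>
        prob_space.indep_vars M (\<lambda>_. borel) (\<lambda>j \<omega>. pp_count X (A j) \<omega>) {..<n})"

definition indep_rv2 :: "'w measure \<Rightarrow> 'a measure \<Rightarrow> ('w \<Rightarrow> 'a) \<Rightarrow> 'b measure \<Rightarrow> ('w \<Rightarrow> 'b) \<Rightarrow> bool" where
  "indep_rv2 M Ma X Mb Y \<longleftrightarrow> X \<in> measurable M Ma \<and> Y \<in> measurable M Mb \<and>
     (\<forall>A\<in>sets Ma. \<forall>B\<in>sets Mb.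
        measure M {\<omega>\<in>space M. X \<omega> \<in> A \<and> Y \<omega> \<in> B}
          = measure M {\<omega>\<in>space M. X \<omega> \<in> A} * measure M {\<omega>\<in>space M. Y \<omega> \<in> B})"

definition argsup :: "('a \<Rightarrow> real) \<Rightarrow> 'a set" where
  "argsup f = {t. \<forall>s. f s \<le> f t}"

definition lex_le :: "(real^('d::{finite,linorder})) \<Rightarrow> real^('d::{finite,linorder}) \<Rightarrow> bool" where
  "lex_le x y \<longleftrightarrow> x = y \<or> (\<exists>k. x$k < y$k \<and> (\<forall>j<k. x$j = y$j))"

definition is_lex_inf :: "(real^('d::{finite,linorder})) set \<Rightarrow> real^('d::{finite,linorder}) \<Rightarrow> bool" where
  "is_lex_inf S x \<longleftrightarrow> (\<forall>s\<in>S. lex_le x s) \<and> (\<forall>z. (\<forall>s\<in>S. lex_le z s) \<longrightarrow> lex_le z x)"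

definition lex_inf :: "(real^('d::{finite,linorder})) set \<Rightarrow> real^('d::{finite,linorder})" where
  "lex_inf S = (THE x. is_lex_inf S x)"

definition tau_of :: "(real^('d::{finite,linorder}) \<Rightarrow> real) \<Rightarrow> real^('d::{finite,linorder})" where
  "tau_of f = lex_inf (argsup f)"

definition gamma_of :: "('a \<Rightarrow> real) \<Rightarrow> real" where
  "gamma_of f = (SUP t. f t)"

definition pareto_int :: "real \<Rightarrow> real measure" where
  "pareto_int c = density (restrict_space lborel {0<..}) (\<lambda>u. ennreal (c / u\<^sup>2))"

end

(* The pairs (U_i, W_i) form a Poisson process (marking theorem, via Laplace functionals), so by
   stationarity of xi its image measure under (u, w) |-> u w is invariant under translations of R^d
   away from the zero function: void probabilities of xi determine it on the sets
   {f. f t_j > x_j for some j}. It is also homogeneous under scaling. A function vanishing at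
   infinity is described by its maximum gamma, the argument tau of the maximum and its normalised
   shape. In these coordinates homogeneity gives the factor u^-2 du, and translation invariance
   gives, for each set A of shapes, that E(gamma; tau in B, shape in A) is a multiple of the
   Lebesgue measure of B; it is locally finite since gamma is at most max_K W when tau lies in K.
   The moving maxima process has the same void probabilities as xi, hence the same
   finite-dimensional laws. *)
theory Submission
  imports Defs
begin

section \<open>The space of non-negative continuous functions\<close>

text \<open>The obstacle is the zero function. If \<open>W\<close> vanishes identically with
  positive probability, the image measure has infinite mass there, and a point with
  \<open>gamma_of (W i) = 0\<close> has an argsup without lexicographic infimum. Its first
  coordinate \<open>U i * gamma\<close> is 0, outside the state space, so it is not counted, and
  measures are compared only on sets of functions that are positive somewhere. Likewise only
  positive thresholds enter the void probabilities: exceedance sets of level 0 have infinite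
  measure.

  \<open>poisson_pp\<close> speaks of counts only, so Laplace functionals are used in both
  directions, from counts to the functional and back to the joint law of counts.

  The constant is \<open>c = E(gamma; tau in Q)\<close> for a box \<open>Q\<close> of volume 1. Its
  reciprocal is the integral of the mean shape because \<open>W(0) = gamma * shape(-tau)\<close> has
  mean 1. In the formula for the shape law, integrals of \<open>y\<close> against probabilities
  given \<open>gamma = y\<close> are expectations weighted by \<open>gamma\<close>, so no
  conditional law is constructed.\<close>

lemma space_Cspace [simp]: "space Cspace = Cset"
  unfolding Cspace_def by (rule space_measure_of) (auto simp: lu_open_def)

lemma sets_Cspace: "sets Cspace = sigma_sets Cset {U. lu_open U}"
  unfolding Cspace_def by (rule sets_measure_of) (auto simp: lu_open_def)

lemma measurable_eval_Cspace: "(\<lambda>f. f t) \<in> borel_measurable Cspace"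
proof (rule borel_measurableI)
  fix S :: "real set" assume "open S"
  have "lu_open {f \<in> Cset. f t \<in> S}"
    unfolding lu_open_def
  proof (intro conjI ballI)
    fix f assume f: "f \<in> {f \<in> Cset. f t \<in> S}"
    then obtain e where e: "e > 0" "ball (f t) e \<subseteq> S"
      using \<open>open S\<close> by (auto elim: openE)
    have "{g \<in> Cset. \<forall>s\<in>{t}. \<bar>g s - f s\<bar> < e} \<subseteq> {f \<in> Cset. f t \<in> S}"
      using e(2) by (auto simp: subset_eq dist_real_def abs_minus_commute)
    then show "\<exists>K e. compact K \<and> e > 0 \<and> {g\<in>Cset. \<forall>t\<in>K. \<bar>g t - f t\<bar> < e} \<subseteq> {f \<in> Cset. f t \<in> S}"
      using e(1) by (intro exI[of _ "{t}"] exI[of _ e]) auto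
  qed auto
  moreover have "(\<lambda>f. f t) -` S \<inter> space Cspace = {f \<in> Cset. f t \<in> S}"
    by auto
  ultimately show "(\<lambda>f. f t) -` S \<inter> space Cspace \<in> sets Cspace"
    by (simp add: sets_Cspace sigma_sets.Basic)
qed

text \<open>Turns conditions at uncountably many points into countably many. The points of
  \<open>B\<close> at which \<open>f\<close> leaves the closed set \<open>S\<close> form an open
  set, so if there is one, there is one in \<open>D\<close>.\<close>

lemma Ball_dense_closed_iff:
  fixes D :: "'a::topological_space set" and f :: "'a \<Rightarrow> 'b::topological_space"
  assumes D: "\<And>X. open X \<Longrightarrow> X \<noteq> {} \<Longrightarrow> \<exists>d\<in>D. d \<in> X"
    and f: "continuous_on UNIV f" and B: "open B" and "closed S"
  shows "(\<forall>t\<in>B. f t \<in> S) \<longleftrightarrow> (\<forall>t\<in>B \<inter> D. f t \<in> S)"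
proof (intro iffI ballI)
  fix t assume *: "\<forall>t\<in>B \<inter> D. f t \<in> S" "t \<in> B"
  have "open (B \<inter> f -` (- S))"
    using f B \<open>closed S\<close> by (intro open_Int open_vimage) auto
  then have "B \<inter> f -` (- S) = {}" using D[of "B \<inter> f -` (- S)"] *(1) by blast
  then show "f t \<in> S" using *(2) by blast
qed auto

text \<open>The sets of functions that map finitely many basic open sets into rational intervals form
  a countable family, and every open set is a union of some of them.\<close>

lemma measurable_CspaceI:
  fixes F :: "'b \<Rightarrow> 'a::{metric_space, second_countable_topology} \<Rightarrow> real"
  assumes sp: "\<And>\<omega>. \<omega> \<in> space N \<Longrightarrow> F \<omega> \<in> Cset"
    and ev: "\<And>t. (\<lambda>\<omega>. F \<omega> t) \<in> borel_measurable N"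
  shows "F \<in> measurable N Cspace"
  unfolding Cspace_def
proof (rule measurable_measure_of)
  show "{U. lu_open U} \<subseteq> Pow Cset" by (auto simp: lu_open_def)
  show "F \<in> space N \<rightarrow> Cset" using sp by auto
  fix U :: "('a \<Rightarrow> real) set" assume "U \<in> {U. lu_open U}"
  then have U: "lu_open U" by simp
  obtain \<B> :: "'a set set" where B: "countable \<B>" "topological_basis \<B>"
    using ex_countable_basis by blast
  obtain D :: "'a set" where D: "countable D" "\<And>X. open X \<Longrightarrow> X \<noteq> {} \<Longrightarrow> \<exists>d\<in>D. d \<in> X"
    using countable_dense_setE by blast
  define \<F> where "\<F> = {Q :: ('a set \<times> real \<times> real) set. Q \<subseteq> \<B> \<times> (\<rat> \<times> \<rat>) \<and> finite Q}"
  have cF: "countable \<F>"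
  proof -
    have "\<F> = {Q. finite Q \<and> Q \<subseteq> \<B> \<times> (\<rat> \<times> \<rat>)}" unfolding \<F>_def by auto
    then show ?thesis
      using B(1) countable_rat
      by (simp only:) (intro countable_Collect_finite_subset countable_SIGMA; simp)
  qed
  define H :: "('a set \<times> real \<times> real) set \<Rightarrow> ('a \<Rightarrow> real) set" where
    "H = (\<lambda>Q. {f\<in>Cset. \<forall>(B,a,c)\<in>Q. \<forall>t\<in>B. f t \<in> {a..c}})"
  have key: "\<exists>Q\<in>\<F>. f \<in> H Q \<and> H Q \<subseteq> U" if f: "f \<in> U" for f
  proof -
    from U f obtain K e where K: "compact K" "e > 0" "{g\<in>Cset. \<forall>t\<in>K. \<bar>g t - f t\<bar> < e} \<subseteq> U"
      unfolding lu_open_def by blast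
    have fC: "f \<in> Cset" using U f by (auto simp: lu_open_def)
    then have cont: "continuous_on UNIV f" by (simp add: Cset_def)
    \<comment> \<open>Closed intervals of length below \<open>e\<close>: two functions with values
      in the same interval differ by less than \<open>e\<close>, and closedness lets membership be
      tested on the dense set \<open>D\<close>.\<close>
    define C where "C = {B\<in>\<B>. \<exists>a\<in>\<rat>. \<exists>c\<in>\<rat>. c - a < e \<and> f ` B \<subseteq> {a..c}}"
    have cover: "K \<subseteq> \<Union> C"
    proof
      fix t assume "t \<in> K"
      obtain a where a: "a \<in> \<rat>" "f t - e/2 < a" "a < f t"
        using Rats_dense_in_real[of "f t - e/2" "f t"] K(2) by auto
      obtain c where c: "c \<in> \<rat>" "f t < c" "c < f t + e/2"
        using Rats_dense_in_real[of "f t" "f t + e/2"] K(2) by auto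
      have "open (f -` {a<..<c})"
        using cont by (intro open_vimage) auto
      then obtain B where B': "B \<in> \<B>" "t \<in> B" "B \<subseteq> f -` {a<..<c}"
        using topological_basisE[OF B(2), of "f -` {a<..<c}" t] a c by auto
      have "f ` B \<subseteq> {a..c}" using B' by auto
      moreover have "c - a < e" using a c by auto
      ultimately show "t \<in> \<Union> C" using B' a c unfolding C_def by blast
    qed
    have "\<And>B. B \<in> C \<Longrightarrow> open B"
      using B(2) by (auto simp: C_def topological_basis_open)
    then obtain C' where C': "C' \<subseteq> C" "finite C'" "K \<subseteq> \<Union> C'"
      using compactE[OF K(1) cover] by metis
    have "\<forall>B\<in>C. \<exists>a c. a \<in> \<rat> \<and> c \<in> \<rat> \<and> c - a < e \<and> f ` B \<subseteq> {a..c}"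
      unfolding C_def by blast
    then obtain a c where ac: "\<And>B. B \<in> C \<Longrightarrow> a B \<in> \<rat> \<and> c B \<in> \<rat> \<and> c B - a B < e \<and> f ` B \<subseteq> {a B..c B}"
      by metis
    define Q where "Q = (\<lambda>B. (B, a B, c B)) ` C'"
    have acC: "a B \<in> \<rat>" "c B \<in> \<rat>" "c B - a B < e" "f ` B \<subseteq> {a B..c B}" "B \<in> \<B>" if "B \<in> C'" for B
      using ac[of B] C'(1) that by (auto simp: C_def)
    have "Q \<in> \<F>"
      using C'(2) acC by (auto simp: Q_def \<F>_def)
    moreover have "f \<in> H Q"
      using fC acC(4) by (fastforce simp: Q_def H_def)
    moreover have "H Q \<subseteq> U"
    proof
      fix g assume g: "g \<in> H Q"
      have "\<bar>g t - f t\<bar> < e" if tK: "t \<in> K" for t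
      proof -
        obtain B where Bt: "B \<in> C'" "t \<in> B" using tK C'(3) by blast
        have "g t \<in> {a B..c B}" using g Bt by (auto simp: H_def Q_def)
        moreover have "f t \<in> {a B..c B}" "c B - a B < e" using acC(3,4)[OF Bt(1)] Bt(2) by auto
        ultimately show ?thesis by (auto simp: abs_if)
      qed
      moreover have "g \<in> Cset" using g by (simp add: H_def)
      ultimately show "g \<in> U" using K(3) by auto
    qed
    ultimately show ?thesis by blast
  qed
  have Hmeas: "F -` H Q \<inter> space N \<in> sets N" if "Q \<in> \<F>" for Q
  proof -
    have fin: "finite Q" using that by (simp add: \<F>_def)
    have dense: "(\<forall>t\<in>B. F \<omega> t \<in> {a..c}) \<longleftrightarrow> (\<forall>t\<in>B \<inter> D. F \<omega> t \<in> {a..c})"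
      if "\<omega> \<in> space N" "(B,a,c) \<in> Q" for \<omega> B a c
    proof (rule Ball_dense_closed_iff)
      show "\<And>X. open X \<Longrightarrow> X \<noteq> {} \<Longrightarrow> \<exists>d\<in>D. d \<in> X" by (rule D(2))
      show "continuous_on UNIV (F \<omega>)" using sp that by (simp add: Cset_def)
      show "open B" using that \<open>Q \<in> \<F>\<close> B(2) by (auto simp: \<F>_def topological_basis_open)
    qed simp
    have "(F \<omega> \<in> H Q) \<longleftrightarrow> (\<forall>q\<in>Q. \<forall>t\<in>fst q \<inter> D. F \<omega> t \<in> {fst (snd q)..snd (snd q)})"
      if "\<omega> \<in> space N" for \<omega>
    proof -
      have "(F \<omega> \<in> H Q) \<longleftrightarrow> (\<forall>q\<in>Q. \<forall>t\<in>fst q. F \<omega> t \<in> {fst (snd q)..snd (snd q)})"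
        using sp[OF that] by (simp add: H_def split_beta')
      also have "\<dots> \<longleftrightarrow> (\<forall>q\<in>Q. \<forall>t\<in>fst q \<inter> D. F \<omega> t \<in> {fst (snd q)..snd (snd q)})"
        using dense[OF that, of "fst q" "fst (snd q)" "snd (snd q)" for q] by (rule ball_cong[OF refl]) (metis prod.collapse)
      finally show ?thesis .
    qed
    then have "F -` H Q \<inter> space N
        = {\<omega>\<in>space N. \<forall>q\<in>Q. \<forall>t\<in>fst q \<inter> D. F \<omega> t \<in> {fst (snd q)..snd (snd q)}}"
      by auto
    also have "\<dots> \<in> sets N"
    proof (intro sets.sets_Collect_countable_All' countable_finite[OF fin])
      show "{\<omega>\<in>space N. F \<omega> t \<in> {fst (snd q)..snd (snd q)}} \<in> sets N" for t q
        using ev[of t] by measurable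
      show "countable (fst q \<inter> D)" for q using D(1) by auto
    qed
    finally show ?thesis .
  qed
  have "F -` U \<inter> space N = (\<Union>Q\<in>{Q\<in>\<F>. H Q \<subseteq> U}. F -` H Q \<inter> space N)"
    using key by blast
  also have "\<dots> \<in> sets N"
    using cF Hmeas by (intro sets.countable_UN') auto
  finally show "F -` U \<inter> space N \<in> sets N" .
qed

text \<open>If \<open>f t > a\<close>, then \<open>f\<close> is at least some rational
  \<open>q > a\<close> on a basic neighbourhood of \<open>t\<close>, so the superlevel set is a
  countable union of rectangles. Joint measurability is what allows evaluation at a point depending
  on \<open>f\<close>, such as \<open>tau_of f\<close>.\<close>

lemma measurable_eval_pair_Cspace:
  "(\<lambda>(t, f). f t) \<in> borel_measurable
     ((borel :: 'a::{metric_space, second_countable_topology} measure) \<Otimes>\<^sub>M Cspace)"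
proof (subst borel_measurable_iff_greater, intro allI)
  fix a :: real
  let ?N = "(borel :: 'a measure) \<Otimes>\<^sub>M Cspace"
  obtain \<B> :: "'a set set" where B: "countable \<B>" "topological_basis \<B>"
    using ex_countable_basis by blast
  obtain D :: "'a set" where D: "countable D" "\<And>X. open X \<Longrightarrow> X \<noteq> {} \<Longrightarrow> \<exists>d\<in>D. d \<in> X"
    using countable_dense_setE by blast
  have "{p \<in> space ?N. a < (case p of (t, f) \<Rightarrow> f t)}
      = (\<Union>q\<in>{q\<in>\<rat>. a < q}. \<Union>B\<in>\<B>. B \<times> {f\<in>space Cspace. \<forall>s\<in>B \<inter> D. f s \<in> {q..}})" (is "?L = ?R")
  proof (intro set_eqI iffI)
    fix p assume p: "p \<in> ?L"
    obtain t f where [simp]: "p = (t, f)" by (cases p)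
    have f: "f \<in> Cset" "a < f t" using p by (auto simp: space_pair_measure)
    then have cont: "continuous_on UNIV f" by (simp add: Cset_def)
    obtain q where q: "q \<in> \<rat>" "a < q" "q < f t" using Rats_dense_in_real[OF f(2)] by auto
    have "open (f -` {q<..})" using cont by (intro open_vimage) auto
    then obtain B' where B': "B' \<in> \<B>" "t \<in> B'" "B' \<subseteq> f -` {q<..}"
      using topological_basisE[OF B(2), of "f -` {q<..}" t] q by auto
    then have "\<forall>s\<in>B' \<inter> D. f s \<in> {q..}" by (auto simp: subset_eq less_imp_le)
    then show "p \<in> ?R" using B' q f by auto
  next
    fix p assume "p \<in> ?R"
    then obtain q B' t f where *: "a < q" "B' \<in> \<B>" "p = (t, f)" "t \<in> B'" "f \<in> Cset" "\<forall>s\<in>B' \<inter> D. f s \<in> {q..}"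
      by auto
    have "open B'" using *(2) B(2) by (auto simp: topological_basis_open)
    then have "\<forall>s\<in>B'. f s \<in> {q..}"
      using *(5,6) D(2) by (subst Ball_dense_closed_iff[of D]) (auto simp: Cset_def)
    then show "p \<in> ?L" using * by (fastforce simp: space_pair_measure)
  qed
  also have "\<dots> \<in> sets ?N"
  proof -
    have "countable {q\<in>\<rat>. a < q}" using countable_rat by (rule countable_subset[rotated]) auto
    moreover have "{f\<in>space Cspace. \<forall>s\<in>B' \<inter> D. f s \<in> {q..}} \<in> sets Cspace" for B' q
    proof (rule sets.sets_Collect_countable_All')
      show "{f\<in>space Cspace. f s \<in> {q..}} \<in> sets Cspace" for s :: 'a
        using measurable_eval_Cspace[measurable] by measurable
    qed (use D(1) in auto)
    moreover have "B' \<in> sets borel" if "B' \<in> \<B>" for B'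
      using that B(2) by (auto simp: topological_basis_open)
    ultimately show ?thesis
      using B(1) by (intro sets.countable_UN') auto
  qed
  finally show "{p \<in> space ?N. a < (case p of (t, f) \<Rightarrow> f t)} \<in> sets ?N" .
qed

lemma measurable_apply_Cspace:
  assumes "F \<in> measurable N Cspace" "T \<in> measurable N borel"
  shows "(\<lambda>\<omega>. F \<omega> (T \<omega> :: 'a::{metric_space, second_countable_topology})) \<in> borel_measurable N"
proof -
  have "(\<lambda>\<omega>. (T \<omega>, F \<omega>)) \<in> measurable N (borel \<Otimes>\<^sub>M Cspace)" using assms by measurable
  from measurable_compose[OF this measurable_eval_pair_Cspace] show ?thesis
    by (simp only: prod.case)
qed

text \<open>No boundedness is assumed: on unbounded families the real supremum is one unspecified constant,
  so the supremum is still measurable.\<close>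

lemma borel_measurable_Sup_countable:
  fixes g :: "'i \<Rightarrow> 'b \<Rightarrow> real"
  assumes D: "countable D" "D \<noteq> {}" and g: "\<And>i. i \<in> D \<Longrightarrow> g i \<in> borel_measurable N"
  shows "(\<lambda>\<omega>. SUP i\<in>D. g i \<omega>) \<in> borel_measurable N"
proof -
  have le: "{\<omega>\<in>space N. g i \<omega> \<le> a} \<in> sets N" if "i \<in> D" for i a
    using g[OF that] by measurable
  have bdd: "{\<omega>\<in>space N. bdd_above ((\<lambda>i. g i \<omega>) ` D)} \<in> sets N"
  proof -
    have "bdd_above ((\<lambda>i. g i \<omega>) ` D) \<longleftrightarrow> (\<exists>n::nat. \<forall>i\<in>D. g i \<omega> \<le> real n)" for \<omega>
    proof
      assume "bdd_above ((\<lambda>i. g i \<omega>) ` D)"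
      then obtain b where b: "\<forall>i\<in>D. g i \<omega> \<le> b" by (auto simp: bdd_above_def)
      obtain n :: nat where "b \<le> real n" using real_arch_simple by blast
      then have "\<forall>i\<in>D. g i \<omega> \<le> real n" using b by (blast intro: order_trans)
      then show "\<exists>n::nat. \<forall>i\<in>D. g i \<omega> \<le> real n" ..
    qed (auto simp: bdd_above_def)
    then show ?thesis
      by (simp, intro sets.sets_Collect_countable_Ex sets.sets_Collect_countable_All' D(1) le)
  qed
  define S :: "'b set" where "S = {\<omega>\<in>space N. bdd_above ((\<lambda>i. g i \<omega>) ` D)}"
  have nb: "(SUP i\<in>D. g i \<omega>) = (THE x. False)" if "\<not> bdd_above ((\<lambda>i. g i \<omega>) ` D)" for \<omega>
    using that unfolding Sup_real_def Least_def bdd_above_def by (metis (mono_tags, lifting))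
  show ?thesis
  proof (subst borel_measurable_iff_le, intro allI)
    fix a
    have "(SUP i\<in>D. g i \<omega>) \<le> a \<longleftrightarrow> (if \<omega> \<in> S then \<forall>i\<in>D. g i \<omega> \<le> a else (THE x. False) \<le> a)"
      if "\<omega> \<in> space N" for \<omega>
      using that D(2) nb[of \<omega>] by (auto simp: S_def cSUP_le_iff)
    then have "{\<omega> \<in> space N. (SUP i\<in>D. g i \<omega>) \<le> a}
        = {\<omega>\<in>space N. (\<omega> \<in> S \<and> (\<forall>i\<in>D. g i \<omega> \<le> a)) \<or> (\<omega> \<notin> S \<and> (THE x. False) \<le> a)}"
      by (intro Collect_cong conj_cong refl) simp
    also have "\<dots> \<in> sets N"
    proof -
      have S: "{\<omega>\<in>space N. \<omega> \<in> S} \<in> sets N" using bdd by (simp add: S_def)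
      show ?thesis
        by (intro sets.sets_Collect_disj sets.sets_Collect_conj sets.sets_Collect_countable_All'
            sets.sets_Collect_const sets.sets_Collect_neg S D(1) le)
    qed
    finally show "{\<omega> \<in> space N. (SUP i\<in>D. g i \<omega>) \<le> a} \<in> sets N" .
  qed
qed

text \<open>The real supremum is defined from the set of upper bounds alone, and density leaves that
  set unchanged, whether or not it is empty.\<close>

lemma Sup_dense_eq:
  fixes f :: "'a::topological_space \<Rightarrow> real"
  assumes D: "\<And>X. open X \<Longrightarrow> X \<noteq> {} \<Longrightarrow> \<exists>d\<in>D. d \<in> X" and f: "continuous_on UNIV f"
  shows "(SUP t\<in>D. f t) = (SUP t. f t)"
proof -
  have "(\<forall>x\<in>f ` D. x \<le> z) \<longleftrightarrow> (\<forall>x\<in>range f. x \<le> z)" for z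
    using Ball_dense_closed_iff[of D f UNIV "{..z}"] D f by auto
  then show ?thesis unfolding Sup_real_def by simp
qed

lemma measurable_gamma_of [measurable]:
  "gamma_of \<in> borel_measurable (Cspace :: ('a::{metric_space, second_countable_topology} \<Rightarrow> real) measure)"
proof -
  obtain D :: "'a set" where D: "countable D" "\<And>X. open X \<Longrightarrow> X \<noteq> {} \<Longrightarrow> \<exists>d\<in>D. d \<in> X"
    using countable_dense_setE by blast
  have "D \<noteq> {}" using D(2)[of UNIV] by auto
  then have "(\<lambda>f. SUP t\<in>D. f t) \<in> borel_measurable (Cspace :: ('a \<Rightarrow> real) measure)"
    using D(1) by (intro borel_measurable_Sup_countable measurable_eval_Cspace) auto
  moreover have "(SUP t\<in>D. f t) = gamma_of f" if "f \<in> space Cspace" for f :: "'a \<Rightarrow> real"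
    using that D(2) Sup_dense_eq[of D f] by (simp add: gamma_of_def Cset_def)
  ultimately show ?thesis by (subst (asm) measurable_cong) assumption+
qed

section \<open>Functions vanishing at infinity\<close>

lemma tendsto_0_at_infinity_iff:
  fixes f :: "'a::real_normed_vector \<Rightarrow> real"
  assumes f: "\<And>t. 0 \<le> f t"
  shows "(f \<longlongrightarrow> 0) at_infinity \<longleftrightarrow> (\<forall>n. \<exists>m::nat. \<forall>t\<in>- cball 0 (real m). f t \<le> 1 / real (Suc n))"
proof
  assume "(f \<longlongrightarrow> 0) at_infinity"
  then have *: "\<forall>e>0. \<exists>b. \<forall>x. b \<le> norm x \<longrightarrow> \<bar>f x\<bar> < e"
    by (simp add: tendsto_iff eventually_at_infinity dist_real_def)
  show "\<forall>n. \<exists>m::nat. \<forall>t\<in>- cball 0 (real m). f t \<le> 1 / real (Suc n)"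
  proof
    fix n
    obtain b where b: "\<forall>x. b \<le> norm x \<longrightarrow> \<bar>f x\<bar> < 1 / real (Suc n)" 
      using *[rule_format, of "1 / real (Suc n)"] by auto
    obtain m :: nat where bm: "b \<le> real m" using real_arch_simple by blast
    have "\<forall>t\<in>- cball 0 (real m). f t \<le> 1 / real (Suc n)"
    proof (intro ballI)
      fix t :: 'a assume "t \<in> - cball 0 (real m)"
      then have "b \<le> norm t" using bm by auto
      then show "f t \<le> 1 / real (Suc n)" using b by (meson abs_le_D1 less_imp_le)
    qed
    then show "\<exists>m::nat. \<forall>t\<in>- cball 0 (real m). f t \<le> 1 / real (Suc n)" ..
  qed
next
  assume *: "\<forall>n. \<exists>m::nat. \<forall>t\<in>- cball 0 (real m). f t \<le> 1 / real (Suc n)"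
  show "(f \<longlongrightarrow> 0) at_infinity"
    unfolding tendsto_iff
  proof (intro allI impI)
    fix e :: real assume "e > 0"
    then obtain n where n: "1 / real (Suc n) < e" using nat_approx_posE by blast
    obtain m :: nat where m: "\<forall>t\<in>- cball 0 (real m). f t \<le> 1 / real (Suc n)" using * by blast
    show "\<forall>\<^sub>F x in at_infinity. dist (f x) 0 < e"
      unfolding eventually_at_infinity
    proof (intro exI[of _ "real m + 1"] allI impI)
      fix x :: 'a assume "real m + 1 \<le> norm x"
      then have "f x \<le> 1 / real (Suc n)" using bspec[OF m, of x] by auto
      then show "dist (f x) 0 < e" using n f[of x] by (simp add: dist_real_def)
    qed
  qed
qed

text \<open>The almost sure range of \<open>W\<close>. The criterion above bounds \<open>f\<close>
  on complements of closed balls, which are open, by closed conditions, so membership can be tested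
  on a countable dense set.\<close>

definition Cvan :: "('a::real_normed_vector \<Rightarrow> real) set" where
  "Cvan = {f\<in>Cset. (f \<longlongrightarrow> 0) at_infinity}"

lemma sets_Cvan [measurable]:
  "(Cvan :: ('a::{real_normed_vector, second_countable_topology} \<Rightarrow> real) set) \<in> sets Cspace"
proof -
  obtain D :: "'a set" where D: "countable D" "\<And>X. open X \<Longrightarrow> X \<noteq> {} \<Longrightarrow> \<exists>d\<in>D. d \<in> X"
    using countable_dense_setE by blast
  have "Cvan = {f\<in>space Cspace. \<forall>n. \<exists>m::nat. \<forall>t\<in>- cball 0 (real m) \<inter> D. f t \<in> {..1 / real (Suc n)}}"
  proof -
    have "(\<forall>t\<in>- cball 0 (real m) \<inter> D. f t \<in> {..1 / real (Suc n)}) \<longleftrightarrow> (\<forall>t\<in>- cball 0 (real m). f t \<in> {..1 / real (Suc n)})"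
      if "f \<in> Cset" for f :: "'a \<Rightarrow> real" and m n
      using that D(2) by (intro Ball_dense_closed_iff[symmetric]) (auto simp: Cset_def)
    then show ?thesis
      unfolding Cvan_def by (auto simp: tendsto_0_at_infinity_iff Cset_def)
  qed
  also have "\<dots> \<in> sets Cspace"
  proof (intro sets.sets_Collect_countable_All sets.sets_Collect_countable_Ex sets.sets_Collect_countable_All')
    show "{f\<in>space Cspace. f t \<in> {..1 / real (Suc n)}} \<in> sets Cspace" for t :: 'a and n
      using measurable_eval_Cspace[measurable] by measurable
    show "countable (- cball 0 (real m) \<inter> D)" for m using D(1) by auto
  qed
  finally show ?thesis .
qed

section \<open>Measurability of the lexicographic argsup\<close>

lemma closed_argsup:
  fixes f :: "'a::metric_space \<Rightarrow> real"
  assumes "f \<in> Cset" shows "closed (argsup f)"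
proof -
  have "argsup f = (\<Inter>s. {t. f s \<le> f t})" by (auto simp: argsup_def)
  moreover have "closed {t. f s \<le> f t}" for s
    using assms by (intro closed_Collect_le) (auto simp: Cset_def)
  ultimately show ?thesis by auto
qed

text \<open>Measurability of a random closed set through its hitting events. Compact sets are used
  because continuous functions attain their extrema on them; \<open>measurable_hits_closed\<close>
  passes to closed sets by exhausting with balls.\<close>

definition measurable_hits :: "'b measure \<Rightarrow> ('b \<Rightarrow> 'a::metric_space set) \<Rightarrow> bool" where
  "measurable_hits N S \<longleftrightarrow> (\<forall>\<omega>\<in>space N. closed (S \<omega>)) \<and>
     (\<forall>K. compact K \<longrightarrow> {\<omega>\<in>space N. S \<omega> \<inter> K \<noteq> {}} \<in> sets N)"

lemma measurable_hits_closed: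
  fixes S :: "'b \<Rightarrow> 'a::euclidean_space set"
  assumes "measurable_hits N S" "closed C"
  shows "{\<omega>\<in>space N. S \<omega> \<inter> C \<noteq> {}} \<in> sets N"
proof -
  have "{\<omega>\<in>space N. S \<omega> \<inter> C \<noteq> {}} = (\<Union>n::nat. {\<omega>\<in>space N. S \<omega> \<inter> (C \<inter> cball 0 (real n)) \<noteq> {}})"
  proof (intro set_eqI iffI)
    fix \<omega> assume "\<omega> \<in> {\<omega>\<in>space N. S \<omega> \<inter> C \<noteq> {}}"
    then obtain x where x: "\<omega> \<in> space N" "x \<in> S \<omega>" "x \<in> C" by blast
    obtain n :: nat where "norm x \<le> real n" using real_arch_simple by blast
    then have "x \<in> S \<omega> \<inter> (C \<inter> cball 0 (real n))" using x by simp
    then show "\<omega> \<in> (\<Union>n::nat. {\<omega>\<in>space N. S \<omega> \<inter> (C \<inter> cball 0 (real n)) \<noteq> {}})" using x(1) by blast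
  qed blast
  also have "\<dots> \<in> sets N"
    using assms by (intro sets.countable_UN) (auto simp: measurable_hits_def closed_Int_compact)
  finally show ?thesis .
qed

text \<open>A nonempty \<open>K\<close> meets \<open>argsup f\<close> exactly if its maximum is a
  global upper bound, that is, if every rational level exceeded anywhere is exceeded in
  \<open>K\<close>. By continuity both places may be sought in countable dense sets.\<close>

lemma measurable_hits_argsup:
  "measurable_hits Cspace (argsup :: ('a::euclidean_space \<Rightarrow> real) \<Rightarrow> 'a set)"
  unfolding measurable_hits_def
proof (intro conjI ballI allI impI)
  show "closed (argsup f)" if "f \<in> space Cspace" for f :: "'a \<Rightarrow> real"
    using that closed_argsup by auto
  fix K :: "'a set" assume K: "compact K"
  obtain D :: "'a set" where D: "countable D" "\<And>X. open X \<Longrightarrow> X \<noteq> {} \<Longrightarrow> \<exists>d\<in>D. d \<in> X"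
    using countable_dense_setE by blast
  obtain E where E: "countable E" "E \<subseteq> K" "K \<subseteq> closure E"
    using separable by blast
  have hit: "argsup f \<inter> K \<noteq> {} \<longleftrightarrow> K \<noteq> {} \<and> (\<forall>s\<in>D. \<forall>q\<in>\<rat>. f s > q \<longrightarrow> (\<exists>t\<in>E. f t > q))"
    if f: "f \<in> Cset" for f
  proof -
    have cont: "continuous_on A f" for A using f by (auto simp: Cset_def intro: continuous_on_subset)
    show ?thesis
    proof (intro iffI conjI ballI impI)
      fix s q assume "argsup f \<inter> K \<noteq> {}" "f s > q"
      then obtain t where t: "t \<in> K" "f t > q"
        by (auto simp: argsup_def) (meson less_le_trans)
      have "open (f -` {q<..})" by (intro open_vimage cont) auto
      moreover have "t \<in> f -` {q<..} \<inter> closure E" using t E by auto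
      ultimately have "f -` {q<..} \<inter> E \<noteq> {}" using open_Int_closure_eq_empty by blast
      then show "\<exists>t\<in>E. f t > q" by auto
    next
      assume *: "K \<noteq> {} \<and> (\<forall>s\<in>D. \<forall>q\<in>\<rat>. f s > q \<longrightarrow> (\<exists>t\<in>E. f t > q))"
      then obtain t where t: "t \<in> K" "\<And>s. s \<in> K \<Longrightarrow> f s \<le> f t"
        using continuous_attains_sup[OF K _ cont] by blast
      have "f s \<le> f t" for s
      proof (rule ccontr)
        assume "\<not> f s \<le> f t"
        then have "s \<in> f -` {f t<..}" by auto
        then have "f -` {f t<..} \<noteq> {}" by blast
        moreover have "open (f -` {f t<..})" by (intro open_vimage cont) auto
        ultimately obtain d where d: "d \<in> D" "f d > f t" using D(2)[of "f -` {f t<..}"] by auto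
        then obtain q where q: "q \<in> \<rat>" "f t < q" "q < f d" using Rats_dense_in_real by blast
        then obtain e where "e \<in> E" "f e > q" using * d by blast
        then show False using t(2)[of e] E(2) q by auto
      qed
      then show "argsup f \<inter> K \<noteq> {}" using t(1) by (auto simp: argsup_def)
    qed auto
  qed
  have "{f\<in>space Cspace. argsup f \<inter> K \<noteq> {}}
    = {f\<in>space Cspace. K \<noteq> {} \<and> (\<forall>s\<in>D. \<forall>q\<in>\<rat>. f s > q \<longrightarrow> (\<exists>t\<in>E. f t > q))}"
    using hit by auto
  also have "\<dots> \<in> sets Cspace"
    using D(1) E(1) countable_rat
    by (intro sets.sets_Collect_conj sets.sets_Collect_const sets.sets_Collect_countable_All'
        sets.sets_Collect_imp sets.sets_Collect_countable_Ex'
        borel_measurable_less borel_measurable_const measurable_eval_Cspace)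
  finally show "{f\<in>space Cspace. argsup f \<inter> K \<noteq> {}} \<in> sets Cspace" .
qed

text \<open>Meant for \<open>p\<close> a coordinate: lexicographic minimisation is a succession of
  such minimisations, each over the minimisers left by the one before.\<close>

lemma measurable_hits_min:
  fixes S :: "'b \<Rightarrow> 'a::euclidean_space set" and p :: "'a \<Rightarrow> real"
  assumes S: "measurable_hits N S" and p: "continuous_on UNIV p"
  shows "measurable_hits N (\<lambda>\<omega>. {s\<in>S \<omega>. \<forall>s'\<in>S \<omega>. p s \<le> p s'})"
  unfolding measurable_hits_def
proof (intro conjI ballI allI impI)
  have cont: "continuous_on A p" for A using p by (auto intro: continuous_on_subset)
  have clp: "closed {x. p x \<le> a}" for a by (intro closed_Collect_le cont) auto
  show "closed {s\<in>S \<omega>. \<forall>s'\<in>S \<omega>. p s \<le> p s'}" if "\<omega> \<in> space N" for \<omega>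
  proof -
    have "{s\<in>S \<omega>. \<forall>s'\<in>S \<omega>. p s \<le> p s'} = S \<omega> \<inter> (\<Inter>s'\<in>S \<omega>. {x. p x \<le> p s'})" by auto
    moreover have "closed (\<Inter>s'\<in>S \<omega>. {x. p x \<le> p s'})" using clp by (intro closed_INT) auto
    ultimately show ?thesis using S that by (auto simp: measurable_hits_def closed_Int)
  qed
  fix K :: "'a set" assume K: "compact K"
  \<comment> \<open>The right-hand side says that no point of \<open>S \<omega>\<close> has a
    smaller value of \<open>p\<close> than the best point in \<open>K\<close>. The strict inequality
    \<open>p x < q\<close> is written as a countable union of closed conditions, so that only hits
    of closed sets occur.\<close>
  have hit: "{s\<in>S \<omega>. \<forall>s'\<in>S \<omega>. p s \<le> p s'} \<inter> K \<noteq> {} \<longleftrightarrow>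
      S \<omega> \<inter> K \<noteq> {} \<and> (\<forall>q\<in>\<rat>. (\<exists>n. S \<omega> \<inter> {x. p x \<le> q - 1 / real (Suc n)} \<noteq> {}) \<longrightarrow> S \<omega> \<inter> (K \<inter> {x. p x \<le> q}) \<noteq> {})"
    if "\<omega> \<in> space N" for \<omega>
  proof (intro iffI conjI ballI impI)
    fix q assume "{s\<in>S \<omega>. \<forall>s'\<in>S \<omega>. p s \<le> p s'} \<inter> K \<noteq> {}"
      "\<exists>n. S \<omega> \<inter> {x. p x \<le> q - 1 / real (Suc n)} \<noteq> {}"
    then obtain s s' n where s: "s \<in> S \<omega>" "s \<in> K" "p s \<le> p s'" "s' \<in> S \<omega>" "p s' \<le> q - 1 / real (Suc n)" by blast
    have "0 < 1 / real (Suc n)" by simp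
    then have "p s \<le> q" using s by linarith
    then show "S \<omega> \<inter> (K \<inter> {x. p x \<le> q}) \<noteq> {}" using s by auto
  next
    assume *: "S \<omega> \<inter> K \<noteq> {} \<and> (\<forall>q\<in>\<rat>. (\<exists>n. S \<omega> \<inter> {x. p x \<le> q - 1 / real (Suc n)} \<noteq> {}) \<longrightarrow> S \<omega> \<inter> (K \<inter> {x. p x \<le> q}) \<noteq> {})"
    have "compact (S \<omega> \<inter> K)" using S K that by (auto simp: measurable_hits_def closed_Int_compact)
    then have "\<exists>s\<in>S \<omega> \<inter> K. \<forall>s'\<in>S \<omega> \<inter> K. p s \<le> p s'"
      using * by (intro continuous_attains_inf cont) auto
    then obtain s where s: "s \<in> S \<omega> \<inter> K" "\<And>s'. s' \<in> S \<omega> \<inter> K \<Longrightarrow> p s \<le> p s'"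
      by meson
    have "p s \<le> p s'" if s': "s' \<in> S \<omega>" for s'
    proof (rule ccontr)
      assume "\<not> p s \<le> p s'"
      then obtain q where q: "q \<in> \<rat>" "p s' < q" "q < p s"
        using Rats_dense_in_real[of "p s'" "p s"] by auto
      obtain n where "1 / real (Suc n) < q - p s'" using nat_approx_posE[of "q - p s'"] q by auto
      then have "S \<omega> \<inter> {x. p x \<le> q - 1 / real (Suc n)} \<noteq> {}" using s' by auto
      then obtain x where "x \<in> S \<omega> \<inter> K" "p x \<le> q" using * q by blast
      then show False using s(2)[of x] q by auto
    qed
    then show "{s\<in>S \<omega>. \<forall>s'\<in>S \<omega>. p s \<le> p s'} \<inter> K \<noteq> {}" using s by auto
  qed auto
  have "{\<omega>\<in>space N. {s\<in>S \<omega>. \<forall>s'\<in>S \<omega>. p s \<le> p s'} \<inter> K \<noteq> {}}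
     = {\<omega>\<in>space N. S \<omega> \<inter> K \<noteq> {} \<and> (\<forall>q\<in>\<rat>. (\<exists>n. S \<omega> \<inter> {x. p x \<le> q - 1 / real (Suc n)} \<noteq> {}) \<longrightarrow> S \<omega> \<inter> (K \<inter> {x. p x \<le> q}) \<noteq> {})}"
    using hit by (intro Collect_cong conj_cong refl) simp
  also have "\<dots> \<in> sets N"
    using K clp countable_rat
    by (intro sets.sets_Collect_conj sets.sets_Collect_countable_All' sets.sets_Collect_imp
        sets.sets_Collect_countable_Ex measurable_hits_closed[OF S] compact_imp_closed[OF K]
        closed_Int clp)
  finally show "{\<omega>\<in>space N. {s\<in>S \<omega>. \<forall>s'\<in>S \<omega>. p s \<le> p s'} \<inter> K \<noteq> {}} \<in> sets N" .
qed

section \<open>Lexicographic minima, one coordinate at a time\<close>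

definition lex_le_on :: "'d set \<Rightarrow> real^('d::{finite,linorder}) \<Rightarrow> real^('d::{finite,linorder}) \<Rightarrow> bool" where
  "lex_le_on J x y \<longleftrightarrow> (\<forall>j\<in>J. x$j = y$j) \<or> (\<exists>k\<in>J. x$k < y$k \<and> (\<forall>j\<in>J. j < k \<longrightarrow> x$j = y$j))"

lemma lex_le_on_UNIV: "lex_le_on UNIV = lex_le"
  by (auto simp: lex_le_on_def lex_le_def fun_eq_iff vec_eq_iff)

text \<open>Unless \<open>J\<close> is \<open>UNIV\<close>, the comparison ignores the remaining
  coordinates and there may be many minimisers. Their set shrinks as coordinates are added in
  increasing order.\<close>

definition lex_mins_on :: "'d set \<Rightarrow> (real^('d::{finite,linorder})) set \<Rightarrow> (real^('d::{finite,linorder})) set" where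
  "lex_mins_on J S = {s\<in>S. \<forall>s'\<in>S. lex_le_on J s s'}"

lemma lex_le_on_antisym:
  assumes "lex_le_on J x y" "lex_le_on J y x" shows "\<forall>j\<in>J. x$j = y$j"
  using assms unfolding lex_le_on_def by (metis linorder_neqE less_asym less_irrefl)

lemma lex_le_antisym: "lex_le x y \<Longrightarrow> lex_le y x \<Longrightarrow> x = y"
  using lex_le_on_antisym[of UNIV x y] by (simp add: lex_le_on_UNIV vec_eq_iff)

text \<open>All minimisers over \<open>J\<close> agree on the coordinates in \<open>J\<close>, so
  the later coordinate \<open>b\<close> alone decides between them.\<close>

lemma lex_mins_on_insert:
  assumes b: "\<And>a. a \<in> J \<Longrightarrow> a < b"
  shows "lex_mins_on (insert b J) S = {s\<in>lex_mins_on J S. \<forall>s'\<in>lex_mins_on J S. s$b \<le> s'$b}"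
proof (intro set_eqI iffI)
  fix s assume s: "s \<in> lex_mins_on (insert b J) S"
  have le: "lex_le_on J s s'" if "lex_le_on (insert b J) s s'" for s'
    using that b unfolding lex_le_on_def by auto
  have "s$b \<le> s'$b" if s': "s' \<in> lex_mins_on J S" for s'
  proof -
    have 1: "lex_le_on (insert b J) s s'" using s s' by (auto simp: lex_mins_on_def)
    have "\<forall>j\<in>J. s$j = s'$j"
      using s s' le by (intro lex_le_on_antisym) (auto simp: lex_mins_on_def)
    then show ?thesis using 1 b unfolding lex_le_on_def by (auto simp: less_le)
  qed
  then show "s \<in> {s\<in>lex_mins_on J S. \<forall>s'\<in>lex_mins_on J S. s$b \<le> s'$b}"
    using s le by (auto simp: lex_mins_on_def)
next
  fix s assume s: "s \<in> {s\<in>lex_mins_on J S. \<forall>s'\<in>lex_mins_on J S. s$b \<le> s'$b}"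
  have "lex_le_on (insert b J) s s'" if s': "s' \<in> S" for s'
  proof (cases "\<forall>j\<in>J. s$j = s'$j")
    case True
    \<comment> \<open>As \<open>s'\<close> ties with \<open>s\<close> on \<open>J\<close>, it is
      itself a minimiser over \<open>J\<close>, and the coordinate \<open>b\<close> compares the
      two.\<close>
    have "lex_le_on J s' x" if "x \<in> S" for x
    proof -
      have "lex_le_on J s x" using s that by (auto simp: lex_mins_on_def)
      then show ?thesis using True unfolding lex_le_on_def by auto
    qed
    then have "s' \<in> lex_mins_on J S" using s' by (auto simp: lex_mins_on_def)
    then have "s$b \<le> s'$b" using s by auto
    then show ?thesis using True b unfolding lex_le_on_def by (auto simp: less_le)
  next
    case False
    have "lex_le_on J s s'" using s s' by (auto simp: lex_mins_on_def)
    then obtain k where k: "k \<in> J" "s$k < s'$k" "\<forall>j\<in>J. j < k \<longrightarrow> s$j = s'$j"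
      using False by (auto simp: lex_le_on_def)
    have "\<not> b < k" using b[OF k(1)] by simp
    then have "\<exists>k\<in>insert b J. s$k < s'$k \<and> (\<forall>j\<in>insert b J. j < k \<longrightarrow> s$j = s'$j)"
      using k by (intro bexI[of _ k]) auto
    then show ?thesis by (simp add: lex_le_on_def)
  qed
  then show "s \<in> lex_mins_on (insert b J) S" using s by (auto simp: lex_mins_on_def)
qed

lemma measurable_hits_lex_mins:
  fixes S :: "'b \<Rightarrow> (real^('d::{finite,linorder})) set"
  assumes "measurable_hits N S" "finite J"
  shows "measurable_hits N (\<lambda>\<omega>. lex_mins_on J (S \<omega>))"
  using assms(2)
proof (induction J rule: finite_linorder_max_induct)
  case empty
  then show ?case using assms(1) by (simp add: lex_mins_on_def lex_le_on_def)
next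
  case (insert b A)
  then show ?case
    using measurable_hits_min[OF insert.IH, of "\<lambda>s. s$b"]
    by (simp add: lex_mins_on_insert continuous_on_component)
qed

text \<open>Compactness survives every stage, so the next coordinate attains its minimum.\<close>

lemma lex_mins_on_nonempty:
  fixes S :: "(real^('d::{finite,linorder})) set"
  assumes "compact S" "S \<noteq> {}" "finite J"
  shows "compact (lex_mins_on J S) \<and> lex_mins_on J S \<noteq> {}"
  using assms(3)
proof (induction J rule: finite_linorder_max_induct)
  case empty
  then show ?case using assms(1,2) by (simp add: lex_mins_on_def lex_le_on_def)
next
  case (insert b A)
  let ?L = "lex_mins_on A S"
  have cont: "continuous_on X (\<lambda>s::(real,'d) vec. s$b)" for X by (intro continuous_intros)
  obtain s where s: "s \<in> ?L" "\<And>s'. s' \<in> ?L \<Longrightarrow> s$b \<le> s'$b"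
    using continuous_attains_inf[of ?L "\<lambda>s. s$b"] insert.IH cont by blast
  have eq: "{s\<in>?L. \<forall>s'\<in>?L. s$b \<le> s'$b} = ?L \<inter> {x. x$b \<le> s$b}"
    using s by (auto intro: order_trans)
  have "closed {x::(real,'d) vec. x$b \<le> s$b}" by (intro closed_Collect_le continuous_intros)
  then have "compact (?L \<inter> {x. x$b \<le> s$b})" using insert.IH by (intro compact_Int_closed) auto
  then show ?case using insert.hyps s by (auto simp: lex_mins_on_insert eq)
qed

text \<open>A lexicographic infimum of a closed set is attained: otherwise increasing its last
  coordinate a little would give a greater lower bound.\<close>

lemma is_lex_inf_closed_mem:
  fixes S :: "(real^('d::{finite,linorder})) set"
  assumes S: "closed S" and x: "is_lex_inf S x"
  shows "x \<in> S"
proof (rule ccontr)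
  assume nx: "x \<notin> S"
  define m where "m = Max (UNIV :: 'd set)"
  have m: "k \<le> m" for k by (simp add: m_def)
  have "\<exists>s\<in>S. norm (s - x) < e" if e: "e > 0" for e
  proof -
    define z where "z = (\<chi> k. if k = m then x$k + e else x$k)"
    have "\<not> lex_le z x"
    proof
      assume "lex_le z x"
      moreover have "z \<noteq> x" using e by (auto simp: z_def vec_eq_iff)
      ultimately obtain k where "z$k < x$k" by (auto simp: lex_le_def)
      then show False using e by (auto simp: z_def split: if_splits)
    qed
    then obtain s where s: "s \<in> S" "\<not> lex_le z s" using x by (auto simp: is_lex_inf_def)
    have "lex_le x s" "x \<noteq> s" using x s nx by (auto simp: is_lex_inf_def)
    then obtain k where k: "x$k < s$k" "\<forall>j<k. x$j = s$j" by (auto simp: lex_le_def)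
    \<comment> \<open>If \<open>x\<close> were below \<open>s\<close> already before the last
      coordinate, raising the last coordinate of \<open>x\<close> would leave \<open>z\<close> below
      \<open>s\<close>.\<close>
    have "k = m"
    proof (rule ccontr)
      assume "k \<noteq> m"
      then have "k < m" using m[of k] by simp
      then have "lex_le z s" using k unfolding lex_le_def z_def by (auto intro!: exI[of _ k])
      then show False using s by simp
    qed
    have "s$m < x$m + e"
    proof (rule ccontr)
      assume *: "\<not> s$m < x$m + e"
      show False
      proof (cases "s$m = x$m + e")
        case True
        have "z$j = s$j" for j
          using True k \<open>k = m\<close> m[of j] by (cases "j = m") (auto simp: z_def)
        then show False using s(2) by (simp add: lex_le_def vec_eq_iff)
      next
        case False
        then have "lex_le z s" using k * \<open>k = m\<close> unfolding lex_le_def z_def by (auto intro!: exI[of _ m])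
        then show False using s by simp
      qed
    qed
    moreover have "s - x = (s$m - x$m) *\<^sub>R axis m 1"
      using k \<open>k = m\<close> m by (auto simp: vec_eq_iff axis_def less_le)
    ultimately show ?thesis using k \<open>k = m\<close> s by (intro bexI[of _ s]) auto
  qed
  then have "x \<in> closure S" by (auto simp: closure_approachable dist_norm)
  then show False using S nx by simp
qed

lemma is_lex_inf_closed_iff:
  assumes "closed S" shows "is_lex_inf S x \<longleftrightarrow> x \<in> lex_mins_on UNIV S"
  using is_lex_inf_closed_mem[OF assms, of x]
  by (auto simp: lex_mins_on_def is_lex_inf_def lex_le_on_UNIV)

lemma is_lex_inf_unique: "is_lex_inf S x \<Longrightarrow> is_lex_inf S y \<Longrightarrow> x = y"
  unfolding is_lex_inf_def by (meson lex_le_antisym)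

lemma lex_inf_eqI: "is_lex_inf S x \<Longrightarrow> lex_inf S = x"
  unfolding lex_inf_def using is_lex_inf_unique by blast

text \<open>Functions without a lexicographic infimum all share the unspecified value \<open>THE x. False\<close>.\<close>

lemma measurable_tau_of [measurable]: "tau_of \<in> measurable Cspace borel"
  unfolding borel_eq_closed
proof (rule measurable_measure_of)
  fix C :: "(real^('d::{finite,linorder})) set" assume "C \<in> Collect closed"
  then have C: "closed C" by simp
  let ?L = "\<lambda>f::(real,'d) vec \<Rightarrow> real. lex_mins_on UNIV (argsup f)"
  have hits: "measurable_hits Cspace ?L"
    by (intro measurable_hits_lex_mins measurable_hits_argsup) simp
  have "tau_of f \<in> C \<longleftrightarrow> ?L f \<inter> C \<noteq> {} \<or> (\<not> ?L f \<inter> UNIV \<noteq> {} \<and> (THE x. False) \<in> C)" if "f \<in> Cset" for f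
  proof (cases "\<exists>x. is_lex_inf (argsup f) x")
    case True
    then obtain x where x: "is_lex_inf (argsup f) x" ..
    have "?L f = {x}"
      using x is_lex_inf_unique is_lex_inf_closed_iff[OF closed_argsup[OF that]] by blast
    then show ?thesis using lex_inf_eqI[OF x] by (auto simp: tau_of_def)
  next
    case False
    then have "is_lex_inf (argsup f) = (\<lambda>_. False)" by auto
    moreover have "?L f = {}" using False is_lex_inf_closed_iff[OF closed_argsup[OF that]] by blast
    ultimately show ?thesis by (simp add: tau_of_def lex_inf_def)
  qed
  then have "tau_of -` C \<inter> space Cspace
      = {f\<in>space Cspace. ?L f \<inter> C \<noteq> {} \<or> (\<not> ?L f \<inter> UNIV \<noteq> {} \<and> (THE x. False) \<in> C)}"
    by auto
  also have "\<dots> \<in> sets Cspace"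
    by (intro sets.sets_Collect_disj sets.sets_Collect_conj sets.sets_Collect_neg sets.sets_Collect_const
        measurable_hits_closed[OF hits] C closed_UNIV)
  finally show "tau_of -` C \<inter> space Cspace \<in> sets Cspace" .
qed auto

text \<open>If \<open>f r > 0\<close>, then \<open>f\<close> is smaller than \<open>f r\<close>
  outside some ball, so its maximum over the ball is global and \<open>argsup f\<close> is compact,
  which gives the lexicographic minimum. For the zero function \<open>argsup\<close> is the whole
  space and has no lexicographic lower bound; hence the condition on \<open>gamma_of\<close> in the
  last two claims.\<close>

lemma Cvan_max:
  fixes f :: "real^('d::{finite,linorder}) \<Rightarrow> real"
  assumes f: "f \<in> Cvan"
  shows "bdd_above (range f)" and "0 \<le> gamma_of f" and "f t \<le> gamma_of f"
    and "0 < gamma_of f \<Longrightarrow> is_lex_inf (argsup f) (tau_of f)"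
    and "0 < gamma_of f \<Longrightarrow> f (tau_of f) = gamma_of f"
proof -
  have C: "f \<in> Cset" and nn: "\<And>t. 0 \<le> f t" and cont: "continuous_on A f" for A
    using f by (auto simp: Cvan_def Cset_def intro: continuous_on_subset)
  have lim: "\<forall>n. \<exists>m::nat. \<forall>t\<in>- cball 0 (real m). f t \<le> 1 / real (Suc n)"
    using f nn by (simp add: Cvan_def tendsto_0_at_infinity_iff)
  have attain: "\<exists>s\<in>K. \<forall>t\<in>K. f t \<le> f s" if "compact K" "K \<noteq> {}" for K
    using continuous_attains_sup[OF that cont] .
  obtain m where m: "\<forall>t\<in>- cball 0 (real m). f t \<le> 1" using lim[rule_format, of 0] by auto
  obtain s where s: "\<forall>t\<in>cball 0 (real m). f t \<le> f s" using attain[of "cball 0 (real m)"] by auto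
  have "f t \<le> max 1 (f s)" for t using m s by (cases "t \<in> cball 0 (real m)") (auto simp: le_max_iff_disj)
  then show bdd: "bdd_above (range f)" by (auto simp: bdd_above_def)
  show le: "f t \<le> gamma_of f" for t unfolding gamma_of_def by (intro cSUP_upper bdd) auto
  show "0 \<le> gamma_of f" using nn[of 0] le[of 0] by simp
  assume pos: "0 < gamma_of f"
  then obtain r where r: "f r > 0" unfolding gamma_of_def using bdd by (subst (asm) less_cSUP_iff) auto
  obtain n where n: "1 / real (Suc n) < f r" using nat_approx_posE[OF r] by auto
  obtain k where k: "\<forall>t\<in>- cball 0 (real k). f t \<le> 1 / real (Suc n)" using lim by blast
  have rk: "r \<in> cball 0 (real k)" using n k by force
  obtain x where x: "x \<in> cball 0 (real k)" "\<forall>t\<in>cball 0 (real k). f t \<le> f x"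
    using attain[of "cball 0 (real k)"] by auto
  have fx: "f t \<le> f x" for t
  proof (cases "t \<in> cball 0 (real k)")
    case False
    then have "f t \<le> 1 / real (Suc n)" using k by blast
    moreover have "f r \<le> f x" using x rk by blast
    ultimately show ?thesis using n by linarith
  qed (use x in blast)
  then have ne: "argsup f \<noteq> {}" by (auto simp: argsup_def)
  have "argsup f \<subseteq> cball 0 (real k)"
  proof
    fix t assume "t \<in> argsup f"
    then have "f r \<le> f t" by (auto simp: argsup_def)
    then show "t \<in> cball 0 (real k)" using k n by force
  qed
  then have "compact (argsup f)"
    using closed_argsup[OF C] bounded_cball bounded_subset by (auto simp: compact_eq_bounded_closed)
  then obtain y where "y \<in> lex_mins_on UNIV (argsup f)" using lex_mins_on_nonempty[OF _ ne, of UNIV] by auto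
  then have y: "is_lex_inf (argsup f) y" using is_lex_inf_closed_iff[OF closed_argsup[OF C]] by blast
  then show inf: "is_lex_inf (argsup f) (tau_of f)" using lex_inf_eqI[OF y] by (simp add: tau_of_def)
  have "tau_of f \<in> argsup f" by (rule is_lex_inf_closed_mem[OF closed_argsup[OF C] inf])
  then show "f (tau_of f) = gamma_of f"
    unfolding gamma_of_def by (intro antisym cSUP_upper bdd cSUP_least) (auto simp: argsup_def)
qed

section \<open>Laplace functionals of Poisson processes\<close>

text \<open>\<open>enn2real\<close> maps infinity to 0, so \<open>exp (- enn2real x)\<close> would
  be 1 there, whereas a Laplace functional must be 0 where its sum diverges.\<close>

definition nexp :: "ennreal \<Rightarrow> real" where
  "nexp x = (if x = \<infinity> then 0 else exp (- enn2real x))"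

lemma nexp_ennreal [simp]: "0 \<le> r \<Longrightarrow> nexp (ennreal r) = exp (- r)"
  by (simp add: nexp_def)

lemma nexp_0 [simp]: "nexp 0 = 1"
  by (simp add: nexp_def)

lemma nexp_nonneg [simp]: "0 \<le> nexp x"
  by (simp add: nexp_def)

lemma nexp_le_1 [simp]: "nexp x \<le> 1"
  by (simp add: nexp_def)

lemma nexp_add: "nexp (x + y) = nexp x * nexp y"
  by (cases x; cases y) (auto simp: nexp_def mult_exp_exp simp flip: ennreal_plus)

lemma nexp_sum: "nexp (\<Sum>i\<in>I. f i) = (\<Prod>i\<in>I. nexp (f i))"
  by (induction I rule: infinite_finite_induct) (auto simp: nexp_add)

lemma measurable_nexp [measurable]: "nexp \<in> borel_measurable borel"
  unfolding nexp_def by measurable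

text \<open>Infinity is treated by hand because \<open>enn2real\<close> is discontinuous there, and
  sums over a point process may diverge.\<close>

lemma tendsto_nexp:
  assumes f: "(f \<longlongrightarrow> x) F"
  shows "((\<lambda>n. nexp (f n)) \<longlongrightarrow> nexp x) F"
proof (cases "x = \<infinity>")
  case True
  have "((\<lambda>n. nexp (f n)) \<longlongrightarrow> 0) F"
  proof (rule order_tendstoI)
    fix a :: real assume "0 < a"
    \<comment> \<open>Beyond \<open>b\<close> the exponential is below \<open>a\<close>. The maximum
      with 0 is needed because \<open>ennreal\<close> truncates negative numbers.\<close>
    define b where "b = max 0 (1 - ln a)"
    have "\<forall>\<^sub>F n in F. ennreal b < f n"
      using order_tendstoD(1)[OF f, of "ennreal b"] True by simp
    then show "\<forall>\<^sub>F n in F. nexp (f n) < a"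
    proof eventually_elim
      case (elim n)
      show ?case
      proof (cases "f n")
        case (real r)
        moreover have "0 \<le> b" by (simp add: b_def)
        ultimately have "b < r" using elim by (simp add: ennreal_less_iff)
        then have "- r < ln a" by (simp add: b_def)
        then have "exp (- r) < a" using \<open>0 < a\<close> by (metis exp_less_cancel_iff exp_ln)
        then show ?thesis using real by simp
      qed (use \<open>0 < a\<close> in \<open>simp add: nexp_def\<close>)
    qed
  next
    fix a :: real assume "a < 0"
    then show "\<forall>\<^sub>F n in F. a < nexp (f n)" by (intro always_eventually allI) (rule less_le_trans[OF _ nexp_nonneg])
  qed
  then show ?thesis using True by (simp add: nexp_def)
next
  case False
  then have "((\<lambda>n. exp (- enn2real (f n))) \<longlongrightarrow> exp (- enn2real x)) F"
    using f by (intro tendsto_intros tendsto_enn2real) (auto simp: less_top)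
  moreover have "\<forall>\<^sub>F n in F. f n < \<infinity>"
    using order_tendstoD(2)[OF f, of \<infinity>] False by (simp add: less_top)
  then have "\<forall>\<^sub>F n in F. exp (- enn2real (f n)) = nexp (f n)"
    by eventually_elim (auto simp: nexp_def)
  ultimately show ?thesis using False by (simp add: nexp_def tendsto_cong)
qed

lemma pp_count_eq_suminf: "pp_count X A \<omega> = (\<Sum>i. indicator A (X i \<omega>))"
proof -
  have "pp_count X A \<omega> = (\<integral>\<^sup>+i. indicator {i. X i \<omega> \<in> A} i \<partial>count_space UNIV)"
    by (simp add: pp_count_def)
  also have "\<dots> = (\<Sum>i. indicator {i. X i \<omega> \<in> A} i)" by (rule nn_integral_count_space_nat)
  finally show ?thesis by (simp add: indicator_def)
qed

lemma pp_count_cases: "pp_count X A \<omega> = \<infinity> \<or> (\<exists>k. pp_count X A \<omega> = of_nat k)"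
  by (simp add: pp_count_def emeasure_count_space)

lemma pp_count_mult_suminf: "c * pp_count X A \<omega> = (\<Sum>i. c * indicator A (X i \<omega>))"
  by (simp add: pp_count_eq_suminf ennreal_suminf_cmult)

lemma measurable_pp_count:
  assumes "\<And>i. {\<omega>\<in>space M. X i \<omega> \<in> A} \<in> sets M"
  shows "pp_count X A \<in> borel_measurable M"
proof -
  have "(\<lambda>\<omega>. indicator A (X i \<omega>) :: ennreal) \<in> borel_measurable M" for i
  proof -
    have "(\<lambda>\<omega>. indicator {\<omega>\<in>space M. X i \<omega> \<in> A} \<omega> :: ennreal) \<in> borel_measurable M"
      using assms by (intro borel_measurable_indicator)
    then show ?thesis by (rule measurable_cong[THEN iffD1, rotated]) (simp add: indicator_def)
  qed
  then show ?thesis unfolding pp_count_eq_suminf[abs_def] by (rule borel_measurable_suminf_order)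
qed

lemma poisson_sums: "(\<lambda>k. exp (- l) * l ^ k / fact k * z ^ k) sums exp (- l * (1 - z :: real))"
proof -
  have "(\<lambda>k. exp (- l) * ((l * z) ^ k /\<^sub>R fact k)) sums (exp (- l) * exp (l * z))"
    by (intro sums_mult exp_converges)
  moreover have "exp (- l) * exp (l * z) = exp (- l * (1 - z))"
    by (simp add: mult_exp_exp algebra_simps)
  ultimately show ?thesis by (simp add: power_mult_distrib divide_inverse mult_ac)
qed

lemma nn_integral_nexp_poisson:
  assumes M: "prob_space M" and N: "N \<in> borel_measurable M" and "0 \<le> l" "0 \<le> s"
    and P: "\<And>k. measure M {\<omega>\<in>space M. N \<omega> = of_nat k} = exp (- l) * l ^ k / fact k"
  shows "(\<integral>\<^sup>+\<omega>. ennreal (nexp (ennreal s * N \<omega>)) \<partial>M) = ennreal (exp (- l * (1 - exp (- s))))"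
proof -
  interpret prob_space M by fact
  let ?E = "\<lambda>k::nat. {\<omega>\<in>space M. N \<omega> = of_nat k}"
  have E [measurable]: "?E k \<in> sets M" for k using N by measurable
  have disj: "disjoint_family ?E" by (auto simp: disjoint_family_on_def)
  have "(\<lambda>k. measure M (?E k)) sums measure M (\<Union>k. ?E k)"
    using disj by (intro finite_measure_UNION) auto
  moreover have "(\<lambda>k. measure M (?E k)) sums 1"
    using poisson_sums[of l 1] by (simp add: P)
  \<comment> \<open>The Poisson weights already exhaust the total mass, so the value infinity has
    probability 0.\<close>
  ultimately have "prob (\<Union>k. ?E k) = 1" by (rule sums_unique2)
  then have "AE \<omega> in M. \<omega> \<in> (\<Union>k. ?E k)" by (subst AE_in_set_eq_1) auto
  then have "(\<integral>\<^sup>+\<omega>. ennreal (nexp (ennreal s * N \<omega>)) \<partial>M)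
    = (\<integral>\<^sup>+\<omega>. (\<Sum>k. ennreal (exp (- s) ^ k) * indicator (?E k) \<omega>) \<partial>M)"
  proof (intro nn_integral_cong_AE, eventually_elim)
    case (elim \<omega>)
    then obtain k where k: "\<omega> \<in> space M" "N \<omega> = of_nat k" by auto
    have "(\<Sum>j. ennreal (exp (- s) ^ j) * indicator (?E j) \<omega>)
       = (\<Sum>j\<in>{k}. ennreal (exp (- s) ^ j) * indicator (?E j) \<omega>)"
      by (rule suminf_finite) (auto simp: indicator_def k)
    moreover have "ennreal s * N \<omega> = ennreal (s * real k)"
      using k \<open>0 \<le> s\<close> by (simp add: ennreal_mult ennreal_of_nat_eq_real_of_nat)
    ultimately show ?case
      using k \<open>0 \<le> s\<close> by (simp add: exp_of_nat_mult[symmetric] mult.commute)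
  qed
  also have "\<dots> = (\<Sum>k. \<integral>\<^sup>+\<omega>. ennreal (exp (- s) ^ k) * indicator (?E k) \<omega> \<partial>M)"
    by (rule nn_integral_suminf) measurable
  also have "\<dots> = (\<Sum>k. ennreal (exp (- l) * l ^ k / fact k * exp (- s) ^ k))"
    using \<open>0 \<le> l\<close> by (simp add: nn_integral_cmult_indicator emeasure_eq_measure P flip: ennreal_mult)
      (simp add: mult_ac)
  also have "\<dots> = ennreal (exp (- l * (1 - exp (- s))))"
  proof -
    have "(\<lambda>k. exp (- l) * l ^ k / fact k * exp (- s) ^ k) sums exp (- l * (1 - exp (- s)))"
      by (rule poisson_sums)
    then show ?thesis using \<open>0 \<le> l\<close> by (subst suminf_ennreal2) (auto simp: sums_iff)
  qed
  finally show ?thesis .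
qed

lemma poisson_pp_nexp_counts:
  fixes n :: nat
  assumes pp: "poisson_pp M \<mu> X"
    and A: "\<And>j. j < n \<Longrightarrow> A j \<in> sets \<mu>" "\<And>j. j < n \<Longrightarrow> emeasure \<mu> (A j) < \<infinity>"
    and disj: "disjoint_family_on A {..<n}" and s: "\<And>j. j < n \<Longrightarrow> 0 \<le> s j"
  shows "(\<integral>\<^sup>+\<omega>. ennreal (nexp (\<Sum>j<n. ennreal (s j) * pp_count X (A j) \<omega>)) \<partial>M)
    = ennreal (nexp (\<Sum>j<n. ennreal (1 - exp (- s j)) * emeasure \<mu> (A j)))"
proof -
  have M: "prob_space M" using pp by (simp add: poisson_pp_def)
  interpret prob_space M by fact
  have meas: "pp_count X (A j) \<in> borel_measurable M" if "j < n" for j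
    using pp A(1)[OF that] by (intro measurable_pp_count) (auto simp: poisson_pp_def)
  have ind: "indep_vars (\<lambda>_. borel) (\<lambda>j \<omega>. pp_count X (A j) \<omega>) {..<n}"
  proof -
    have "(\<forall>j<n. A j \<in> sets \<mu> \<and> emeasure \<mu> (A j) < \<infinity>) \<and> disjoint_family_on A {..<n}"
      using A disj by simp
    moreover have "\<forall>(n::nat) A. (\<forall>j<n. A j \<in> sets \<mu> \<and> emeasure \<mu> (A j) < \<infinity>) \<and> disjoint_family_on A {..<n} \<longrightarrow>
        indep_vars (\<lambda>_. borel) (\<lambda>j \<omega>. pp_count X (A j) \<omega>) {..<n}"
      using pp unfolding poisson_pp_def by (elim conjE)
    ultimately show ?thesis by (elim allE impE)
  qed
  have "indep_vars (\<lambda>_. borel) (\<lambda>j \<omega>. ennreal (nexp (ennreal (s j) * pp_count X (A j) \<omega>))) {..<n}"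
    by (rule indep_vars_compose2[OF ind, where Y = "\<lambda>j x. ennreal (nexp (ennreal (s j) * x))"]) simp
  then have "(\<integral>\<^sup>+\<omega>. (\<Prod>j<n. ennreal (nexp (ennreal (s j) * pp_count X (A j) \<omega>))) \<partial>M)
     = (\<Prod>j<n. \<integral>\<^sup>+\<omega>. ennreal (nexp (ennreal (s j) * pp_count X (A j) \<omega>)) \<partial>M)"
    by (intro indep_vars_nn_integral finite_lessThan) auto
  also have "\<dots> = (\<Prod>j<n. ennreal (nexp (ennreal (1 - exp (- s j)) * emeasure \<mu> (A j))))"
  proof (intro prod.cong refl)
    fix j assume "j \<in> {..<n}"
    then have j: "j < n" by simp
    define l where "l = enn2real (emeasure \<mu> (A j))"
    have l: "0 \<le> l" "emeasure \<mu> (A j) = ennreal l" using A(2)[OF j] by (auto simp: l_def less_top)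
    have "measure M {\<omega>\<in>space M. pp_count X (A j) \<omega> = of_nat k} = exp (- l) * l ^ k / fact k" for k
      using pp A j by (auto simp: poisson_pp_def l_def)
    from nn_integral_nexp_poisson[OF M meas[OF j] l(1) s[OF j] this]
    show "(\<integral>\<^sup>+\<omega>. ennreal (nexp (ennreal (s j) * pp_count X (A j) \<omega>)) \<partial>M)
       = ennreal (nexp (ennreal (1 - exp (- s j)) * emeasure \<mu> (A j)))"
      using l s[OF j] by (simp add: mult_ac flip: ennreal_mult)
  qed
  finally show ?thesis by (simp add: nexp_sum prod_ennreal)
qed

text \<open>The level sets of the positive values are disjoint and of finite measure, so their
  counts are independent and Poisson. The level set of 0 may have infinite measure but contributes
  neither to the sum nor to the integral.\<close>

lemma poisson_pp_laplace_simple: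
  assumes pp: "poisson_pp M \<mu> X" and sp: "\<And>i \<omega>. \<omega> \<in> space M \<Longrightarrow> X i \<omega> \<in> space \<mu>"
    and f: "simple_function \<mu> f" "\<And>x. 0 \<le> f x"
    and fin: "\<And>y. 0 < y \<Longrightarrow> emeasure \<mu> {x\<in>space \<mu>. f x = y} < \<infinity>"
  shows "(\<integral>\<^sup>+\<omega>. ennreal (nexp (\<Sum>i. ennreal (f (X i \<omega>)))) \<partial>M)
    = ennreal (nexp (\<integral>\<^sup>+x. ennreal (1 - exp (- f x)) \<partial>\<mu>))"
proof -
  let ?Y = "f ` space \<mu> - {0 :: real}"
  have "finite ?Y" using simple_functionD(1)[OF f(1)] by simp
  then obtain y where y: "bij_betw y {..<card ?Y} ?Y"
    using ex_bij_betw_nat_finite[of ?Y] by (auto simp: atLeast0LessThan)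
  define n where "n = card ?Y"
  define A where "A j = {x\<in>space \<mu>. f x = y j}" for j
  have yY: "y j \<in> ?Y" if "j < n" for j using y that by (auto simp: bij_betw_def n_def)
  have ypos: "0 < y j" if "j < n" for j using yY[OF that] f(2) by (force simp: less_le)
  have inj: "inj_on y {..<n}" using y by (simp add: bij_betw_def n_def)
  have A: "A j \<in> sets \<mu>" for j
  proof -
    have "f -` {y j} \<inter> space \<mu> \<in> sets \<mu>" using f(1) by (rule simple_functionD)
    moreover have "A j = f -` {y j} \<inter> space \<mu>" by (auto simp: A_def)
    ultimately show ?thesis by simp
  qed
  have disj: "disjoint_family_on A {..<n}"
    unfolding disjoint_family_on_def A_def using inj_onD[OF inj] by fastforce
  \<comment> \<open>Applied twice: with \<open>g = ennreal\<close> to the exponent and with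
    \<open>1 - exp (- y)\<close> to the integrand on the right. Both vanish at 0.\<close>
  have decomp: "g (f x) = (\<Sum>j<n. g (y j) * indicator (A j) x)" if "x \<in> space \<mu>" "g 0 = 0" for g :: "real \<Rightarrow> ennreal" and x
  proof (cases "f x = 0")
    case True
    then show ?thesis using ypos that by (auto simp: A_def indicator_def intro!: sum.neutral[symmetric])
  next
    case False
    then have "f x \<in> y ` {..<n}" using that y by (auto simp: bij_betw_def n_def)
    then obtain k where k: "k < n" "f x = y k" by auto
    have "(\<Sum>j<n. g (y j) * indicator (A j) x) = (\<Sum>j<n. if j = k then g (y j) else 0)"
      using inj k that by (intro sum.cong) (auto simp: A_def indicator_def inj_on_def)
    then show ?thesis using k by simp
  qed
  have "(\<integral>\<^sup>+\<omega>. ennreal (nexp (\<Sum>i. ennreal (f (X i \<omega>)))) \<partial>M)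
      = (\<integral>\<^sup>+\<omega>. ennreal (nexp (\<Sum>j<n. ennreal (y j) * pp_count X (A j) \<omega>)) \<partial>M)"
  proof (intro nn_integral_cong arg_cong[where f = "\<lambda>x. ennreal (nexp x)"])
    fix \<omega> assume "\<omega> \<in> space M"
    then have "(\<Sum>i. ennreal (f (X i \<omega>))) = (\<Sum>i. \<Sum>j<n. ennreal (y j) * indicator (A j) (X i \<omega>))"
      using sp by (intro suminf_cong decomp) auto
    also have "\<dots> = (\<Sum>j<n. \<Sum>i. ennreal (y j) * indicator (A j) (X i \<omega>))"
      by (intro suminf_sum summableI)
    finally show "(\<Sum>i. ennreal (f (X i \<omega>))) = (\<Sum>j<n. ennreal (y j) * pp_count X (A j) \<omega>)"
      by (simp add: pp_count_mult_suminf)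
  qed
  also have "\<dots> = ennreal (nexp (\<Sum>j<n. ennreal (1 - exp (- y j)) * emeasure \<mu> (A j)))"
  proof (rule poisson_pp_nexp_counts[OF pp A _ disj])
    show "emeasure \<mu> (A j) < \<infinity>" if "j < n" for j
      unfolding A_def by (rule fin[OF ypos[OF that]])
    show "0 \<le> y j" if "j < n" for j using ypos[OF that] by simp
  qed
  also have "(\<Sum>j<n. ennreal (1 - exp (- y j)) * emeasure \<mu> (A j))
      = (\<integral>\<^sup>+x. (\<Sum>j<n. ennreal (1 - exp (- y j)) * indicator (A j) x) \<partial>\<mu>)"
    using A by (subst nn_integral_sum) (auto simp: nn_integral_cmult_indicator)
  also have "\<dots> = (\<integral>\<^sup>+x. ennreal (1 - exp (- f x)) \<partial>\<mu>)"
    by (intro nn_integral_cong) (subst decomp, auto)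
  finally show ?thesis .
qed

lemma suminf_mono_convergence:
  fixes f :: "nat \<Rightarrow> nat \<Rightarrow> ennreal"
  assumes "\<And>i. incseq (\<lambda>n. f n i)" "\<And>i. (\<lambda>n. f n i) \<longlonglongrightarrow> g i"
  shows "(\<lambda>n. \<Sum>i. f n i) \<longlonglongrightarrow> (\<Sum>i. g i)"
proof -
  have "(\<lambda>n. \<integral>\<^sup>+i. f n i \<partial>count_space UNIV) \<longlonglongrightarrow> (\<integral>\<^sup>+i. g i \<partial>count_space UNIV)"
    using assms by (intro nn_integral_LIMSEQ) (auto simp: incseq_def le_fun_def)
  then show ?thesis by (simp add: nn_integral_count_space_nat)
qed

text \<open>Simple functions increase to \<open>h\<close>. The expectations converge because they
  are dominated by 1, the intensity integrals by monotone convergence.\<close>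

lemma poisson_pp_laplace:
  assumes pp: "poisson_pp M \<mu> X" and sp: "\<And>i \<omega>. \<omega> \<in> space M \<Longrightarrow> X i \<omega> \<in> space \<mu>"
    and h: "h \<in> borel_measurable \<mu>" "\<And>x. 0 \<le> h x"
    and fin: "(\<integral>\<^sup>+x. ennreal (1 - exp (- h x)) \<partial>\<mu>) < \<infinity>"
  shows "(\<integral>\<^sup>+\<omega>. ennreal (nexp (\<Sum>i. ennreal (h (X i \<omega>)))) \<partial>M)
    = ennreal (nexp (\<integral>\<^sup>+x. ennreal (1 - exp (- h x)) \<partial>\<mu>))"
proof -
  note h(1)[measurable]
  have M: "prob_space M" using pp by (simp add: poisson_pp_def)
  interpret prob_space M by fact
  have Xm [measurable]: "X i \<in> measurable M \<mu>" for i
    using pp sp by (auto simp: poisson_pp_def measurable_def vimage_def Int_def conj_commute)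
  obtain f where f: "\<And>n. simple_function \<mu> (f n)" "incseq f" "\<And>x. bdd_above (range (\<lambda>n. f n x))"
      "\<And>n x. 0 \<le> f n x" "h = (SUP n. f n)"
    using borel_measurable_implies_simple_function_sequence_real[OF h] by blast
  have hx: "h x = (SUP n. f n x)" for x unfolding f(5) by (simp add: image_image)
  have inc: "incseq (\<lambda>n. f n x)" for x using f(2) by (auto simp: incseq_def le_fun_def)
  have lim: "(\<lambda>n. f n x) \<longlonglongrightarrow> h x" for x
    unfolding hx by (rule LIMSEQ_incseq_SUP[OF f(3) inc])
  have le: "f n x \<le> h x" for n x by (rule incseq_le[OF inc lim])
  have fm [measurable]: "f n \<in> borel_measurable \<mu>" for n
    by (rule borel_measurable_simple_function[OF f(1)])
  have step: "(\<integral>\<^sup>+\<omega>. ennreal (nexp (\<Sum>i. ennreal (f n (X i \<omega>)))) \<partial>M)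
    = ennreal (nexp (\<integral>\<^sup>+x. ennreal (1 - exp (- f n x)) \<partial>\<mu>))" for n
  proof (rule poisson_pp_laplace_simple[OF pp sp f(1) f(4)])
    fix y :: real assume y: "0 < y"
    \<comment> \<open>Markov's inequality: on the level set of \<open>y\<close> the function
      \<open>1 - exp (- h)\<close> is at least \<open>1 - exp (- y)\<close>, which is
      positive.\<close>
    have "ennreal (1 - exp (- y)) * emeasure \<mu> {x\<in>space \<mu>. f n x = y}
       = (\<integral>\<^sup>+x. ennreal (1 - exp (- y)) * indicator {x\<in>space \<mu>. f n x = y} x \<partial>\<mu>)"
      by (intro nn_integral_cmult_indicator[symmetric]) measurable
    also have "\<dots> \<le> (\<integral>\<^sup>+x. ennreal (1 - exp (- h x)) \<partial>\<mu>)"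
      by (intro nn_integral_mono) (auto simp: indicator_def intro!: ennreal_leI le)
    also have "\<dots> < \<infinity>" by fact
    finally show "emeasure \<mu> {x\<in>space \<mu>. f n x = y} < \<infinity>"
      using y by (auto simp: ennreal_mult_less_top)
  qed
  have "(\<lambda>n. \<integral>\<^sup>+\<omega>. ennreal (nexp (\<Sum>i. ennreal (f n (X i \<omega>)))) \<partial>M)
     \<longlonglongrightarrow> (\<integral>\<^sup>+\<omega>. ennreal (nexp (\<Sum>i. ennreal (h (X i \<omega>)))) \<partial>M)"
  proof (rule nn_integral_dominated_convergence[where w = "\<lambda>_. 1"])
    show "AE \<omega> in M. (\<lambda>n. ennreal (nexp (\<Sum>i. ennreal (f n (X i \<omega>))))) \<longlonglongrightarrow> ennreal (nexp (\<Sum>i. ennreal (h (X i \<omega>))))"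
      using lim inc by (intro AE_I2 tendsto_ennrealI tendsto_nexp suminf_mono_convergence)
        (auto simp: incseq_def intro!: ennreal_leI)
    show "AE \<omega> in M. ennreal (nexp (\<Sum>i. ennreal (f n (X i \<omega>)))) \<le> 1" for n
      by (intro AE_I2) simp
    show "(\<integral>\<^sup>+\<omega>. 1 \<partial>M) < \<infinity>" by (simp add: emeasure_space_1)
    show "(\<lambda>\<omega>. ennreal (nexp (\<Sum>i. ennreal (f n (X i \<omega>))))) \<in> borel_measurable M" for n
      by measurable
    show "(\<lambda>\<omega>. ennreal (nexp (\<Sum>i. ennreal (h (X i \<omega>))))) \<in> borel_measurable M"
      by measurable
  qed simp
  moreover have "(\<lambda>n. \<integral>\<^sup>+\<omega>. ennreal (nexp (\<Sum>i. ennreal (f n (X i \<omega>)))) \<partial>M)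
     \<longlonglongrightarrow> ennreal (nexp (\<integral>\<^sup>+x. ennreal (1 - exp (- h x)) \<partial>\<mu>))"
    unfolding step
  proof (intro tendsto_ennrealI tendsto_nexp nn_integral_LIMSEQ)
    show "(\<lambda>x. ennreal (1 - exp (- f n x))) \<in> borel_measurable \<mu>" for n by measurable
    show "incseq (\<lambda>n x. ennreal (1 - exp (- f n x)))"
      using inc by (auto simp: incseq_def le_fun_def intro!: ennreal_leI)
    show "(\<lambda>n. 1 - exp (- f n x)) \<longlonglongrightarrow> 1 - exp (- h x)" for x
      by (intro tendsto_diff tendsto_const tendsto_exp tendsto_minus lim)
  qed
  ultimately show ?thesis by (rule LIMSEQ_unique)
qed

section \<open>Poisson counts recovered from their Laplace functionals\<close>

lemma powser_eq_0_right:
  fixes c :: "nat \<Rightarrow> real"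
  assumes "\<And>z. 0 < z \<Longrightarrow> z < 1 \<Longrightarrow> (\<lambda>k. c k * z ^ k) sums 0"
  shows "c k = 0"
proof (induction k rule: less_induct)
  case (less k)
  \<comment> \<open>The coefficients below \<open>k\<close> vanish, so division by
    \<open>z ^ k\<close> leaves a power series with constant term \<open>c k\<close>. It is 0 on
    \<open>(0,1)\<close>, the range of \<open>exp (- s)\<close> for \<open>s > 0\<close>, and its
    limit at 0 from the right is \<open>c k\<close>.\<close>
  define d where "d j = c (j + k)" for j
  have d: "(\<lambda>j. d j * z ^ j) sums 0" if z: "0 < z" "z < 1" for z
  proof -
    have "(\<lambda>j. c (j + k) * z ^ (j + k)) sums (0 - (\<Sum>i<k. c i * z ^ i))"
      by (rule sums_split_initial_segment[OF assms[OF z]])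
    also have "(\<Sum>i<k. c i * z ^ i) = 0" using less by (intro sum.neutral) auto
    finally have "(\<lambda>j. c (j + k) * z ^ (j + k) / z ^ k) sums (0 / z ^ k)"
      by (intro sums_divide) simp
    then show ?thesis using z by (simp add: d_def power_add)
  qed
  define f where "f z = (\<Sum>j. d j * z ^ j)" for z
  have "(\<lambda>j. d j * z ^ j) sums f z" if "norm z < 1/2" for z
    unfolding f_def using powser_inside[OF sums_summable[OF d[of "1/2"]], of z] that
    by (intro summable_sums) simp
  then have "(f \<longlongrightarrow> d 0) (at 0)" by (intro powser_limit_0[of "1/2"]) auto
  then have "(f \<longlongrightarrow> d 0) (at_right 0)" by (rule filterlim_at_split[THEN iffD1, THEN conjunct2])
  moreover have "\<forall>\<^sub>F z in at_right 0. f z = 0"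
    by (rule eventually_mono[OF eventually_at_right_real[of 0 1]]) (use d in \<open>auto simp: f_def sums_iff\<close>)
  then have "(f \<longlongrightarrow> 0) (at_right 0)" by (rule tendsto_eventually)
  ultimately have "d 0 = 0" by (intro tendsto_unique[of "at_right (0::real)"]) auto
  then show ?case by (simp add: d_def)
qed

text \<open>The Poisson law with mean \<open>l\<close> as a law on \<open>ennreal\<close>, where
  counts take their values. It puts no mass at infinity.\<close>

definition poisson_prob :: "real \<Rightarrow> ennreal set \<Rightarrow> real" where
  "poisson_prob l B = (\<Sum>k. indicator B (of_nat k) * (exp (- l) * l ^ k / fact k))"

lemma poisson_prob_summable:
  fixes l :: real
  assumes "0 \<le> l"
  shows "summable (\<lambda>k. indicator B (of_nat k :: ennreal) * (exp (- l) * l ^ k / fact k))"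
proof (rule summable_comparison_test)
  show "summable (\<lambda>k. exp (- l) * l ^ k / fact k)"
    using poisson_sums[of l 1] by (simp add: sums_iff)
  show "\<exists>N. \<forall>n\<ge>N. norm (indicator B (of_nat n :: ennreal) * (exp (- l) * l ^ n / fact n)) \<le> exp (- l) * l ^ n / fact n"
    using assms by (auto simp: indicator_def)
qed

lemma poisson_prob_nonneg: "0 \<le> l \<Longrightarrow> 0 \<le> poisson_prob l B"
  unfolding poisson_prob_def by (intro suminf_nonneg poisson_prob_summable) auto

lemma poisson_prob_singleton: "poisson_prob l {of_nat k} = exp (- l) * l ^ k / fact k"
proof -
  have "poisson_prob l {of_nat k} = (\<Sum>j\<in>{k}. indicator {of_nat k} (of_nat j :: ennreal) * (exp (- l) * l ^ j / fact j))"
    unfolding poisson_prob_def by (rule suminf_finite) (auto simp: indicator_def)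
  then show ?thesis by simp
qed

lemma poisson_prob_UNIV: "poisson_prob l UNIV = 1"
  using poisson_sums[of l 1] by (simp add: poisson_prob_def sums_iff)

text \<open>Comparing coefficients of the power series in \<open>exp (- s)\<close>; the weight \<open>Y\<close> carries the
  coordinates that the induction below has or has not yet treated.\<close>

lemma poisson_law_from_nexp:
  assumes M: "prob_space M" and Y [measurable]: "Y \<in> borel_measurable M"
    and N [measurable]: "N \<in> borel_measurable M" and "0 \<le> l" "0 \<le> C"
    and cases: "\<And>\<omega>. \<omega> \<in> space M \<Longrightarrow> N \<omega> = \<infinity> \<or> (\<exists>k. N \<omega> = of_nat k)"
    and gen: "\<And>s. 0 \<le> s \<Longrightarrow> (\<integral>\<^sup>+\<omega>. Y \<omega> * ennreal (nexp (ennreal s * N \<omega>)) \<partial>M) = ennreal (C * exp (- l * (1 - exp (- s))))"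
    and B: "B \<in> sets borel"
  shows "(\<integral>\<^sup>+\<omega>. Y \<omega> * indicator B (N \<omega>) \<partial>M) = ennreal (C * poisson_prob l B)"
proof -
  let ?E = "\<lambda>k::nat. {\<omega>\<in>space M. N \<omega> = of_nat k}"
  have total: "(\<integral>\<^sup>+\<omega>. Y \<omega> \<partial>M) = ennreal C" using gen[of 0] by simp
  define a where "a k = enn2real (\<integral>\<^sup>+\<omega>. Y \<omega> * indicator (?E k) \<omega> \<partial>M)" for k
  have a_nonneg: "0 \<le> a k" for k by (simp add: a_def)
  have a: "(\<integral>\<^sup>+\<omega>. Y \<omega> * indicator (?E k) \<omega> \<partial>M) = ennreal (a k)" for k
  proof -
    have "(\<integral>\<^sup>+\<omega>. Y \<omega> * indicator (?E k) \<omega> \<partial>M) \<le> (\<integral>\<^sup>+\<omega>. Y \<omega> \<partial>M)"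
      by (intro nn_integral_mono) (auto simp: indicator_def)
    then have "(\<integral>\<^sup>+\<omega>. Y \<omega> * indicator (?E k) \<omega> \<partial>M) < \<infinity>"
      unfolding total by (rule le_less_trans) simp
    then show ?thesis by (simp add: a_def)
  qed
  \<comment> \<open>Only for \<open>s > 0\<close>: at \<open>s = 0\<close> the product
    \<open>0 * \<infinity>\<close> is 0, so the event \<open>N \<omega> = \<infinity>\<close> would
    contribute to the left side but not to the series.\<close>
  have expand: "(\<integral>\<^sup>+\<omega>. Y \<omega> * ennreal (nexp (ennreal s * N \<omega>)) \<partial>M) = (\<Sum>k. ennreal (a k * exp (- s) ^ k))"
    if "0 < s" for s
  proof -
    have "(\<integral>\<^sup>+\<omega>. Y \<omega> * ennreal (nexp (ennreal s * N \<omega>)) \<partial>M)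
       = (\<integral>\<^sup>+\<omega>. (\<Sum>k. ennreal (exp (- s) ^ k) * (Y \<omega> * indicator (?E k) \<omega>)) \<partial>M)"
    proof (intro nn_integral_cong)
      fix \<omega> assume \<omega>: "\<omega> \<in> space M"
      from cases[OF this] show "Y \<omega> * ennreal (nexp (ennreal s * N \<omega>))
         = (\<Sum>k. ennreal (exp (- s) ^ k) * (Y \<omega> * indicator (?E k) \<omega>))"
      proof
        assume inf: "N \<omega> = \<infinity>"
        then have "(\<Sum>k. ennreal (exp (- s) ^ k) * (Y \<omega> * indicator (?E k) \<omega>)) = (\<Sum>k::nat. 0)"
          by (intro suminf_cong) (auto simp: indicator_def)
        moreover have "ennreal s * N \<omega> = \<infinity>" using inf that by (simp add: ennreal_mult_top)
        ultimately show ?thesis by (simp add: nexp_def)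
      next
        assume "\<exists>k. N \<omega> = of_nat k"
        then obtain k where k: "N \<omega> = of_nat k" ..
        have "(\<Sum>j. ennreal (exp (- s) ^ j) * (Y \<omega> * indicator (?E j) \<omega>))
          = (\<Sum>j\<in>{k}. ennreal (exp (- s) ^ j) * (Y \<omega> * indicator (?E j) \<omega>))"
          by (rule suminf_finite) (auto simp: indicator_def k)
        moreover have "ennreal s * N \<omega> = ennreal (s * real k)"
          using k that by (simp add: ennreal_mult ennreal_of_nat_eq_real_of_nat)
        ultimately show ?thesis
          using k that \<omega> by (simp add: exp_of_nat_mult[symmetric] mult.commute)
      qed
    qed
    also have "\<dots> = (\<Sum>k. \<integral>\<^sup>+\<omega>. ennreal (exp (- s) ^ k) * (Y \<omega> * indicator (?E k) \<omega>) \<partial>M)"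
      by (rule nn_integral_suminf) measurable
    also have "\<dots> = (\<Sum>k. ennreal (a k * exp (- s) ^ k))"
      by (intro suminf_cong, subst nn_integral_cmult)
         (simp_all add: a a_nonneg mult.commute flip: ennreal_mult)
    finally show ?thesis .
  qed
  define b where "b k = C * (exp (- l) * l ^ k / fact k)" for k
  have b_nonneg: "0 \<le> b k" for k using \<open>0 \<le> C\<close> \<open>0 \<le> l\<close> by (simp add: b_def)
  have b_sums: "(\<lambda>k. b k * z ^ k) sums (C * exp (- l * (1 - z)))" for z
    using sums_mult[OF poisson_sums[of l z], of C] by (simp add: b_def mult.assoc)
  have "a k - b k = 0" for k
  proof (rule powser_eq_0_right)
    fix z :: real assume z: "0 < z" "z < 1"
    define s where "s = - ln z"
    have s: "0 < s" "exp (- s) = z" using z by (simp_all add: s_def)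
    have "(\<Sum>k. ennreal (a k * z ^ k)) = ennreal (C * exp (- l * (1 - z)))"
      using expand[OF s(1)] gen[of s] s by simp
    moreover have "(\<lambda>k. ennreal (a k * z ^ k)) sums (\<Sum>k. ennreal (a k * z ^ k))" by (intro summable_sums summableI)
    ultimately have "(\<lambda>k. a k * z ^ k) sums (C * exp (- l * (1 - z)))"
      using z a_nonneg \<open>0 \<le> C\<close> by (simp add: sums_ennreal)
    from sums_diff[OF this b_sums[of z]] show "(\<lambda>k. (a k - b k) * z ^ k) sums 0"
      by (simp add: algebra_simps)
  qed
  then have ab: "a k = b k" for k by simp
  have split: "Y \<omega> * indicator D (N \<omega>) = (\<Sum>k. indicator D (of_nat k) * (Y \<omega> * indicator (?E k) \<omega>)) + Y \<omega> * indicator (D \<inter> {\<infinity>}) (N \<omega>)"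
    if \<omega>: "\<omega> \<in> space M" for D \<omega>
    using cases[OF \<omega>]
  proof
    assume inf: "N \<omega> = \<infinity>"
    then have "(\<Sum>k. indicator D (of_nat k) * (Y \<omega> * indicator (?E k) \<omega>)) = (\<Sum>k::nat. 0)"
      by (intro suminf_cong) (auto simp: indicator_def)
    then show ?thesis using inf by (simp add: indicator_def)
  next
    assume "\<exists>k. N \<omega> = of_nat k"
    then obtain k where k: "N \<omega> = of_nat k" ..
    have "(\<Sum>j. indicator D (of_nat j) * (Y \<omega> * indicator (?E j) \<omega>))
      = (\<Sum>j\<in>{k}. indicator D (of_nat j) * (Y \<omega> * indicator (?E j) \<omega>))"
      by (rule suminf_finite) (auto simp: indicator_def k)
    then show ?thesis using k \<omega> by (simp add: indicator_def)
  qed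
  have int: "(\<integral>\<^sup>+\<omega>. Y \<omega> * indicator D (N \<omega>) \<partial>M)
      = ennreal (C * poisson_prob l D) + (\<integral>\<^sup>+\<omega>. Y \<omega> * indicator (D \<inter> {\<infinity>}) (N \<omega>) \<partial>M)"
    if D [measurable]: "D \<in> sets borel" for D
  proof -
    have "(\<integral>\<^sup>+\<omega>. Y \<omega> * indicator D (N \<omega>) \<partial>M)
      = (\<integral>\<^sup>+\<omega>. (\<Sum>k. indicator D (of_nat k) * (Y \<omega> * indicator (?E k) \<omega>)) \<partial>M) + (\<integral>\<^sup>+\<omega>. Y \<omega> * indicator (D \<inter> {\<infinity>}) (N \<omega>) \<partial>M)"
      by (subst nn_integral_add[symmetric]) (auto intro!: nn_integral_cong split[simplified])
    also have "(\<integral>\<^sup>+\<omega>. (\<Sum>k. indicator D (of_nat k) * (Y \<omega> * indicator (?E k) \<omega>)) \<partial>M)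
      = (\<Sum>k. \<integral>\<^sup>+\<omega>. indicator D (of_nat k) * (Y \<omega> * indicator (?E k) \<omega>) \<partial>M)"
      by (rule nn_integral_suminf) measurable
    also have "\<dots> = (\<Sum>k. ennreal (indicator D (of_nat k :: ennreal) * b k))"
    proof (intro suminf_cong)
      fix k
      show "(\<integral>\<^sup>+\<omega>. indicator D (of_nat k) * (Y \<omega> * indicator (?E k) \<omega>) \<partial>M) = ennreal (indicator D (of_nat k :: ennreal) * b k)"
        by (subst nn_integral_cmult) (simp_all add: a ab, simp add: indicator_def)
    qed
    also have "\<dots> = ennreal (\<Sum>k. indicator D (of_nat k :: ennreal) * b k)"
      using summable_mult[OF poisson_prob_summable[OF \<open>0 \<le> l\<close>, of D], of C] b_nonneg
      by (intro suminf_ennreal2 mult_nonneg_nonneg) (simp_all add: b_def mult_ac)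
    also have "(\<Sum>k. indicator D (of_nat k :: ennreal) * b k) = C * poisson_prob l D"
      unfolding poisson_prob_def
      by (subst suminf_mult[OF poisson_prob_summable[OF \<open>0 \<le> l\<close>], symmetric]) (simp add: b_def mult_ac)
    finally show ?thesis .
  qed
  \<comment> \<open>With \<open>B = UNIV\<close> the finite counts alone already carry the whole
    weight \<open>C\<close>, so nothing is left for the value infinity.\<close>
  have "(\<integral>\<^sup>+\<omega>. Y \<omega> * indicator {\<infinity>} (N \<omega>) \<partial>M) = 0"
    using int[of UNIV] by (simp add: total poisson_prob_UNIV)
  moreover have "(\<integral>\<^sup>+\<omega>. Y \<omega> * indicator (B \<inter> {\<infinity>}) (N \<omega>) \<partial>M) \<le> (\<integral>\<^sup>+\<omega>. Y \<omega> * indicator {\<infinity>} (N \<omega>) \<partial>M)"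
    by (intro nn_integral_mono) (auto simp: indicator_def)
  ultimately show ?thesis using int[OF B] by simp
qed

text \<open>The exponential factors are replaced by indicators one coordinate at a time. After
  \<open>m\<close> stages the coordinates below \<open>m\<close> carry indicators and the others
  exponentials with arbitrary parameters. It is this freedom in \<open>s m\<close> that makes the
  next coordinate accessible to \<open>poisson_law_from_nexp\<close>.\<close>

lemma joint_poisson_from_nexp:
  fixes n :: nat
  assumes M: "prob_space M" and N: "\<And>j. j < n \<Longrightarrow> N j \<in> borel_measurable M"
    and l: "\<And>j. j < n \<Longrightarrow> 0 \<le> l j"
    and cases: "\<And>j \<omega>. \<omega> \<in> space M \<Longrightarrow> N j \<omega> = \<infinity> \<or> (\<exists>k. N j \<omega> = of_nat k)"
    and gen: "\<And>s. (\<And>j. j < n \<Longrightarrow> 0 \<le> s j) \<Longrightarrow> (\<integral>\<^sup>+\<omega>. ennreal (nexp (\<Sum>j<n. ennreal (s j) * N j \<omega>)) \<partial>M)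
        = ennreal (exp (- (\<Sum>j<n. (1 - exp (- s j)) * l j)))"
    and B: "\<And>j. j < n \<Longrightarrow> B j \<in> sets borel"
  shows "(\<integral>\<^sup>+\<omega>. (\<Prod>j<n. indicator (B j) (N j \<omega>)) \<partial>M) = ennreal (\<Prod>j<n. poisson_prob (l j) (B j))"
proof -
  have "(\<integral>\<^sup>+\<omega>. (\<Prod>j<m. indicator (B j) (N j \<omega>)) * ennreal (nexp (\<Sum>j\<in>{m..<n}. ennreal (s j) * N j \<omega>)) \<partial>M)
     = ennreal ((\<Prod>j<m. poisson_prob (l j) (B j)) * exp (- (\<Sum>j\<in>{m..<n}. (1 - exp (- s j)) * l j)))"
    if "m \<le> n" and "\<And>j. j < n \<Longrightarrow> 0 \<le> s j" for m s
    using that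
  proof (induction m arbitrary: s)
    case 0
    then show ?case using gen[of s] by (simp add: atLeast0LessThan)
  next
    case (Suc m)
    then have m: "m < n" by simp
    have ins: "{m..<n} = insert m {Suc m..<n}" using m by auto
    let ?Y = "\<lambda>\<omega>. (\<Prod>j<m. indicator (B j) (N j \<omega>)) * ennreal (nexp (\<Sum>j\<in>{Suc m..<n}. ennreal (s j) * N j \<omega>))"
    let ?C = "(\<Prod>j<m. poisson_prob (l j) (B j)) * exp (- (\<Sum>j\<in>{Suc m..<n}. (1 - exp (- s j)) * l j))"
    have "(\<integral>\<^sup>+\<omega>. ?Y \<omega> * indicator (B m) (N m \<omega>) \<partial>M) = ennreal (?C * poisson_prob (l m) (B m))"
    proof (rule poisson_law_from_nexp[OF M])
      show "?Y \<in> borel_measurable M"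
      proof -
        have [measurable]: "(\<lambda>\<omega>. indicator (B j) (N j \<omega>) :: ennreal) \<in> borel_measurable M" if "j < m" for j
          using N[of j] B[of j] m that by (intro measurable_compose[OF _ borel_measurable_indicator]) auto
        have [measurable]: "N j \<in> borel_measurable M" if "j \<in> {Suc m..<n}" for j using N that by auto
        show ?thesis by (intro borel_measurable_times_ennreal borel_measurable_prod_ennreal) (simp, measurable)
      qed
      show "0 \<le> ?C" using l m by (intro mult_nonneg_nonneg prod_nonneg poisson_prob_nonneg) auto
      fix r :: real assume r: "0 \<le> r"
      have "(\<integral>\<^sup>+\<omega>. ?Y \<omega> * ennreal (nexp (ennreal r * N m \<omega>)) \<partial>M)
        = (\<integral>\<^sup>+\<omega>. (\<Prod>j<m. indicator (B j) (N j \<omega>)) * ennreal (nexp (\<Sum>j\<in>{m..<n}. ennreal ((s(m := r)) j) * N j \<omega>)) \<partial>M)"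
        unfolding ins by (intro nn_integral_cong) (simp add: nexp_add ennreal_mult mult_ac)
      also have "\<dots> = ennreal ((\<Prod>j<m. poisson_prob (l j) (B j)) * exp (- (\<Sum>j\<in>{m..<n}. (1 - exp (- (s(m := r)) j)) * l j)))"
        using Suc r by (intro Suc.IH) auto
      also have "\<dots> = ennreal (?C * exp (- l m * (1 - exp (- r))))"
        unfolding ins by (simp add: exp_add[symmetric] exp_diff[symmetric] algebra_simps mult_exp_exp)
      finally show "(\<integral>\<^sup>+\<omega>. ?Y \<omega> * ennreal (nexp (ennreal r * N m \<omega>)) \<partial>M) = ennreal (?C * exp (- l m * (1 - exp (- r))))" .
    qed (use N m l B cases in auto)
    then show ?case by (simp add: mult_ac)
  qed
  from this[OF order_refl, of "\<lambda>_. 0"] show ?thesis by simp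
qed

text \<open>The converse of \<open>poisson_pp_nexp_counts\<close>. The joint generating function of
  the counts of disjoint sets determines their joint law as a product of Poisson laws, which gives
  both the marginals and the independence.\<close>

lemma poisson_ppI:
  assumes M: "prob_space M"
    and ev: "\<And>i A. A \<in> sets \<mu> \<Longrightarrow> {\<omega>\<in>space M. X i \<omega> \<in> A} \<in> sets M"
    and gen: "\<And>(n::nat) A s. (\<And>j. j < n \<Longrightarrow> A j \<in> sets \<mu>) \<Longrightarrow> (\<And>j. j < n \<Longrightarrow> emeasure \<mu> (A j) < \<infinity>) \<Longrightarrow>
        disjoint_family_on A {..<n} \<Longrightarrow> (\<And>j. j < n \<Longrightarrow> 0 \<le> s j) \<Longrightarrow>
        (\<integral>\<^sup>+\<omega>. ennreal (nexp (\<Sum>j<n. ennreal (s j) * pp_count X (A j) \<omega>)) \<partial>M)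
         = ennreal (nexp (\<Sum>j<n. ennreal (1 - exp (- s j)) * emeasure \<mu> (A j)))"
  shows "poisson_pp M \<mu> X"
proof -
  interpret prob_space M by fact
  have meas: "pp_count X A \<in> borel_measurable M" if "A \<in> sets \<mu>" for A
    using ev[OF that] by (intro measurable_pp_count)
  have joint: "prob {\<omega>\<in>space M. \<forall>j<n. pp_count X (A j) \<omega> \<in> B j} = (\<Prod>j<n. poisson_prob (enn2real (emeasure \<mu> (A j))) (B j))"
    if A: "\<And>j. j < n \<Longrightarrow> A j \<in> sets \<mu>" "\<And>j. j < n \<Longrightarrow> emeasure \<mu> (A j) < \<infinity>"
      "disjoint_family_on A {..<n}" and B: "\<And>j. j < n \<Longrightarrow> B j \<in> sets borel" for n :: nat and A B
  proof -
    let ?l = "\<lambda>j. enn2real (emeasure \<mu> (A j))"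
    have sets: "{\<omega>\<in>space M. \<forall>j<n. pp_count X (A j) \<omega> \<in> B j} \<in> sets M"
    proof -
      have "{\<omega>\<in>space M. \<forall>j\<in>{..<n}. pp_count X (A j) \<omega> \<in> B j} \<in> sets M"
      proof (intro sets.sets_Collect_finite_All finite_lessThan)
        fix j assume "j \<in> {..<n}"
        then have "pp_count X (A j) -` B j \<inter> space M \<in> sets M"
          using meas[OF A(1)] B by (intro measurable_sets[of _ M borel]) auto
        moreover have "{\<omega>\<in>space M. pp_count X (A j) \<omega> \<in> B j} = pp_count X (A j) -` B j \<inter> space M" by auto
        ultimately show "{\<omega>\<in>space M. pp_count X (A j) \<omega> \<in> B j} \<in> sets M" by simp
      qed
      then show ?thesis by (simp only: Ball_def lessThan_iff)
    qed
    have "emeasure M {\<omega>\<in>space M. \<forall>j<n. pp_count X (A j) \<omega> \<in> B j}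
       = (\<integral>\<^sup>+\<omega>. indicator {\<omega>\<in>space M. \<forall>j<n. pp_count X (A j) \<omega> \<in> B j} \<omega> \<partial>M)"
      using sets by (rule nn_integral_indicator[symmetric])
    also have "\<dots> = (\<integral>\<^sup>+\<omega>. (\<Prod>j<n. indicator (B j) (pp_count X (A j) \<omega>)) \<partial>M)"
    proof (intro nn_integral_cong)
      fix \<omega> assume "\<omega> \<in> space M"
      then show "indicator {\<omega>\<in>space M. \<forall>j<n. pp_count X (A j) \<omega> \<in> B j} \<omega>
         = (\<Prod>j<n. indicator (B j) (pp_count X (A j) \<omega>) :: ennreal)"
        by (cases "\<forall>j<n. pp_count X (A j) \<omega> \<in> B j") (auto simp: indicator_def)
    qed
    also have "\<dots> = ennreal (\<Prod>j<n. poisson_prob (?l j) (B j))"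
    proof (rule joint_poisson_from_nexp[OF M])
      fix s :: "nat \<Rightarrow> real" assume s: "\<And>j. j < n \<Longrightarrow> 0 \<le> s j"
      have "(\<Sum>j<n. ennreal (1 - exp (- s j)) * emeasure \<mu> (A j)) = (\<Sum>j<n. ennreal ((1 - exp (- s j)) * ?l j))"
        using A(2) s by (intro sum.cong refl) (simp add: ennreal_mult)
      also have "\<dots> = ennreal (\<Sum>j<n. (1 - exp (- s j)) * ?l j)"
        using s by (intro sum_ennreal) auto
      finally have eq: "(\<Sum>j<n. ennreal (1 - exp (- s j)) * emeasure \<mu> (A j)) = ennreal (\<Sum>j<n. (1 - exp (- s j)) * ?l j)" .
      have "0 \<le> (\<Sum>j<n. (1 - exp (- s j)) * ?l j)"
        using s by (intro sum_nonneg mult_nonneg_nonneg) auto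
      then show "(\<integral>\<^sup>+\<omega>. ennreal (nexp (\<Sum>j<n. ennreal (s j) * pp_count X (A j) \<omega>)) \<partial>M)
        = ennreal (exp (- (\<Sum>j<n. (1 - exp (- s j)) * ?l j)))"
        using gen[of n A s] A s by (simp add: eq)
    next
      show "pp_count X (A j) \<omega> = \<infinity> \<or> (\<exists>k. pp_count X (A j) \<omega> = of_nat k)" for j \<omega> by (rule pp_count_cases)
    qed (use meas A B in auto)
    finally show ?thesis
      by (simp add: emeasure_eq_measure prod_nonneg poisson_prob_nonneg)
  qed
  have single: "prob {\<omega>\<in>space M. pp_count X A \<omega> \<in> B} = poisson_prob (enn2real (emeasure \<mu> A)) B"
    if "A \<in> sets \<mu>" "emeasure \<mu> A < \<infinity>" "B \<in> sets borel" for A B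
    using joint[of 1 "\<lambda>_. A" "\<lambda>_. B"] that by (simp add: disjoint_family_on_def)
  have indep: "indep_vars (\<lambda>_. borel) (\<lambda>j \<omega>. pp_count X (A j) \<omega>) {..<n}"
    if A: "\<And>j. j < n \<Longrightarrow> A j \<in> sets \<mu>" "\<And>j. j < n \<Longrightarrow> emeasure \<mu> (A j) < \<infinity>"
      "disjoint_family_on A {..<n}" for n :: nat and A
  proof (cases "n = 0")
    case True
    then show ?thesis by (simp add: indep_vars_def indep_sets_def)
  next
    case False
    show ?thesis
    proof (subst indep_vars_finite[where E = "\<lambda>_. sets borel"])
      show "\<forall>Aa\<in>{..<n} \<rightarrow> sets borel. prob (\<Inter>j\<in>{..<n}. (\<lambda>\<omega>. pp_count X (A j) \<omega>) -` Aa j \<inter> space M)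
          = (\<Prod>j<n. prob ((\<lambda>\<omega>. pp_count X (A j) \<omega>) -` Aa j \<inter> space M))"
      proof
        fix B :: "nat \<Rightarrow> ennreal set" assume B: "B \<in> {..<n} \<rightarrow> sets borel"
        have "(\<Inter>j\<in>{..<n}. (\<lambda>\<omega>. pp_count X (A j) \<omega>) -` B j \<inter> space M) = {\<omega>\<in>space M. \<forall>j<n. pp_count X (A j) \<omega> \<in> B j}"
          using False by auto
        moreover have "prob ((\<lambda>\<omega>. pp_count X (A j) \<omega>) -` B j \<inter> space M) = poisson_prob (enn2real (emeasure \<mu> (A j))) (B j)" if "j < n" for j
          using single[of "A j" "B j"] A B that by (auto simp: vimage_def Int_def conj_commute)
        ultimately show "prob (\<Inter>j\<in>{..<n}. (\<lambda>\<omega>. pp_count X (A j) \<omega>) -` B j \<inter> space M)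
          = (\<Prod>j<n. prob ((\<lambda>\<omega>. pp_count X (A j) \<omega>) -` B j \<inter> space M))"
          using joint[OF A, of B] B by auto
      qed
    qed (use False meas A sets.sigma_sets_eq[of borel] sets.Int_stable in auto)
  qed
  show ?thesis
    unfolding poisson_pp_def
  proof (intro conjI allI ballI impI)
    show "{\<omega>\<in>space M. X i \<omega> \<in> A} \<in> sets M" if "A \<in> sets \<mu>" for i A using ev that .
    show "prob {\<omega>\<in>space M. pp_count X A \<omega> = of_nat k}
        = exp (- enn2real (emeasure \<mu> A)) * enn2real (emeasure \<mu> A) ^ k / fact k"
      if "A \<in> sets \<mu>" "emeasure \<mu> A < \<infinity>" for A k
      using single[OF that, of "{of_nat k}"] by (simp add: poisson_prob_singleton)
  qed (use M indep in auto)
qed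

section \<open>Marking\<close>

text \<open>The sequences of points and of marks are independent, so Fubini fixes the points first;
  the marks are then independent with common law \<open>P\<close>, and the product
  factorises.\<close>

lemma nn_integral_prod_marks:
  fixes v :: "'u \<times> 'n \<Rightarrow> ennreal"
  assumes M: "prob_space M"
    and UW: "indep_rv2 M (\<Pi>\<^sub>M i\<in>UNIV. \<mu>) (\<lambda>\<omega> i. U i \<omega>) (\<Pi>\<^sub>M i\<in>UNIV. N) (\<lambda>\<omega> i. W i \<omega>)"
    and Wi: "prob_space.indep_vars M (\<lambda>_. N) W UNIV"
    and WP: "\<And>i :: nat. distr M N (W i) = P"
    and v [measurable]: "v \<in> borel_measurable (\<mu> \<Otimes>\<^sub>M N)"
  shows "(\<integral>\<^sup>+\<omega>. (\<Prod>i<n. v (U i \<omega>, W i \<omega>)) \<partial>M) = (\<integral>\<^sup>+\<omega>. (\<Prod>i<n. \<integral>\<^sup>+w. v (U i \<omega>, w) \<partial>P) \<partial>M)"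
proof -
  interpret prob_space M by fact
  let ?A = "\<Pi>\<^sub>M i\<in>(UNIV :: nat set). \<mu>" and ?B = "\<Pi>\<^sub>M i\<in>(UNIV :: nat set). N"
  let ?U = "\<lambda>\<omega> i. U i \<omega>" and ?W = "\<lambda>\<omega> i. W i \<omega>"
  have Um [measurable]: "?U \<in> measurable M ?A" and Wm [measurable]: "?W \<in> measurable M ?B"
    using UW by (auto simp: indep_rv2_def)
  have Wim [measurable]: "W i \<in> measurable M N" for i
    using Wi by (simp add: indep_vars_def)
  have Uim [measurable]: "U i \<in> measurable M \<mu>" for i
    using measurable_compose[OF Um measurable_component_singleton[of i UNIV "\<lambda>_. \<mu>"]] by simp
  interpret PU: prob_space "distr M ?A ?U" by (rule prob_space_distr) fact
  interpret PW: prob_space "distr M ?B ?W" by (rule prob_space_distr) fact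
  \<comment> \<open>Independence, given on rectangles, says that the joint law of the two sequences
    is a product measure.\<close>
  have law: "distr M ?A ?U \<Otimes>\<^sub>M distr M ?B ?W = distr M (?A \<Otimes>\<^sub>M ?B) (\<lambda>\<omega>. (?U \<omega>, ?W \<omega>))"
  proof (rule pair_measure_eqI)
    show "sets (distr M ?A ?U \<Otimes>\<^sub>M distr M ?B ?W) = sets (distr M (?A \<Otimes>\<^sub>M ?B) (\<lambda>\<omega>. (?U \<omega>, ?W \<omega>)))"
      by (simp cong: sets_pair_measure_cong)
    fix A B assume "A \<in> sets (distr M ?A ?U)" "B \<in> sets (distr M ?B ?W)"
    then have AB: "A \<in> sets ?A" "B \<in> sets ?B" by simp_all
    have m: "(\<lambda>\<omega>. (?U \<omega>, ?W \<omega>)) \<in> measurable M (?A \<Otimes>\<^sub>M ?B)" by measurable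
    have "measure M {\<omega>\<in>space M. ?U \<omega> \<in> A \<and> ?W \<omega> \<in> B}
       = measure M {\<omega>\<in>space M. ?U \<omega> \<in> A} * measure M {\<omega>\<in>space M. ?W \<omega> \<in> B}"
      using UW AB by (simp add: indep_rv2_def)
    moreover have "emeasure (distr M ?A ?U) A = measure M {\<omega>\<in>space M. ?U \<omega> \<in> A}"
      using AB by (subst emeasure_distr[OF Um]) (auto simp: emeasure_eq_measure intro!: arg_cong[where f = prob])
    moreover have "emeasure (distr M ?B ?W) B = measure M {\<omega>\<in>space M. ?W \<omega> \<in> B}"
      using AB by (subst emeasure_distr[OF Wm]) (auto simp: emeasure_eq_measure intro!: arg_cong[where f = prob])
    moreover have "emeasure (distr M (?A \<Otimes>\<^sub>M ?B) (\<lambda>\<omega>. (?U \<omega>, ?W \<omega>))) (A \<times> B) = measure M {\<omega>\<in>space M. ?U \<omega> \<in> A \<and> ?W \<omega> \<in> B}"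
      using AB by (subst emeasure_distr[OF m]) (auto simp: emeasure_eq_measure intro!: arg_cong[where f = prob])
    ultimately show "emeasure (distr M ?A ?U) A * emeasure (distr M ?B ?W) B
        = emeasure (distr M (?A \<Otimes>\<^sub>M ?B) (\<lambda>\<omega>. (?U \<omega>, ?W \<omega>))) (A \<times> B)"
      by (simp add: ennreal_mult)
  qed (unfold_locales)
  have inner: "(\<integral>\<^sup>+w. (\<Prod>i<n. v (u i, w i)) \<partial>distr M ?B ?W) = (\<Prod>i<n. \<integral>\<^sup>+w. v (u i, w) \<partial>P)"
    if u: "u \<in> space ?A" for u
  proof -
    have ui: "u i \<in> space \<mu>" for i using u by (auto simp: space_PiM PiE_iff)
    have vm [measurable]: "(\<lambda>w. v (u i, w)) \<in> borel_measurable N" for i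
      using ui v by (rule measurable_Pair2[rotated])
    have "(\<integral>\<^sup>+w. (\<Prod>i<n. v (u i, w i)) \<partial>distr M ?B ?W) = (\<integral>\<^sup>+\<omega>. (\<Prod>i<n. v (u i, W i \<omega>)) \<partial>M)"
    proof (subst nn_integral_distr[OF Wm])
      have "(\<lambda>w. v (u i, w i)) \<in> borel_measurable ?B" for i
        using measurable_compose[OF measurable_component_singleton[of i UNIV "\<lambda>_. N"] vm[of i]] by simp
      then show "(\<lambda>w. \<Prod>i<n. v (u i, w i)) \<in> borel_measurable (distr M ?B ?W)"
        by (simp add: borel_measurable_prod_ennreal)
    qed simp
    also have "\<dots> = (\<Prod>i<n. \<integral>\<^sup>+\<omega>. v (u i, W i \<omega>) \<partial>M)"
    proof (intro indep_vars_nn_integral finite_lessThan)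
      have "indep_vars (\<lambda>_. N) W {..<n}" by (rule indep_vars_subset[OF Wi]) auto
      then show "indep_vars (\<lambda>_. borel) (\<lambda>i \<omega>. v (u i, W i \<omega>)) {..<n}"
        by (rule indep_vars_compose2[where Y = "\<lambda>i w. v (u i, w)"]) (rule vm)
    qed simp
    also have "\<dots> = (\<Prod>i<n. \<integral>\<^sup>+w. v (u i, w) \<partial>P)"
    proof (intro prod.cong refl)
      show "(\<integral>\<^sup>+\<omega>. v (u i, W i \<omega>) \<partial>M) = (\<integral>\<^sup>+w. v (u i, w) \<partial>P)" for i
        unfolding WP[of i, symmetric] by (subst nn_integral_distr) auto
    qed
    finally show ?thesis .
  qed
  have comp1: "(\<lambda>p. fst p i) \<in> measurable (?A \<Otimes>\<^sub>M ?B) \<mu>" for i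
    by (rule measurable_compose[OF measurable_fst measurable_component_singleton]) simp
  have comp2: "(\<lambda>p. snd p i) \<in> measurable (?A \<Otimes>\<^sub>M ?B) N" for i
    by (rule measurable_compose[OF measurable_snd measurable_component_singleton]) simp
  have gm: "(\<lambda>p. \<Prod>i<n. v (fst p i, snd p i)) \<in> borel_measurable (?A \<Otimes>\<^sub>M ?B)"
    by (intro borel_measurable_prod_ennreal measurable_compose[OF _ v] measurable_Pair comp1 comp2)
  have gm': "(\<lambda>p. \<Prod>i<n. v (fst p i, snd p i)) \<in> borel_measurable (distr M ?A ?U \<Otimes>\<^sub>M distr M ?B ?W)"
    using gm by (simp cong: measurable_cong_sets sets_pair_measure_cong)
  have "(\<integral>\<^sup>+\<omega>. (\<Prod>i<n. v (U i \<omega>, W i \<omega>)) \<partial>M)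
     = (\<integral>\<^sup>+p. (\<Prod>i<n. v (fst p i, snd p i)) \<partial>distr M (?A \<Otimes>\<^sub>M ?B) (\<lambda>\<omega>. (?U \<omega>, ?W \<omega>)))"
    using gm by (subst nn_integral_distr) auto
  also have "\<dots> = (\<integral>\<^sup>+u. \<integral>\<^sup>+w. (\<Prod>i<n. v (u i, w i)) \<partial>distr M ?B ?W \<partial>distr M ?A ?U)"
    unfolding law[symmetric] by (subst PW.nn_integral_fst[OF gm', symmetric]) simp
  also have "\<dots> = (\<integral>\<^sup>+u. (\<Prod>i<n. \<integral>\<^sup>+w. v (u i, w) \<partial>P) \<partial>distr M ?A ?U)"
    by (intro nn_integral_cong inner) simp
  also have "\<dots> = (\<integral>\<^sup>+\<omega>. (\<Prod>i<n. \<integral>\<^sup>+w. v (U i \<omega>, w) \<partial>P) \<partial>M)"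
  proof (subst nn_integral_distr[OF Um])
    interpret P: prob_space P unfolding WP[of 0, symmetric] by (rule prob_space_distr) (rule Wim)
    have sP: "sets P = sets N" unfolding WP[of 0, symmetric] by simp
    have "v \<in> borel_measurable (\<mu> \<Otimes>\<^sub>M P)" using v sP by (simp cong: measurable_cong_sets sets_pair_measure_cong)
    then have "(\<lambda>u. \<integral>\<^sup>+w. v (u, w) \<partial>P) \<in> borel_measurable \<mu>"
      by (rule P.borel_measurable_nn_integral_fst)
    then have "(\<lambda>u. \<integral>\<^sup>+w. v (u i, w) \<partial>P) \<in> borel_measurable ?A" for i
      using measurable_compose[OF measurable_component_singleton[of i UNIV "\<lambda>_. \<mu>"]] by simp
    then show "(\<lambda>u. \<Prod>i<n. \<integral>\<^sup>+w. v (u i, w) \<partial>P) \<in> borel_measurable (distr M ?A ?U)"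
      by (simp add: borel_measurable_prod_ennreal)
  qed simp
  finally show ?thesis .
qed

text \<open>Independence of the marks yields only finite products; this passes to all points at
  once.\<close>

lemma prob_limit_nexp_suminf:
  assumes M: "prob_space M" and g: "\<And>i. (\<lambda>\<omega>. g i \<omega>) \<in> borel_measurable M" and nn: "\<And>i \<omega>. \<omega> \<in> space M \<Longrightarrow> 0 \<le> (g i \<omega> :: real)"
  shows "(\<lambda>n. \<integral>\<^sup>+\<omega>. (\<Prod>i<n. ennreal (exp (- g i \<omega>))) \<partial>M) \<longlonglongrightarrow> (\<integral>\<^sup>+\<omega>. ennreal (nexp (\<Sum>i. ennreal (g i \<omega>))) \<partial>M)"
proof -
  interpret prob_space M by fact
  note g [measurable]
  have eq: "(\<Prod>i<n. ennreal (exp (- g i \<omega>))) = ennreal (nexp (\<Sum>i<n. ennreal (g i \<omega>)))" if "\<omega> \<in> space M" for n \<omega>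
    using nn[OF that] by (simp add: nexp_sum prod_ennreal del: sum_ennreal)
  have "(\<lambda>n. \<integral>\<^sup>+\<omega>. ennreal (nexp (\<Sum>i<n. ennreal (g i \<omega>))) \<partial>M) \<longlonglongrightarrow> (\<integral>\<^sup>+\<omega>. ennreal (nexp (\<Sum>i. ennreal (g i \<omega>))) \<partial>M)"
  proof (rule nn_integral_dominated_convergence[where w = "\<lambda>_. 1"])
    show "AE \<omega> in M. (\<lambda>n. ennreal (nexp (\<Sum>i<n. ennreal (g i \<omega>)))) \<longlonglongrightarrow> ennreal (nexp (\<Sum>i. ennreal (g i \<omega>)))"
      by (intro AE_I2 tendsto_ennrealI tendsto_nexp summable_LIMSEQ summableI)
    show "AE \<omega> in M. ennreal (nexp (\<Sum>i<n. ennreal (g i \<omega>))) \<le> 1" for n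
      by (intro AE_I2) simp
    show "(\<integral>\<^sup>+\<omega>. 1 \<partial>M) < \<infinity>" by (simp add: emeasure_space_1)
  qed measurable
  then show ?thesis using eq by (simp cong: nn_integral_cong)
qed

text \<open>Integrating out the marks turns the factor \<open>exp (- g (U i, W i))\<close> into \<open>V (U i)\<close>, so the
  Laplace functional of the marked process at \<open>g\<close> is that of the ground process at \<open>- ln V\<close>.\<close>

lemma poisson_pp_marking:
  assumes U: "poisson_pp M \<mu> U" and Usp: "\<And>i \<omega>. \<omega> \<in> space M \<Longrightarrow> U i \<omega> \<in> space \<mu>"
    and UW: "indep_rv2 M (\<Pi>\<^sub>M i\<in>UNIV. \<mu>) (\<lambda>\<omega> i. U i \<omega>) (\<Pi>\<^sub>M i\<in>UNIV. N) (\<lambda>\<omega> i. W i \<omega>)"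
    and Wi: "prob_space.indep_vars M (\<lambda>_. N) W UNIV"
    and WP: "\<And>i. distr M N (W i) = P"
    and \<Psi>: "\<And>A. A \<in> sets \<eta> \<Longrightarrow> {p\<in>space (\<mu> \<Otimes>\<^sub>M P). \<Psi> p \<in> A} \<in> sets (\<mu> \<Otimes>\<^sub>M P)"
    and \<eta>: "\<And>A. A \<in> sets \<eta> \<Longrightarrow> emeasure \<eta> A = emeasure (\<mu> \<Otimes>\<^sub>M P) {p\<in>space (\<mu> \<Otimes>\<^sub>M P). \<Psi> p \<in> A}"
  shows "poisson_pp M \<eta> (\<lambda>i \<omega>. \<Psi> (U i \<omega>, W i \<omega>))"
proof (rule poisson_ppI)
  show M: "prob_space M" using U by (simp add: poisson_pp_def)
  interpret prob_space M by fact
  have Wim [measurable]: "W i \<in> measurable M N" for i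
    using Wi by (simp add: indep_vars_def)
  have Uim [measurable]: "U i \<in> measurable M \<mu>" for i
    using U Usp by (auto simp: poisson_pp_def measurable_def vimage_def Int_def conj_commute)
  interpret P: prob_space P unfolding WP[of 0, symmetric] by (rule prob_space_distr) (rule Wim)
  have sP: "sets P = sets N" unfolding WP[of 0, symmetric] by simp
  have sPN: "sets (\<mu> \<Otimes>\<^sub>M P) = sets (\<mu> \<Otimes>\<^sub>M N)" using sP by (simp cong: sets_pair_measure_cong)
  have mPN: "borel_measurable (\<mu> \<Otimes>\<^sub>M P) = borel_measurable (\<mu> \<Otimes>\<^sub>M N)"
    using sPN by (rule measurable_cong_sets) simp
  have UWm: "(\<lambda>\<omega>. (U i \<omega>, W i \<omega>)) \<in> measurable M (\<mu> \<Otimes>\<^sub>M P)" for i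
    using sP by (simp add: measurable_Pair cong: measurable_cong_sets)
  show "{\<omega>\<in>space M. \<Psi> (U i \<omega>, W i \<omega>) \<in> A} \<in> sets M" if "A \<in> sets \<eta>" for i A
  proof -
    have "{\<omega>\<in>space M. \<Psi> (U i \<omega>, W i \<omega>) \<in> A} = (\<lambda>\<omega>. (U i \<omega>, W i \<omega>)) -` {p\<in>space (\<mu> \<Otimes>\<^sub>M P). \<Psi> p \<in> A} \<inter> space M"
      using measurable_space[OF UWm[of i]] by auto
    then show ?thesis using measurable_sets[OF UWm \<Psi>[OF that]] by simp
  qed
  fix n :: nat and A and s :: "nat \<Rightarrow> real"
  assume A: "\<And>j. j < n \<Longrightarrow> A j \<in> sets \<eta>" "\<And>j. j < n \<Longrightarrow> emeasure \<eta> (A j) < \<infinity>"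
    "disjoint_family_on A {..<n}" and s: "\<And>j. j < n \<Longrightarrow> 0 \<le> s j"
  let ?S = "space (\<mu> \<Otimes>\<^sub>M P)"
  define D where "D j = {p\<in>?S. \<Psi> p \<in> A j}" for j
  have Dm: "D j \<in> sets (\<mu> \<Otimes>\<^sub>M P)" if "j < n" for j unfolding D_def by (rule \<Psi>[OF A(1)[OF that]])
  have Ddisj: "disjoint_family_on D {..<n}" using A(3) by (auto simp: D_def disjoint_family_on_def)
  \<comment> \<open>The exponent of the joint generating function of the counts, written as one test
    function on pairs.\<close>
  define g where "g p = (\<Sum>j<n. s j * indicator (D j) p)" for p
  have g0: "0 \<le> g p" for p unfolding g_def using s by (intro sum_nonneg mult_nonneg_nonneg) auto
  have gm: "g \<in> borel_measurable (\<mu> \<Otimes>\<^sub>M P)"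
    unfolding g_def using Dm by (intro borel_measurable_sum borel_measurable_times borel_measurable_const borel_measurable_indicator) auto
  define v where "v p = exp (- g p)" for p
  have vm: "v \<in> borel_measurable (\<mu> \<Otimes>\<^sub>M P)" unfolding v_def using gm by measurable
  have vm': "(\<lambda>p. ennreal (v p)) \<in> borel_measurable (\<mu> \<Otimes>\<^sub>M N)" using vm by (simp add: mPN)
  have v1: "v p \<le> 1" for p using g0 by (simp add: v_def)
  have gS: "g p \<le> (\<Sum>j<n. s j)" for p
    unfolding g_def using s by (intro sum_mono) (auto simp: indicator_def)
  \<comment> \<open>A positive lower bound for \<open>v\<close> keeps \<open>V\<close> positive, so
    that \<open>- ln V\<close> satisfies \<open>exp (- h u) = V u\<close>.\<close>
  define \<delta> where "\<delta> = exp (- (\<Sum>j<n. s j))"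
  have v\<delta>: "\<delta> \<le> v p" for p using gS by (simp add: v_def \<delta>_def)
  have \<delta>: "0 < \<delta>" by (simp add: \<delta>_def)
  define V where "V u = enn2real (\<integral>\<^sup>+w. ennreal (v (u, w)) \<partial>P)" for u
  have Vle: "(\<integral>\<^sup>+w. ennreal (v (u, w)) \<partial>P) \<le> 1" for u
  proof -
    have "(\<integral>\<^sup>+w. ennreal (v (u, w)) \<partial>P) \<le> (\<integral>\<^sup>+w. 1 \<partial>P)" using v1 by (intro nn_integral_mono) simp
    then show ?thesis by (simp add: P.emeasure_space_1)
  qed
  have V: "(\<integral>\<^sup>+w. ennreal (v (u, w)) \<partial>P) = ennreal (V u)" for u
    unfolding V_def using Vle[of u] by (simp add: le_less_trans)
  have V1: "V u \<le> 1" for u using Vle[of u] by (simp add: V ennreal_le_1)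
  have V0: "0 < V u" for u
  proof -
    have "(\<integral>\<^sup>+w. ennreal \<delta> \<partial>P) \<le> (\<integral>\<^sup>+w. ennreal (v (u, w)) \<partial>P)"
      using v\<delta> by (intro nn_integral_mono ennreal_leI)
    then have "ennreal \<delta> \<le> ennreal (V u)" by (simp add: V P.emeasure_space_1)
    then show ?thesis using \<delta> by (metis V_def enn2real_nonneg ennreal_le_iff less_le_trans)
  qed
  have Vm [measurable]: "V \<in> borel_measurable \<mu>"
    unfolding V_def using P.borel_measurable_nn_integral_fst[of "\<lambda>p. ennreal (v p)" \<mu>] vm by simp
  define h where "h u = - ln (V u)" for u
  have h0: "0 \<le> h u" for u using V0 V1 by (simp add: h_def)
  have hm [measurable]: "h \<in> borel_measurable \<mu>" unfolding h_def by measurable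
  have hV: "exp (- h u) = V u" for u using V0 by (simp add: h_def)
  \<comment> \<open>As \<open>P\<close> is a probability measure, \<open>1 - V u\<close> is the mean
    of \<open>1 - v (u, w)\<close> over the mark, so the exponent for the ground process is an
    integral over the product intensity.\<close>
  have "(\<integral>\<^sup>+u. ennreal (1 - exp (- h u)) \<partial>\<mu>) = (\<integral>\<^sup>+p. ennreal (1 - v p) \<partial>(\<mu> \<Otimes>\<^sub>M P))"
  proof -
    have "(\<integral>\<^sup>+p. ennreal (1 - v p) \<partial>(\<mu> \<Otimes>\<^sub>M P)) = (\<integral>\<^sup>+u. \<integral>\<^sup>+w. ennreal (1 - v (u, w)) \<partial>P \<partial>\<mu>)"
      using vm by (intro P.nn_integral_fst[symmetric]) measurable
    also have "\<dots> = (\<integral>\<^sup>+u. ennreal (1 - exp (- h u)) \<partial>\<mu>)"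
    proof (intro nn_integral_cong)
      fix u assume u: "u \<in> space \<mu>"
      have [measurable]: "(\<lambda>w. v (u, w)) \<in> borel_measurable P" using u vm by (rule measurable_Pair2[rotated])
      have "(\<integral>\<^sup>+w. ennreal (1 - v (u, w)) \<partial>P) = (\<integral>\<^sup>+w. 1 - ennreal (v (u, w)) \<partial>P)"
        by (intro nn_integral_cong) (simp add: v_def ennreal_minus flip: ennreal_1)
      also have "\<dots> = (\<integral>\<^sup>+w. 1 \<partial>P) - (\<integral>\<^sup>+w. ennreal (v (u, w)) \<partial>P)"
        using v1 Vle[of u] by (intro nn_integral_diff) (auto simp: top_unique)
      also have "\<dots> = ennreal (1 - V u)"
      proof -
        have "1 - ennreal (V u) = ennreal (1 - V u)"
          using V0[of u] by (metis ennreal_1 ennreal_minus less_imp_le)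
        then show ?thesis by (simp add: P.emeasure_space_1 V)
      qed
      finally show "(\<integral>\<^sup>+w. ennreal (1 - v (u, w)) \<partial>P) = ennreal (1 - exp (- h u))" by (simp add: hV)
    qed
    finally show ?thesis by simp
  qed
  also have "\<dots> = (\<integral>\<^sup>+p. (\<Sum>j<n. ennreal (1 - exp (- s j)) * indicator (D j) p) \<partial>(\<mu> \<Otimes>\<^sub>M P))"
  proof (intro nn_integral_cong)
    fix p
    show "ennreal (1 - v p) = (\<Sum>j<n. ennreal (1 - exp (- s j)) * indicator (D j) p)"
    proof (cases "\<exists>k<n. p \<in> D k")
      case True
      then obtain k where k: "k < n" "p \<in> D k" by blast
      have only: "p \<in> D j \<longleftrightarrow> j = k" if "j < n" for j
        using Ddisj k that by (auto simp: disjoint_family_on_def)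
      have "g p = (\<Sum>j<n. if j = k then s j else 0)"
        unfolding g_def using only by (intro sum.cong) auto
      moreover have "(\<Sum>j<n. ennreal (1 - exp (- s j)) * indicator (D j) p) = (\<Sum>j<n. if j = k then ennreal (1 - exp (- s j)) else 0)"
        using only by (intro sum.cong) auto
      ultimately show ?thesis using k by (simp add: v_def)
    next
      case False
      then have "g p = 0" "(\<Sum>j<n. ennreal (1 - exp (- s j)) * indicator (D j) p) = 0"
        unfolding g_def by (auto intro!: sum.neutral)
      then show ?thesis by (simp add: v_def)
    qed
  qed
  also have "\<dots> = (\<Sum>j<n. ennreal (1 - exp (- s j)) * emeasure \<eta> (A j))"
    using Dm A(1) by (subst nn_integral_sum) (auto simp: nn_integral_cmult_indicator \<eta> D_def intro!: sum.cong)
  finally have I: "(\<integral>\<^sup>+u. ennreal (1 - exp (- h u)) \<partial>\<mu>) = (\<Sum>j<n. ennreal (1 - exp (- s j)) * emeasure \<eta> (A j))" .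
  have "(\<integral>\<^sup>+\<omega>. ennreal (nexp (\<Sum>j<n. ennreal (s j) * pp_count (\<lambda>i \<omega>. \<Psi> (U i \<omega>, W i \<omega>)) (A j) \<omega>)) \<partial>M)
     = (\<integral>\<^sup>+\<omega>. ennreal (nexp (\<Sum>i. ennreal (g (U i \<omega>, W i \<omega>)))) \<partial>M)"
  proof (intro nn_integral_cong arg_cong[where f = "\<lambda>x. ennreal (nexp x)"])
    fix \<omega> assume \<omega>: "\<omega> \<in> space M"
    have "ennreal (g (U i \<omega>, W i \<omega>)) = (\<Sum>j<n. ennreal (s j) * indicator (A j) (\<Psi> (U i \<omega>, W i \<omega>)))" for i
    proof -
      have "(U i \<omega>, W i \<omega>) \<in> ?S" using measurable_space[OF UWm \<omega>] .
      then have "g (U i \<omega>, W i \<omega>) = (\<Sum>j<n. s j * indicator (A j) (\<Psi> (U i \<omega>, W i \<omega>)))"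
        unfolding g_def by (simp add: D_def indicator_def)
      also have "ennreal \<dots> = (\<Sum>j<n. ennreal (s j * indicator (A j) (\<Psi> (U i \<omega>, W i \<omega>))))"
        using s by (intro sum_ennreal[symmetric]) auto
      also have "\<dots> = (\<Sum>j<n. ennreal (s j) * indicator (A j) (\<Psi> (U i \<omega>, W i \<omega>)))"
        by (intro sum.cong refl) (simp add: indicator_def)
      finally show ?thesis .
    qed
    then have "(\<Sum>i. ennreal (g (U i \<omega>, W i \<omega>))) = (\<Sum>i. \<Sum>j<n. ennreal (s j) * indicator (A j) (\<Psi> (U i \<omega>, W i \<omega>)))"
      by simp
    also have "\<dots> = (\<Sum>j<n. \<Sum>i. ennreal (s j) * indicator (A j) (\<Psi> (U i \<omega>, W i \<omega>)))"
      by (intro suminf_sum summableI)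
    finally show "(\<Sum>j<n. ennreal (s j) * pp_count (\<lambda>i \<omega>. \<Psi> (U i \<omega>, W i \<omega>)) (A j) \<omega>) = (\<Sum>i. ennreal (g (U i \<omega>, W i \<omega>)))"
      by (simp add: pp_count_mult_suminf)
  qed
  also have "\<dots> = (\<integral>\<^sup>+\<omega>. ennreal (nexp (\<Sum>i. ennreal (h (U i \<omega>)))) \<partial>M)"
  proof (rule LIMSEQ_unique)
    show "(\<lambda>n. \<integral>\<^sup>+\<omega>. (\<Prod>i<n. ennreal (exp (- g (U i \<omega>, W i \<omega>)))) \<partial>M)
        \<longlonglongrightarrow> (\<integral>\<^sup>+\<omega>. ennreal (nexp (\<Sum>i. ennreal (g (U i \<omega>, W i \<omega>)))) \<partial>M)"
      by (intro prob_limit_nexp_suminf M measurable_compose[OF UWm gm] g0)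
    have "(\<integral>\<^sup>+\<omega>. (\<Prod>i<n. ennreal (exp (- g (U i \<omega>, W i \<omega>)))) \<partial>M) = (\<integral>\<^sup>+\<omega>. (\<Prod>i<n. ennreal (exp (- h (U i \<omega>)))) \<partial>M)" for n
      using nn_integral_prod_marks[OF M UW Wi WP vm', of n] by (simp add: V hV) (simp add: v_def)
    moreover have "(\<lambda>n. \<integral>\<^sup>+\<omega>. (\<Prod>i<n. ennreal (exp (- h (U i \<omega>)))) \<partial>M)
        \<longlonglongrightarrow> (\<integral>\<^sup>+\<omega>. ennreal (nexp (\<Sum>i. ennreal (h (U i \<omega>)))) \<partial>M)"
      by (intro prob_limit_nexp_suminf M measurable_compose[OF Uim hm] h0)
    ultimately show "(\<lambda>n. \<integral>\<^sup>+\<omega>. (\<Prod>i<n. ennreal (exp (- g (U i \<omega>, W i \<omega>)))) \<partial>M)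
        \<longlonglongrightarrow> (\<integral>\<^sup>+\<omega>. ennreal (nexp (\<Sum>i. ennreal (h (U i \<omega>)))) \<partial>M)" by simp
  qed
  also have "\<dots> = ennreal (nexp (\<integral>\<^sup>+u. ennreal (1 - exp (- h u)) \<partial>\<mu>))"
  proof (rule poisson_pp_laplace[OF U Usp hm h0])
    show "(\<integral>\<^sup>+u. ennreal (1 - exp (- h u)) \<partial>\<mu>) < \<infinity>"
      unfolding I using A(2) by (auto simp: ennreal_mult_less_top less_top)
  qed
  finally show "(\<integral>\<^sup>+\<omega>. ennreal (nexp (\<Sum>j<n. ennreal (s j) * pp_count (\<lambda>i \<omega>. \<Psi> (U i \<omega>, W i \<omega>)) (A j) \<omega>)) \<partial>M)
     = ennreal (nexp (\<Sum>j<n. ennreal (1 - exp (- s j)) * emeasure \<eta> (A j)))"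
    by (simp add: I)
qed

section \<open>Suprema over Poisson processes\<close>

text \<open>Lower orthants are closed under intersection, so that equality of distribution functions
  becomes equality of laws.\<close>

lemma sets_PiM_real_lower_orthants:
  assumes T: "finite T"
  shows "sets (\<Pi>\<^sub>M t\<in>T. (borel :: real measure))
    = sigma_sets (\<Pi>\<^sub>E t\<in>T. UNIV) {{f\<in>(\<Pi>\<^sub>E t\<in>T. UNIV). \<forall>t\<in>T. f t \<le> x t} | x. True}" (is "_ = sigma_sets ?\<Omega> ?G")
proof (rule antisym)
  let ?N = "sigma ?\<Omega> ?G"
  have sub: "?G \<subseteq> Pow ?\<Omega>" by auto
  have sN: "sets ?N = sigma_sets ?\<Omega> ?G" "space ?N = ?\<Omega>"
    using sub by (simp_all add: sets_measure_of space_measure_of)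
  have "(\<lambda>f t. f t) \<in> measurable ?N (\<Pi>\<^sub>M t\<in>T. borel)"
  proof (rule measurable_PiM_single')
    fix t assume t: "t \<in> T"
    show "(\<lambda>f. f t) \<in> borel_measurable ?N"
    proof (subst borel_measurable_iff_le, intro allI)
      fix a
      \<comment> \<open>The remaining coordinates are only required to be at most \<open>n\<close>;
        being finitely many, they satisfy such a bound for some \<open>n\<close>.\<close>
      have "{f \<in> space ?N. f t \<le> a} = (\<Union>n::nat. {f\<in>?\<Omega>. \<forall>s\<in>T. f s \<le> (if s = t then a else real n)})"
      proof (intro set_eqI iffI)
        fix f assume "f \<in> {f \<in> space ?N. f t \<le> a}"
        then have f: "f \<in> ?\<Omega>" "f t \<le> a" unfolding sN by auto
        obtain n :: nat where n: "Max (insert 0 (f ` T)) \<le> real n" using real_arch_simple by blast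
        have "f s \<le> real n" if "s \<in> T" for s
          using that T by (intro order_trans[OF Max_ge n]) auto
        then show "f \<in> (\<Union>n::nat. {f\<in>?\<Omega>. \<forall>s\<in>T. f s \<le> (if s = t then a else real n)})" using f by auto
      next
        fix f assume "f \<in> (\<Union>n::nat. {f\<in>?\<Omega>. \<forall>s\<in>T. f s \<le> (if s = t then a else real n)})"
        then have "f \<in> ?\<Omega>" "f t \<le> a" using t by (auto split: if_splits)
        then show "f \<in> {f \<in> space ?N. f t \<le> a}" unfolding sN by blast
      qed
      moreover have "{f\<in>?\<Omega>. \<forall>s\<in>T. f s \<le> (if s = t then a else real n)} \<in> sets ?N" for n
        unfolding sN
        by (intro sigma_sets.Basic CollectI exI[of _ "\<lambda>s. if s = t then a else real n"]) simp
      ultimately show "{f \<in> space ?N. f t \<le> a} \<in> sets ?N" by auto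
    qed
  next
    show "(\<lambda>f t. f t) \<in> space ?N \<rightarrow> (\<Pi>\<^sub>E t\<in>T. space borel)" unfolding sN by simp
  qed
  from measurable_sets[OF this] sets.sets_into_space[of _ "\<Pi>\<^sub>M t\<in>T. (borel :: real measure)"]
  show "sets (\<Pi>\<^sub>M t\<in>T. (borel :: real measure)) \<subseteq> sigma_sets ?\<Omega> ?G"
    unfolding sN by (auto simp: Int_absorb2 space_PiM)
  have "?G \<subseteq> sets (\<Pi>\<^sub>M t\<in>T. (borel :: real measure))"
  proof safe
    fix x :: "'a \<Rightarrow> real"
    have "{f\<in>space (\<Pi>\<^sub>M t\<in>T. borel). \<forall>t\<in>T. f t \<le> x t} \<in> sets (\<Pi>\<^sub>M t\<in>T. (borel :: real measure))"
    proof (intro sets.sets_Collect_finite_All T)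
      fix t assume "t \<in> T"
      then have "(\<lambda>f. f t) \<in> borel_measurable (\<Pi>\<^sub>M t\<in>T. (borel :: real measure))"
        by (rule measurable_component_singleton)
      then show "{f\<in>space (\<Pi>\<^sub>M t\<in>T. borel). f t \<le> x t} \<in> sets (\<Pi>\<^sub>M t\<in>T. (borel :: real measure))"
        unfolding borel_measurable_iff_le by blast
    qed
    then show "{f\<in>?\<Omega>. \<forall>t\<in>T. f t \<le> x t} \<in> sets (\<Pi>\<^sub>M t\<in>T. (borel :: real measure))"
      by (simp add: space_PiM)
  qed
  then show "sigma_sets ?\<Omega> ?G \<subseteq> sets (\<Pi>\<^sub>M t\<in>T. (borel :: real measure))"
    using sets.sigma_sets_subset[of ?G "\<Pi>\<^sub>M t\<in>T. (borel :: real measure)"] by (simp add: space_PiM)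
qed

lemma sets_Collect_all_le:
  fixes Z :: "'t \<Rightarrow> 'w \<Rightarrow> real"
  assumes "finite T" "\<And>t. t \<in> T \<Longrightarrow> Z t \<in> borel_measurable N"
  shows "{\<omega>\<in>space N. \<forall>t\<in>T. Z t \<omega> \<le> x t} \<in> sets N"
  using assms unfolding borel_measurable_iff_le by (intro sets.sets_Collect_finite_All) auto

text \<open>Right continuity of the distribution function, used to reach thresholds with zero
  coordinates from positive ones.\<close>

lemma tendsto_joint_cdf_right:
  fixes Z :: "'t \<Rightarrow> 'w \<Rightarrow> real"
  assumes T: "finite T" and Z: "\<And>t. t \<in> T \<Longrightarrow> Z t \<in> borel_measurable N" and N: "prob_space N"
  shows "(\<lambda>n. measure N {\<omega>\<in>space N. \<forall>t\<in>T. Z t \<omega> \<le> x t + 1 / real (Suc n)})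
    \<longlonglongrightarrow> measure N {\<omega>\<in>space N. \<forall>t\<in>T. Z t \<omega> \<le> x t}"
proof -
  interpret prob_space N by (rule N)
  let ?B = "\<lambda>n. {\<omega>\<in>space N. \<forall>t\<in>T. Z t \<omega> \<le> x t + 1 / real (Suc n)}"
  have "decseq ?B"
  proof (intro decseq_SucI subsetI)
    fix n \<omega> assume "\<omega> \<in> ?B (Suc n)"
    moreover have "1 / real (Suc (Suc n)) \<le> 1 / real (Suc n)" by (intro divide_left_mono) auto
    ultimately show "\<omega> \<in> ?B n" by (fastforce intro: order_trans add_left_mono)
  qed
  then have "(\<lambda>n. measure N (?B n)) \<longlonglongrightarrow> measure N (\<Inter>n. ?B n)"
    using sets_Collect_all_le[OF T Z] by (intro finite_Lim_measure_decseq) auto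
  moreover have "(\<Inter>n. ?B n) = {\<omega>\<in>space N. \<forall>t\<in>T. Z t \<omega> \<le> x t}"
  proof (intro set_eqI iffI)
    fix \<omega> assume \<omega>: "\<omega> \<in> (\<Inter>n. ?B n)"
    have "Z t \<omega> \<le> x t" if "t \<in> T" for t
    proof (rule field_le_epsilon)
      fix e :: real assume "0 < e"
      then obtain n where "1 / real (Suc n) < e" using nat_approx_posE by blast
      moreover have "Z t \<omega> \<le> x t + 1 / real (Suc n)" using \<omega> that by blast
      ultimately show "Z t \<omega> \<le> x t + e" by linarith
    qed
    then show "\<omega> \<in> {\<omega>\<in>space N. \<forall>t\<in>T. Z t \<omega> \<le> x t}" using \<omega> by auto
  next
    fix \<omega> assume \<omega>: "\<omega> \<in> {\<omega>\<in>space N. \<forall>t\<in>T. Z t \<omega> \<le> x t}"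
    have "Z t \<omega> \<le> x t + 1 / real (Suc n)" if "t \<in> T" for t n
      using \<omega> that by (intro add_increasing2) auto
    then show "\<omega> \<in> (\<Inter>n. ?B n)" using \<omega> by auto
  qed
  ultimately show ?thesis by simp
qed

lemma joint_cdf_negative:
  fixes Z :: "'t \<Rightarrow> 'w \<Rightarrow> real"
  assumes nn: "AE \<omega> in N. 0 \<le> Z t \<omega>" and t: "t \<in> T" "x t < 0"
  shows "measure N {\<omega>\<in>space N. \<forall>t\<in>T. Z t \<omega> \<le> x t} = 0"
proof -
  have "AE \<omega> in N. \<omega> \<in> {\<omega>\<in>space N. \<forall>t\<in>T. Z t \<omega> \<le> x t} \<longleftrightarrow> \<omega> \<in> {}"
    using nn by eventually_elim (use t in force)
  note ae = this
  show ?thesis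
  proof (cases "{\<omega>\<in>space N. \<forall>t\<in>T. Z t \<omega> \<le> x t} \<in> sets N")
    case True
    from measure_eq_AE[OF ae this sets.empty_sets] show ?thesis by (simp only: measure_empty)
  qed (rule measure_notin_sets)
qed

text \<open>Void probabilities give the distribution function only at positive thresholds. A
  negative threshold has probability 0 because the variables are almost surely non-negative, and
  zero thresholds are reached by right continuity.\<close>

lemma distr_PiM_real_eqI:
  fixes \<xi> :: "'t \<Rightarrow> 'w \<Rightarrow> real" and \<xi>' :: "'t \<Rightarrow> 'v \<Rightarrow> real"
  assumes T: "finite T" and M: "prob_space M" "prob_space M'"
    and meas: "\<And>t. t \<in> T \<Longrightarrow> \<xi> t \<in> borel_measurable M" "\<And>t. t \<in> T \<Longrightarrow> \<xi>' t \<in> borel_measurable M'"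
    and nn: "\<And>t. t \<in> T \<Longrightarrow> AE \<omega> in M. 0 \<le> \<xi> t \<omega>" "\<And>t. t \<in> T \<Longrightarrow> AE \<omega> in M'. 0 \<le> \<xi>' t \<omega>"
    and eq: "\<And>x. (\<And>t. t \<in> T \<Longrightarrow> 0 < x t) \<Longrightarrow>
       measure M {\<omega>\<in>space M. \<forall>t\<in>T. \<xi> t \<omega> \<le> x t} = measure M' {\<omega>\<in>space M'. \<forall>t\<in>T. \<xi>' t \<omega> \<le> x t}"
  shows "distr M (\<Pi>\<^sub>M t\<in>T. borel) (\<lambda>\<omega>. \<lambda>t\<in>T. \<xi> t \<omega>) = distr M' (\<Pi>\<^sub>M t\<in>T. borel) (\<lambda>\<omega>. \<lambda>t\<in>T. \<xi>' t \<omega>)"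
proof -
  have all: "measure M {\<omega>\<in>space M. \<forall>t\<in>T. \<xi> t \<omega> \<le> x t} = measure M' {\<omega>\<in>space M'. \<forall>t\<in>T. \<xi>' t \<omega> \<le> x t}" for x
  proof (cases "\<forall>t\<in>T. 0 \<le> x t")
    case True
    have "measure M {\<omega>\<in>space M. \<forall>t\<in>T. \<xi> t \<omega> \<le> x t + 1 / real (Suc n)}
        = measure M' {\<omega>\<in>space M'. \<forall>t\<in>T. \<xi>' t \<omega> \<le> x t + 1 / real (Suc n)}" for n
      using True by (intro eq add_nonneg_pos) auto
    then have "(\<lambda>n. measure M {\<omega>\<in>space M. \<forall>t\<in>T. \<xi> t \<omega> \<le> x t + 1 / real (Suc n)})
        \<longlonglongrightarrow> measure M' {\<omega>\<in>space M'. \<forall>t\<in>T. \<xi>' t \<omega> \<le> x t}"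
      using tendsto_joint_cdf_right[of T \<xi>' M' x, OF T _ M(2)] meas(2) by (simp only:)
    moreover have "(\<lambda>n. measure M {\<omega>\<in>space M. \<forall>t\<in>T. \<xi> t \<omega> \<le> x t + 1 / real (Suc n)})
        \<longlonglongrightarrow> measure M {\<omega>\<in>space M. \<forall>t\<in>T. \<xi> t \<omega> \<le> x t}"
      by (rule tendsto_joint_cdf_right[OF T meas(1) M(1)])
    ultimately show ?thesis by (intro LIMSEQ_unique)
  next
    case False
    then obtain t where t: "t \<in> T" "x t < 0" by auto
    show ?thesis
      using joint_cdf_negative[of \<xi> t M T x] joint_cdf_negative[of \<xi>' t M' T x] nn t by simp
  qed
  let ?\<Omega> = "\<Pi>\<^sub>E t\<in>T. (UNIV :: real set)" and ?G = "{{f\<in>(\<Pi>\<^sub>E t\<in>T. (UNIV :: real set)). \<forall>t\<in>T. f t \<le> x t} | x. True}"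
  have G: "emeasure (distr N (\<Pi>\<^sub>M t\<in>T. borel) (\<lambda>\<omega>. \<lambda>t\<in>T. Z t \<omega>)) {f\<in>?\<Omega>. \<forall>t\<in>T. f t \<le> x t}
      = measure N {\<omega>\<in>space N. \<forall>t\<in>T. Z t \<omega> \<le> x t}"
    if "\<And>t. t \<in> T \<Longrightarrow> Z t \<in> borel_measurable N" "prob_space N"
    for N :: "'c measure" and Z :: "'t \<Rightarrow> 'c \<Rightarrow> real" and x
  proof -
    interpret prob_space N by fact
    have m: "(\<lambda>\<omega>. \<lambda>t\<in>T. Z t \<omega>) \<in> measurable N (\<Pi>\<^sub>M t\<in>T. borel)" using that(1) by (rule measurable_restrict)
    have "{f\<in>?\<Omega>. \<forall>t\<in>T. f t \<le> x t} \<in> sets (\<Pi>\<^sub>M t\<in>T. borel)"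
      unfolding sets_PiM_real_lower_orthants[OF T] by (intro sigma_sets.Basic) blast
    then have "emeasure (distr N (\<Pi>\<^sub>M t\<in>T. borel) (\<lambda>\<omega>. \<lambda>t\<in>T. Z t \<omega>)) {f\<in>?\<Omega>. \<forall>t\<in>T. f t \<le> x t}
       = emeasure N ((\<lambda>\<omega>. \<lambda>t\<in>T. Z t \<omega>) -` {f\<in>?\<Omega>. \<forall>t\<in>T. f t \<le> x t} \<inter> space N)"
      by (rule emeasure_distr[OF m])
    also have "(\<lambda>\<omega>. \<lambda>t\<in>T. Z t \<omega>) -` {f\<in>?\<Omega>. \<forall>t\<in>T. f t \<le> x t} \<inter> space N = {\<omega>\<in>space N. \<forall>t\<in>T. Z t \<omega> \<le> x t}"
      by auto
    finally show ?thesis unfolding emeasure_eq_measure .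
  qed
  show ?thesis
  proof (rule measure_eqI_generator_eq[where E = ?G and \<Omega> = ?\<Omega> and A = "\<lambda>n. {f\<in>?\<Omega>. \<forall>t\<in>T. f t \<le> real n}"])
    show "Int_stable ?G"
    proof (rule Int_stableI)
      fix a b assume "a \<in> ?G" "b \<in> ?G"
      then obtain x y where xy: "a = {f\<in>?\<Omega>. \<forall>t\<in>T. f t \<le> x t}" "b = {f\<in>?\<Omega>. \<forall>t\<in>T. f t \<le> y t}" by blast
      have "a \<inter> b = {f\<in>?\<Omega>. \<forall>t\<in>T. f t \<le> min (x t) (y t)}" unfolding xy by auto
      then show "a \<inter> b \<in> ?G" by (intro CollectI exI[of _ "\<lambda>t. min (x t) (y t)"]) simp
    qed
    show "?G \<subseteq> Pow ?\<Omega>" by auto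
    show "emeasure (distr M (\<Pi>\<^sub>M t\<in>T. borel) (\<lambda>\<omega>. \<lambda>t\<in>T. \<xi> t \<omega>)) X
        = emeasure (distr M' (\<Pi>\<^sub>M t\<in>T. borel) (\<lambda>\<omega>. \<lambda>t\<in>T. \<xi>' t \<omega>)) X" if "X \<in> ?G" for X
    proof -
      obtain x where X: "X = {f\<in>?\<Omega>. \<forall>t\<in>T. f t \<le> x t}" using \<open>X \<in> ?G\<close> by blast
      show ?thesis unfolding X using G[OF meas(1) M(1)] G[OF meas(2) M(2)] all by simp
    qed
    show "range (\<lambda>n. {f\<in>?\<Omega>. \<forall>t\<in>T. f t \<le> real n}) \<subseteq> ?G"
    proof (rule image_subsetI)
      fix n :: nat
      show "{f\<in>?\<Omega>. \<forall>t\<in>T. f t \<le> real n} \<in> ?G" by (intro CollectI exI[of _ "\<lambda>_. real n"]) simp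
    qed
    show "(\<Union>n. {f\<in>?\<Omega>. \<forall>t\<in>T. f t \<le> real n}) = ?\<Omega>"
    proof (intro set_eqI iffI)
      fix f assume f: "f \<in> ?\<Omega>"
      obtain n :: nat where n: "Max (insert 0 (f ` T)) \<le> real n" using real_arch_simple by blast
      have "f s \<le> real n" if "s \<in> T" for s
        using that T by (intro order_trans[OF Max_ge n]) auto
      then show "f \<in> (\<Union>n. {f\<in>?\<Omega>. \<forall>t\<in>T. f t \<le> real n})" using f by auto
    qed auto
    show "emeasure (distr M (\<Pi>\<^sub>M t\<in>T. borel) (\<lambda>\<omega>. \<lambda>t\<in>T. \<xi> t \<omega>)) {f\<in>?\<Omega>. \<forall>t\<in>T. f t \<le> real n} \<noteq> \<infinity>" for n
      using G[OF meas(1) M(1)] by simp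
  qed (simp_all add: sets_PiM_real_lower_orthants[OF T])
qed

text \<open>\<open>\<phi> t y\<close> is the height that the point \<open>y\<close> reaches at the
  site \<open>t\<close>. Both the process \<xi>, with or without a shift, and the moving maxima are
  of this form, so their finite-dimensional laws can be compared through exceedance measures
  alone.\<close>

locale poisson_sup =
  fixes M :: "'w measure" and \<mu> :: "'s measure" and X :: "nat \<Rightarrow> 'w \<Rightarrow> 's"
    and T :: "'t set" and \<phi> :: "'t \<Rightarrow> 's \<Rightarrow> real"
  assumes pp: "poisson_pp M \<mu> X" and sp: "\<And>i \<omega>. \<omega> \<in> space M \<Longrightarrow> X i \<omega> \<in> space \<mu>"
    and T: "finite T" and \<phi>: "\<And>t. t \<in> T \<Longrightarrow> \<phi> t \<in> borel_measurable \<mu>"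
    and \<phi>_nonneg: "\<And>t y. t \<in> T \<Longrightarrow> y \<in> space \<mu> \<Longrightarrow> 0 \<le> \<phi> t y"
    and fin: "\<And>t x. t \<in> T \<Longrightarrow> 0 < x \<Longrightarrow> emeasure \<mu> {y\<in>space \<mu>. x < \<phi> t y} < \<infinity>"
begin

sublocale prob_space M using pp by (simp add: poisson_pp_def)

lemma X_measurable: "X i \<in> measurable M \<mu>"
  using pp sp by (auto simp: poisson_pp_def measurable_def vimage_def Int_def conj_commute)

lemma sup_measurable: "t \<in> T \<Longrightarrow> (\<lambda>\<omega>. SUP i. \<phi> t (X i \<omega>)) \<in> borel_measurable M"
  using measurable_compose[OF X_measurable \<phi>] by (intro borel_measurable_Sup_countable) auto

lemma exceed_sets: "t \<in> T \<Longrightarrow> {y\<in>space \<mu>. x < \<phi> t y} \<in> sets \<mu>"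
  using \<phi> by (auto simp: borel_measurable_iff_greater)

lemma exceed_Un: "{y\<in>space \<mu>. \<exists>t\<in>J. x t < \<phi> t y} = (\<Union>t\<in>J. {y\<in>space \<mu>. x t < \<phi> t y})"
  by auto

lemma exceed_ex_sets: "J \<subseteq> T \<Longrightarrow> {y\<in>space \<mu>. \<exists>t\<in>J. x t < \<phi> t y} \<in> sets \<mu>"
  unfolding exceed_Un using T exceed_sets finite_subset[of J T] by (intro sets.finite_UN) auto

lemma exceed_ex_finite:
  assumes "J \<subseteq> T" "\<And>t. t \<in> J \<Longrightarrow> 0 < x t"
  shows "emeasure \<mu> {y\<in>space \<mu>. \<exists>t\<in>J. x t < \<phi> t y} < \<infinity>"
proof -
  have fJ: "finite J" using T assms(1) finite_subset by blast
  have "emeasure \<mu> {y\<in>space \<mu>. \<exists>t\<in>J. x t < \<phi> t y} \<le> (\<Sum>t\<in>J. emeasure \<mu> {y\<in>space \<mu>. x t < \<phi> t y})"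
    unfolding exceed_Un using assms(1) exceed_sets by (intro emeasure_subadditive_finite fJ) auto
  also have "\<dots> < \<infinity>" using fin assms fJ by (auto simp: less_top)
  finally show ?thesis .
qed

lemma void_prob:
  assumes J: "J \<subseteq> T" and x: "\<And>t. t \<in> J \<Longrightarrow> 0 < x t"
  shows "{\<omega>\<in>space M. \<forall>i. \<forall>t\<in>J. \<phi> t (X i \<omega>) \<le> x t} \<in> sets M"
    and "prob {\<omega>\<in>space M. \<forall>i. \<forall>t\<in>J. \<phi> t (X i \<omega>) \<le> x t}
      = exp (- enn2real (emeasure \<mu> {y\<in>space \<mu>. \<exists>t\<in>J. x t < \<phi> t y}))"
proof -
  let ?A = "{y\<in>space \<mu>. \<exists>t\<in>J. x t < \<phi> t y}"
  have "pp_count X ?A \<omega> = 0 \<longleftrightarrow> (\<forall>i. \<forall>t\<in>J. \<phi> t (X i \<omega>) \<le> x t)" if "\<omega> \<in> space M" for \<omega>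
  proof -
    have "pp_count X ?A \<omega> = 0 \<longleftrightarrow> (\<forall>i. X i \<omega> \<notin> ?A)"
      by (auto simp: pp_count_def emeasure_count_space_eq_0)
    then show ?thesis using sp[OF that] by (auto simp: not_less)
  qed
  then have eq: "{\<omega>\<in>space M. \<forall>i. \<forall>t\<in>J. \<phi> t (X i \<omega>) \<le> x t} = {\<omega>\<in>space M. pp_count X ?A \<omega> = of_nat 0}"
    by auto
  have "pp_count X ?A \<in> borel_measurable M"
  proof (rule measurable_pp_count)
    show "{\<omega>\<in>space M. X i \<omega> \<in> ?A} \<in> sets M" for i
      using pp exceed_ex_sets[OF J] unfolding poisson_pp_def by blast
  qed
  then show "{\<omega>\<in>space M. \<forall>i. \<forall>t\<in>J. \<phi> t (X i \<omega>) \<le> x t} \<in> sets M"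
    unfolding eq by measurable
  show "prob {\<omega>\<in>space M. \<forall>i. \<forall>t\<in>J. \<phi> t (X i \<omega>) \<le> x t} = exp (- enn2real (emeasure \<mu> ?A))"
  proof -
    have "\<forall>A\<in>sets \<mu>. emeasure \<mu> A < \<infinity> \<longrightarrow>
        (\<forall>k::nat. measure M {\<omega>\<in>space M. pp_count X A \<omega> = of_nat k}
            = exp (- enn2real (emeasure \<mu> A)) * enn2real (emeasure \<mu> A) ^ k / fact k)"
      using pp unfolding poisson_pp_def by (elim conjE)
    from this[rule_format, OF exceed_ex_sets[OF J] exceed_ex_finite[OF J x], where k = 0]
    show ?thesis unfolding eq by simp
  qed
qed

text \<open>The real supremum of an unbounded family carries no information, so boundedness has to
  come first. Exceedance sets of growing levels have finite measure and decrease to the empty set,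
  so the probability that no point exceeds the level tends to 1.\<close>

lemma AE_bdd: "AE \<omega> in M. \<forall>t\<in>T. bdd_above (range (\<lambda>i. \<phi> t (X i \<omega>)))"
proof (rule AE_finite_allI[OF T])
  fix t assume t: "t \<in> T"
  let ?E = "\<lambda>n::nat. {\<omega>\<in>space M. \<forall>i. \<forall>s\<in>{t}. \<phi> s (X i \<omega>) \<le> real (Suc n)}"
  let ?B = "\<lambda>n::nat. {y\<in>space \<mu>. \<exists>s\<in>{t}. real (Suc n) < \<phi> s y}"
  have E: "?E n \<in> sets M" "prob (?E n) = exp (- enn2real (emeasure \<mu> (?B n)))" for n
    using void_prob[of "{t}" "\<lambda>_. real (Suc n)"] t by auto
  have "(\<lambda>n. emeasure \<mu> (?B n)) \<longlonglongrightarrow> emeasure \<mu> (\<Inter>n. ?B n)"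
  proof (rule Lim_emeasure_decseq)
    show "range ?B \<subseteq> sets \<mu>" using exceed_ex_sets[of "{t}"] t by auto
    show "decseq ?B" by (auto simp: decseq_def)
    show "emeasure \<mu> (?B n) \<noteq> \<infinity>" for n using exceed_ex_finite[of "{t}" "\<lambda>_. real (Suc n)"] t by auto
  qed
  moreover have "(\<Inter>n. ?B n) = {}"
  proof (rule equals0I)
    fix y assume y: "y \<in> (\<Inter>n. ?B n)"
    obtain n :: nat where "\<phi> t y \<le> real n" using real_arch_simple by blast
    moreover have "real (Suc n) < \<phi> t y" using y by blast
    ultimately show False by simp
  qed
  ultimately have "(\<lambda>n. emeasure \<mu> (?B n)) \<longlonglongrightarrow> 0" by simp
  then have "(\<lambda>n. exp (- enn2real (emeasure \<mu> (?B n)))) \<longlonglongrightarrow> exp (- enn2real 0)"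
    by (intro tendsto_intros tendsto_enn2real) auto
  then have "(\<lambda>n. prob (?E n)) \<longlonglongrightarrow> exp (- enn2real 0)" by (simp only: E(2))
  then have lim: "(\<lambda>n. prob (?E n)) \<longlonglongrightarrow> 1" by simp
  have "prob (?E n) \<le> prob (\<Union>n. ?E n)" for n
    using E(1) by (intro finite_measure_mono) auto
  then have "1 \<le> prob (\<Union>n. ?E n)" by (intro LIMSEQ_le_const2[OF lim]) auto
  then have "prob (\<Union>n. ?E n) = 1" using prob_le_1[of "\<Union>n. ?E n"] by linarith
  then have "AE \<omega> in M. \<omega> \<in> (\<Union>n. ?E n)" using E(1) by (subst AE_in_set_eq_1) auto
  then show "AE \<omega> in M. bdd_above (range (\<lambda>i. \<phi> t (X i \<omega>)))"
    by eventually_elim (auto simp: bdd_above_def)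
qed

lemma AE_nonneg: "t \<in> T \<Longrightarrow> AE \<omega> in M. 0 \<le> (SUP i. \<phi> t (X i \<omega>))"
  using AE_bdd AE_space
proof eventually_elim
  case (elim \<omega>)
  then have "0 \<le> \<phi> t (X 0 \<omega>)" using \<phi>_nonneg sp by auto
  also have "\<dots> \<le> (SUP i. \<phi> t (X i \<omega>))" using elim by (intro cSUP_upper) auto
  finally show ?case .
qed

lemma prob_sup_le:
  assumes x: "\<And>t. t \<in> T \<Longrightarrow> 0 < x t"
  shows "prob {\<omega>\<in>space M. \<forall>t\<in>T. (SUP i. \<phi> t (X i \<omega>)) \<le> x t}
    = exp (- enn2real (emeasure \<mu> {y\<in>space \<mu>. \<exists>t\<in>T. x t < \<phi> t y}))"
proof -
  have "{\<omega>\<in>space M. \<forall>t\<in>T. (SUP i. \<phi> t (X i \<omega>)) \<le> x t} \<in> sets M"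
    using sup_measurable T unfolding borel_measurable_iff_le by (intro sets.sets_Collect_finite_All) auto
  moreover have "AE \<omega> in M. \<omega> \<in> {\<omega>\<in>space M. \<forall>t\<in>T. (SUP i. \<phi> t (X i \<omega>)) \<le> x t}
      \<longleftrightarrow> \<omega> \<in> {\<omega>\<in>space M. \<forall>i. \<forall>t\<in>T. \<phi> t (X i \<omega>) \<le> x t}"
    using AE_bdd by eventually_elim (auto simp: cSUP_le_iff)
  ultimately show ?thesis
    using void_prob[of T x] x by (subst measure_eq_AE) auto
qed

end

lemma poisson_sup_distr_eqI:
  assumes P: "poisson_sup M \<mu> X T \<phi>" and P': "poisson_sup M' \<mu>' X' T \<phi>'"
    and eq: "\<And>x. (\<And>t. t \<in> T \<Longrightarrow> 0 < x t) \<Longrightarrow>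
      emeasure \<mu> {y\<in>space \<mu>. \<exists>t\<in>T. x t < \<phi> t y} = emeasure \<mu>' {y\<in>space \<mu>'. \<exists>t\<in>T. x t < \<phi>' t y}"
  shows "distr M (\<Pi>\<^sub>M t\<in>T. borel) (\<lambda>\<omega>. \<lambda>t\<in>T. SUP i. \<phi> t (X i \<omega>))
    = distr M' (\<Pi>\<^sub>M t\<in>T. borel) (\<lambda>\<omega>. \<lambda>t\<in>T. SUP i. \<phi>' t (X' i \<omega>))"
proof -
  interpret A: poisson_sup M \<mu> X T \<phi> by fact
  interpret B: poisson_sup M' \<mu>' X' T \<phi>' by fact
  show ?thesis
    using A.sup_measurable B.sup_measurable A.AE_nonneg B.AE_nonneg
    by (intro distr_PiM_real_eqI A.T A.prob_space_axioms B.prob_space_axioms)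
      (auto simp: A.prob_sup_le B.prob_sup_le eq)
qed

text \<open>The way back from laws to intensities: the logarithms of the distribution functions are
  the exceedance measures. Finiteness on both sides is checked because \<open>enn2real\<close> maps
  infinity to 0.\<close>

lemma poisson_sup_distr_eqD:
  assumes P: "poisson_sup M \<mu> X T \<phi>" and P': "poisson_sup M' \<mu>' X' T \<phi>'"
    and eq: "distr M (\<Pi>\<^sub>M t\<in>T. borel) (\<lambda>\<omega>. \<lambda>t\<in>T. SUP i. \<phi> t (X i \<omega>))
      = distr M' (\<Pi>\<^sub>M t\<in>T. borel) (\<lambda>\<omega>. \<lambda>t\<in>T. SUP i. \<phi>' t (X' i \<omega>))"
    and x: "\<And>t. t \<in> T \<Longrightarrow> 0 < x t"
  shows "emeasure \<mu> {y\<in>space \<mu>. \<exists>t\<in>T. x t < \<phi> t y} = emeasure \<mu>' {y\<in>space \<mu>'. \<exists>t\<in>T. x t < \<phi>' t y}"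
proof -
  interpret A: poisson_sup M \<mu> X T \<phi> by fact
  interpret B: poisson_sup M' \<mu>' X' T \<phi>' by fact
  let ?S = "{f\<in>(\<Pi>\<^sub>E t\<in>T. UNIV). \<forall>t\<in>T. f t \<le> x t}"
  have S: "?S \<in> sets (\<Pi>\<^sub>M t\<in>T. borel)"
    unfolding sets_PiM_real_lower_orthants[OF A.T] by (intro sigma_sets.Basic) blast
  have 1: "measure (distr M (\<Pi>\<^sub>M t\<in>T. borel) (\<lambda>\<omega>. \<lambda>t\<in>T. SUP i. \<phi> t (X i \<omega>))) ?S
      = measure M {\<omega>\<in>space M. \<forall>t\<in>T. (SUP i. \<phi> t (X i \<omega>)) \<le> x t}"
    by (subst measure_distr[OF measurable_restrict[OF A.sup_measurable] S]) (auto intro!: arg_cong[where f = "measure M"])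
  have 2: "measure (distr M' (\<Pi>\<^sub>M t\<in>T. borel) (\<lambda>\<omega>. \<lambda>t\<in>T. SUP i. \<phi>' t (X' i \<omega>))) ?S
      = measure M' {\<omega>\<in>space M'. \<forall>t\<in>T. (SUP i. \<phi>' t (X' i \<omega>)) \<le> x t}"
    by (subst measure_distr[OF measurable_restrict[OF B.sup_measurable] S]) (auto intro!: arg_cong[where f = "measure M'"])
  have "enn2real (emeasure \<mu> {y\<in>space \<mu>. \<exists>t\<in>T. x t < \<phi> t y}) = enn2real (emeasure \<mu>' {y\<in>space \<mu>'. \<exists>t\<in>T. x t < \<phi>' t y})"
    using 1 2 A.prob_sup_le[OF x] B.prob_sup_le[OF x] eq by simp
  moreover have "emeasure \<mu> {y\<in>space \<mu>. \<exists>t\<in>T. x t < \<phi> t y} < \<infinity>"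
    by (rule A.exceed_ex_finite[OF order_refl x])
  moreover have "emeasure \<mu>' {y\<in>space \<mu>'. \<exists>t\<in>T. x t < \<phi>' t y} < \<infinity>"
    by (rule B.exceed_ex_finite[OF order_refl x])
  moreover have "a = b" if "enn2real a = enn2real b" "a < \<infinity>" "b < \<infinity>" for a b
    using that by (metis ennreal_enn2real infinity_ennreal_def)
  ultimately show ?thesis by blast
qed

section \<open>The Pareto intensity and translation invariant measures\<close>

lemma space_pareto_int [simp]: "space (pareto_int c) = {0<..}"
  by (simp add: pareto_int_def space_restrict_space)

lemma sets_pareto_int: "sets (pareto_int c) = sets (restrict_space borel {0<..})"
  unfolding pareto_int_def by (simp cong: sets_restrict_space_cong)

lemma sets_pareto_int_eq: "sets (pareto_int c) = {A \<in> sets borel. A \<subseteq> {0<..}}"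
  unfolding sets_pareto_int by (auto simp: sets_restrict_space_iff)

lemma measurable_ident_pareto_int: "(\<lambda>u. u) \<in> borel_measurable (pareto_int c)"
  using measurable_restrict_space1[OF measurable_ident_sets[OF refl], of borel "{0<..}"]
  by (simp add: sets_pareto_int cong: measurable_cong_sets)

lemma borel_measurable_pareto_int_iff:
  "f \<in> borel_measurable (pareto_int c) \<longleftrightarrow> (\<lambda>u. f u * indicator {0<..} u :: ennreal) \<in> borel_measurable borel"
proof -
  have "f \<in> borel_measurable (pareto_int c) \<longleftrightarrow> f \<in> borel_measurable (restrict_space borel {0<..})"
    by (intro arg_cong[where f = "\<lambda>S. f \<in> S"] measurable_cong_sets sets_pareto_int refl)
  then show ?thesis by (subst (asm) borel_measurable_restrict_space_iff_ennreal) auto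
qed

lemma nn_integral_pareto_int:
  assumes "f \<in> borel_measurable (pareto_int c)"
  shows "(\<integral>\<^sup>+u. f u \<partial>pareto_int c) = (\<integral>\<^sup>+u. ennreal (c / u\<^sup>2) * (f u * indicator {0<..} u) \<partial>lborel)"
proof -
  have f: "f \<in> borel_measurable (restrict_space lborel {0<..})"
    using assms by (simp add: pareto_int_def)
  have "(\<lambda>u. ennreal (c / u\<^sup>2)) \<in> borel_measurable (restrict_space lborel {0<..})"
    by (intro measurable_restrict_space1) measurable
  then have "(\<integral>\<^sup>+u. f u \<partial>pareto_int c) = (\<integral>\<^sup>+u. ennreal (c / u\<^sup>2) * f u \<partial>restrict_space lborel {0<..})"
    unfolding pareto_int_def using f by (rule nn_integral_density)
  also have "\<dots> = (\<integral>\<^sup>+u. ennreal (c / u\<^sup>2) * f u * indicator {0<..} u \<partial>lborel)"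
    by (rule nn_integral_restrict_space) simp
  finally show ?thesis by (simp add: mult.assoc)
qed

lemma measurable_pareto_int_cong: "measurable (pareto_int c) N = measurable (pareto_int d) N"
  by (intro measurable_cong_sets) (simp_all add: sets_pareto_int)

lemma nn_integral_pareto_int_cmult:
  assumes f: "f \<in> borel_measurable (pareto_int 1)" and "0 \<le> c"
  shows "(\<integral>\<^sup>+u. f u \<partial>pareto_int c) = ennreal c * (\<integral>\<^sup>+u. f u \<partial>pareto_int 1)"
proof -
  have f': "f \<in> borel_measurable (pareto_int c)"
    using f measurable_pareto_int_cong by blast
  have m [measurable]: "(\<lambda>u. f u * indicator {0<..} u) \<in> borel_measurable borel"
    using f by (simp add: borel_measurable_pareto_int_iff)
  have "(\<integral>\<^sup>+u. ennreal (c / u\<^sup>2) * (f u * indicator {0<..} u) \<partial>lborel)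
    = (\<integral>\<^sup>+u. ennreal c * (ennreal (1 / u\<^sup>2) * (f u * indicator {0<..} u)) \<partial>lborel)"
    using \<open>0 \<le> c\<close> by (intro nn_integral_cong) (simp add: mult.assoc[symmetric] flip: ennreal_mult)
  also have "\<dots> = ennreal c * (\<integral>\<^sup>+u. ennreal (1 / u\<^sup>2) * (f u * indicator {0<..} u) \<partial>lborel)"
    by (rule nn_integral_cmult) measurable
  finally show ?thesis by (simp add: nn_integral_pareto_int[OF f] nn_integral_pareto_int[OF f'])
qed

lemma measurable_pareto_int_scale:
  assumes f: "f \<in> borel_measurable (pareto_int 1)" and a: "0 < a"
  shows "(\<lambda>u. f (a * u) :: ennreal) \<in> borel_measurable (pareto_int 1)"
proof -
  have "(\<lambda>u. f u * indicator {0<..} u) \<in> borel_measurable borel"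
    using f by (simp add: borel_measurable_pareto_int_iff)
  then have "(\<lambda>u. f (a * u) * indicator {0<..} (a * u)) \<in> borel_measurable borel"
    by (rule measurable_compose[rotated]) measurable
  moreover have "indicator {0<..} (a * u) = (indicator {0<..} u :: ennreal)" for u
    using a by (simp add: indicator_def zero_less_mult_iff)
  ultimately show ?thesis by (simp add: borel_measurable_pareto_int_iff)
qed

text \<open>Homogeneity of \<open>u^-2 du\<close>: the substitution \<open>v = a * u\<close> costs
  the factor \<open>a\<close>. This is the origin of the weight \<open>gamma_of\<close> and of the
  exchange between \<open>c\<close> in the intensity and \<open>c\<close> in the shapes.\<close>

lemma nn_integral_pareto_int_scale:
  assumes f: "f \<in> borel_measurable (pareto_int 1)" and a: "0 < a"
  shows "(\<integral>\<^sup>+u. f (a * u) \<partial>pareto_int 1) = ennreal a * (\<integral>\<^sup>+u. f u \<partial>pareto_int 1)"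
proof -
  define g where "g u = ennreal (1 / u\<^sup>2) * (f u * indicator {0<..} u)" for u
  have [measurable]: "(\<lambda>u. f u * indicator {0<..} u) \<in> borel_measurable borel"
    using f by (simp add: borel_measurable_pareto_int_iff)
  have g [measurable]: "g \<in> borel_measurable borel" unfolding g_def by measurable
  have "(\<integral>\<^sup>+u. f u \<partial>pareto_int 1) = (\<integral>\<^sup>+u. g u \<partial>lborel)"
    by (simp add: nn_integral_pareto_int[OF f] g_def)
  also have "\<dots> = ennreal a * (\<integral>\<^sup>+u. g (0 + a * u) \<partial>lborel)"
    using a by (subst nn_integral_real_affine[OF g, of a 0]) auto
  finally have "ennreal a * (\<integral>\<^sup>+u. f u \<partial>pareto_int 1) = ennreal (a * a) * (\<integral>\<^sup>+u. g (a * u) \<partial>lborel)"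
    using a by (simp add: ennreal_mult mult.assoc)
  also have "\<dots> = (\<integral>\<^sup>+u. ennreal (a * a) * g (a * u) \<partial>lborel)"
    by (rule nn_integral_cmult[symmetric]) measurable
  also have "\<dots> = (\<integral>\<^sup>+u. ennreal (1 / u\<^sup>2) * (f (a * u) * indicator {0<..} u) \<partial>lborel)"
  proof (intro nn_integral_cong)
    fix u :: real
    have "ennreal (a * a) * ennreal (1 / (a * u)\<^sup>2) = ennreal (1 / u\<^sup>2)"
      using a by (simp add: power2_eq_square flip: ennreal_mult)
    moreover have "indicator {0<..} (a * u) = (indicator {0<..} u :: ennreal)"
      using a by (simp add: indicator_def zero_less_mult_iff)
    ultimately show "ennreal (a * a) * g (a * u) = ennreal (1 / u\<^sup>2) * (f (a * u) * indicator {0<..} u)"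
      unfolding g_def by (simp add: mult.assoc[symmetric])
  qed
  also have "\<dots> = (\<integral>\<^sup>+u. f (a * u) \<partial>pareto_int 1)"
    by (rule nn_integral_pareto_int[OF measurable_pareto_int_scale[OF f a], symmetric])
  finally show ?thesis by simp
qed

lemma emeasure_pareto_int_tail:
  assumes "0 < x" shows "emeasure (pareto_int 1) {x<..} = ennreal (1 / x)"
proof -
  have S: "{x<..} \<in> sets (pareto_int 1)" using assms by (auto simp: sets_pareto_int_eq)
  have "emeasure (pareto_int 1) {x<..} = (\<integral>\<^sup>+u. indicator {x<..} u \<partial>pareto_int 1)"
    using S by simp
  also have "\<dots> = (\<integral>\<^sup>+u. ennreal (1 / u\<^sup>2) * (indicator {x<..} u * indicator {0<..} u) \<partial>lborel)"
    using S by (intro nn_integral_pareto_int borel_measurable_indicator)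
  also have "\<dots> = (\<integral>\<^sup>+u. ennreal (1 / u\<^sup>2) * indicator {x..} u \<partial>lborel)"
  proof (intro nn_integral_cong_AE)
    have "AE u in lborel. u \<noteq> x" by (rule AE_lborel_singleton)
    then show "AE u in lborel. ennreal (1 / u\<^sup>2) * (indicator {x<..} u * indicator {0<..} u) = ennreal (1 / u\<^sup>2) * indicator {x..} u"
      by eventually_elim (use assms in \<open>auto simp: indicator_def\<close>)
  qed
  also have "\<dots> = ennreal (0 - (- (1 / x)))"
  proof (rule nn_integral_FTC_atLeast)
    show "((\<lambda>x. - (1 / x)) has_real_derivative 1 / u\<^sup>2) (at u)" if "x \<le> u" for u
      using assms that by (auto intro!: derivative_eq_intros simp: power2_eq_square)
    show "((\<lambda>x::real. - (1 / x)) \<longlongrightarrow> 0) at_top"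
      using tendsto_minus[OF tendsto_inverse_0_at_top[OF filterlim_ident]] by (simp add: inverse_eq_divide)
  qed auto
  finally show ?thesis by simp
qed

lemma emeasure_pareto_int_scaled_tail:
  assumes "0 < x" "0 \<le> a" shows "emeasure (pareto_int 1) {u\<in>{0<..}. x < u * a} = ennreal (a / x)"
proof (cases "a = 0")
  case False
  then have "{u\<in>{0<..}. x < u * a} = {x / a<..}"
    using assms by (auto simp: field_simps) (smt (verit) mult_nonneg_nonneg mult_nonpos_nonneg)
  then show ?thesis using emeasure_pareto_int_tail[of "x / a"] assms False by simp
qed (use assms in simp)

lemma sigma_finite_pareto_int:
  assumes "0 \<le> c" shows "sigma_finite_measure (pareto_int c)"
proof
  have "emeasure (pareto_int c) {1 / real (Suc n)<..} \<noteq> \<infinity>" for n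
  proof -
    have S: "{1 / real (Suc n)<..} \<in> sets (pareto_int d)" for d
      by (auto simp: sets_pareto_int_eq intro: less_trans[rotated])
    have "emeasure (pareto_int c) {1 / real (Suc n)<..} = (\<integral>\<^sup>+u. indicator {1 / real (Suc n)<..} u \<partial>pareto_int c)"
      using S by simp
    also have "\<dots> = ennreal c * emeasure (pareto_int 1) {1 / real (Suc n)<..}"
      using S assms by (subst nn_integral_pareto_int_cmult) auto
    also have "\<dots> \<noteq> \<infinity>"
      by (subst emeasure_pareto_int_tail) (auto simp: ennreal_mult_eq_top_iff)
    finally show ?thesis .
  qed
  moreover have "(\<Union>n. {1 / real (Suc n)<..}) = {0<..}"
  proof (intro set_eqI iffI)
    fix u :: real assume "u \<in> {0<..}"
    then show "u \<in> (\<Union>n. {1 / real (Suc n)<..})" using nat_approx_posE[of u] by auto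
  qed (auto intro: less_trans[rotated])
  ultimately show "\<exists>A. countable A \<and> A \<subseteq> sets (pareto_int c) \<and> \<Union> A = space (pareto_int c) \<and> (\<forall>a\<in>A. emeasure (pareto_int c) a \<noteq> \<infinity>)"
    by (intro exI[of _ "range (\<lambda>n. {1 / real (Suc n)<..})"]) (auto simp: sets_pareto_int_eq intro: less_trans[rotated])
qed

lemma lborel_distr_reflect: "distr lborel borel (\<lambda>y. x - y) = (lborel :: 'a::euclidean_space measure)"
  using lborel_affine[of "-1" x] by (simp add: density_1 cong: distr_cong)

lemma nn_integral_lborel_reflect:
  fixes f :: "'a::euclidean_space \<Rightarrow> ennreal"
  assumes "f \<in> borel_measurable borel"
  shows "(\<integral>\<^sup>+y. f (x - y) \<partial>lborel) = (\<integral>\<^sup>+y. f y \<partial>lborel)"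
  using assms by (subst lborel_distr_reflect[of x, symmetric]) (simp add: nn_integral_distr)

lemma nn_integral_lborel_translate:
  fixes f :: "'a::euclidean_space \<Rightarrow> ennreal"
  assumes "f \<in> borel_measurable borel"
  shows "(\<integral>\<^sup>+y. f (x + y) \<partial>lborel) = (\<integral>\<^sup>+y. f y \<partial>lborel)"
  using assms by (subst lborel_distr_plus[of x, symmetric]) (simp add: nn_integral_distr)

text \<open>Both sides are the double integral of \<open>1 (x \<in> B) 1 (x + y \<in> Q)\<close> over \<open>m \<times> lborel\<close>.\<close>

lemma translation_invariant_measure_eq_lborel:
  fixes m :: "'a::euclidean_space measure"
  assumes sm: "sets m = sets borel" and fin: "sigma_finite_measure m"
    and inv: "\<And>h B. B \<in> sets borel \<Longrightarrow> emeasure m {x. x - h \<in> B} = emeasure m B"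
    and B: "B \<in> sets borel" and Q: "Q \<in> sets borel"
  shows "emeasure m B * emeasure lborel Q = emeasure m Q * emeasure lborel B"
proof -
  interpret m: sigma_finite_measure m by fact
  interpret pair_sigma_finite m "lborel :: 'a measure" ..
  note B [measurable] Q [measurable] sm [measurable_cong]
  have spm: "space m = UNIV" using sets_eq_imp_space_eq[OF sm] by simp
  have dm: "distr m borel (\<lambda>x. x - y) = m" for y
  proof (rule measure_eqI)
    show "emeasure (distr m borel (\<lambda>x. x - y)) A = emeasure m A" if "A \<in> sets (distr m borel (\<lambda>x. x - y))" for A
      using that inv[of A y] by (subst emeasure_distr) (auto simp: spm vimage_def)
  qed (simp add: sm)
  have m_inv: "(\<integral>\<^sup>+x. f (x - y) \<partial>m) = (\<integral>\<^sup>+x. f x \<partial>m)" if [measurable]: "f \<in> borel_measurable borel" for f :: "'a \<Rightarrow> ennreal" and y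
    by (subst (2) dm[of y, symmetric]) (simp add: nn_integral_distr)
  have "emeasure m B * emeasure lborel Q = (\<integral>\<^sup>+x. indicator B x * (\<integral>\<^sup>+y. indicator Q y \<partial>lborel) \<partial>m)"
    using sm by (simp add: nn_integral_multc)
  also have "\<dots> = (\<integral>\<^sup>+x. \<integral>\<^sup>+y. indicator B x * indicator Q (x + y) \<partial>lborel \<partial>m)"
  proof (intro nn_integral_cong)
    fix x
    show "indicator B x * (\<integral>\<^sup>+y. indicator Q y \<partial>lborel) = (\<integral>\<^sup>+y. indicator B x * indicator Q (x + y) \<partial>lborel)"
      using nn_integral_lborel_translate[of "indicator Q" x] by (subst nn_integral_cmult) auto
  qed
  also have "\<dots> = (\<integral>\<^sup>+y. \<integral>\<^sup>+x. indicator B x * indicator Q (x + y) \<partial>m \<partial>lborel)"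
    by (rule Fubini'[symmetric]) measurable
  also have "\<dots> = (\<integral>\<^sup>+y. \<integral>\<^sup>+x. indicator B (x - y) * indicator Q x \<partial>m \<partial>lborel)"
  proof (rule nn_integral_cong)
    fix y
    show "(\<integral>\<^sup>+x. indicator B x * indicator Q (x + y) \<partial>m) = (\<integral>\<^sup>+x. indicator B (x - y) * indicator Q x \<partial>m)"
      using m_inv[of "\<lambda>x. indicator B x * indicator Q (x + y)" y] by simp
  qed
  also have "\<dots> = (\<integral>\<^sup>+x. \<integral>\<^sup>+y. indicator B (x - y) * indicator Q x \<partial>lborel \<partial>m)"
    by (rule Fubini') measurable
  also have "\<dots> = (\<integral>\<^sup>+x. emeasure lborel B * indicator Q x \<partial>m)"
  proof (intro nn_integral_cong)
    fix x
    show "(\<integral>\<^sup>+y. indicator B (x - y) * indicator Q x \<partial>lborel) = emeasure lborel B * indicator Q x"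
      using nn_integral_lborel_reflect[of "indicator B" x] by (subst nn_integral_multc) auto
  qed
  also have "\<dots> = emeasure m Q * emeasure lborel B"
    by (subst nn_integral_cmult) (simp_all add: mult.commute)
  finally show ?thesis .
qed

section \<open>Translation, scaling and the normalised shape\<close>

definition translate :: "'a::plus \<Rightarrow> ('a \<Rightarrow> real) \<Rightarrow> 'a \<Rightarrow> real" where
  "translate h f = (\<lambda>t. f (t + h))"

lemma translate_apply: "translate h f t = f (t + h)"
  by (simp add: translate_def)

text \<open>The supremum of an unbounded function is an unspecified real; the absolute value keeps \<open>shape\<close>
  non-negative in that case too.\<close>

definition shape :: "(real^('d::{finite,linorder}) \<Rightarrow> real) \<Rightarrow> real^('d::{finite,linorder}) \<Rightarrow> real" where
  "shape f = (\<lambda>t. f (t + tau_of f) / \<bar>gamma_of f\<bar>)"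

lemma translate_Cset: "f \<in> Cset \<Longrightarrow> translate h f \<in> Cset" for h :: "'a::real_normed_vector"
  unfolding Cset_def translate_def
  by (auto intro!: continuous_on_compose2[of UNIV f] continuous_intros)

lemma measurable_translate [measurable]:
  "translate h \<in> measurable Cspace (Cspace :: ('a::euclidean_space \<Rightarrow> real) measure)"
  unfolding translate_def
  by (rule measurable_CspaceI) (use translate_Cset[of _ h] in \<open>auto simp: translate_def intro: measurable_eval_Cspace\<close>)

lemma shape_Cset: "f \<in> Cset \<Longrightarrow> shape f \<in> Cset"
  unfolding Cset_def shape_def divide_inverse
  by (auto intro!: continuous_on_compose2[of UNIV f] continuous_intros)

lemma measurable_shape [measurable]: "shape \<in> measurable Cspace Cspace"
proof (rule measurable_CspaceI)
  show "shape f \<in> Cset" if "f \<in> space Cspace" for f using shape_Cset that by simp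
  fix t
  have "(\<lambda>f. f (t + tau_of f)) \<in> borel_measurable Cspace"
    by (rule measurable_apply_Cspace) measurable
  then show "(\<lambda>f. shape f t) \<in> borel_measurable Cspace"
    unfolding shape_def by measurable
qed

lemma scale_Cset: "0 \<le> u \<Longrightarrow> f \<in> Cset \<Longrightarrow> (\<lambda>t. u * f t) \<in> Cset"
  by (auto simp: Cset_def intro!: continuous_intros)

lemma scale_Cvan: "0 \<le> u \<Longrightarrow> f \<in> Cvan \<Longrightarrow> (\<lambda>t. u * f t) \<in> Cvan"
  using scale_Cset[of u f] tendsto_mult_left[of f 0 at_infinity u] by (auto simp: Cvan_def)

lemma measurable_scale_Cspace: "0 \<le> c \<Longrightarrow> (\<lambda>f t. c * f t) \<in> measurable Cspace (Cspace :: ('a::euclidean_space \<Rightarrow> real) measure)"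
  by (rule measurable_CspaceI) (auto intro!: scale_Cset measurable_eval_Cspace borel_measurable_times)

lemma argsup_scale: "0 < u \<Longrightarrow> argsup (\<lambda>t. u * f t) = argsup f"
  by (simp add: argsup_def)

lemma tau_of_scale: "0 < u \<Longrightarrow> tau_of (\<lambda>t. u * f t) = tau_of f"
  by (simp add: tau_of_def argsup_scale)

lemma gamma_of_scale:
  assumes u: "0 < u" and f: "bdd_above (range f)"
  shows "gamma_of (\<lambda>t. u * f t) = u * gamma_of f"
proof (rule antisym)
  show "gamma_of (\<lambda>t. u * f t) \<le> u * gamma_of f"
    unfolding gamma_of_def using u f by (intro cSUP_least mult_left_mono cSUP_upper) auto
  have "bdd_above (range (\<lambda>t. u * f t))"
  proof -
    obtain b where "\<And>t. f t \<le> b" using f by (auto simp: bdd_above_def)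
    then show ?thesis using u by (intro bdd_aboveI[of _ "u * b"]) auto
  qed
  then have "u * f t \<le> gamma_of (\<lambda>t. u * f t)" for t unfolding gamma_of_def by (intro cSUP_upper) auto
  then have "f t \<le> gamma_of (\<lambda>t. u * f t) / u" for t using u by (simp add: field_simps)
  then have "gamma_of f \<le> gamma_of (\<lambda>t. u * f t) / u" unfolding gamma_of_def[of f] by (intro cSUP_least) auto
  then show "u * gamma_of f \<le> gamma_of (\<lambda>t. u * f t)" using u by (simp add: field_simps)
qed

lemma shape_scale:
  assumes u: "0 < u" and f: "bdd_above (range f)"
  shows "shape (\<lambda>t. u * f t) = shape f"
  using u by (simp add: shape_def tau_of_scale[OF u] gamma_of_scale[OF u f] abs_mult)

lemma gamma_of_translate: "gamma_of (translate h f) = gamma_of f" for h :: "'a::ab_group_add"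
proof -
  have "range (translate h f) = range f"
    unfolding translate_def by (auto simp: image_iff) (metis diff_add_cancel)
  then show ?thesis by (simp add: gamma_of_def)
qed

lemma translate_Cvan_iff: "f \<in> Cset \<Longrightarrow> translate h f \<in> Cvan \<longleftrightarrow> f \<in> Cvan" for h :: "'a::real_normed_vector"
proof -
  have *: "translate h f \<in> Cvan" if "f \<in> Cvan" for h :: 'a and f :: "'a \<Rightarrow> real"
  proof -
    have f: "f \<in> Cset" "(f \<longlongrightarrow> 0) at_infinity" using that by (auto simp: Cvan_def)
    have "filterlim (\<lambda>t. t + h) at_infinity at_infinity"
      by (rule tendsto_add_filterlim_at_infinity'[OF filterlim_ident tendsto_const])
    then have "(translate h f \<longlongrightarrow> 0) at_infinity"
      unfolding translate_def by (rule filterlim_compose[OF f(2)])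
    then show ?thesis using translate_Cset[OF f(1)] by (simp add: Cvan_def)
  qed
  have "translate (- h) (translate h f) = f" by (simp add: translate_def)
  then show ?thesis using *[of f h] *[of "translate h f" "- h"] by auto
qed

lemma lex_le_translate: "lex_le (x - h) (y - h) \<longleftrightarrow> lex_le x y"
  by (auto simp: lex_le_def)

text \<open>The lexicographic order is translation invariant, so the infimum of the shifted argsup
  is the shifted infimum. Positivity is essential: the zero function equals its translates, so its
  \<open>tau_of\<close> does not shift.\<close>

lemma tau_of_translate:
  fixes f :: "real^('d::{finite,linorder}) \<Rightarrow> real"
  assumes f: "f \<in> Cvan" and pos: "0 < gamma_of f"
  shows "tau_of (translate h f) = tau_of f - h"
proof -
  have A: "t \<in> argsup (translate h f) \<longleftrightarrow> t + h \<in> argsup f" for t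
    unfolding argsup_def translate_def by auto (metis diff_add_cancel)
  have inf: "is_lex_inf (argsup f) (tau_of f)" using Cvan_max(4)[OF f pos] .
  have "is_lex_inf (argsup (translate h f)) (tau_of f - h)"
    unfolding is_lex_inf_def
  proof (intro conjI ballI allI impI)
    fix s assume "s \<in> argsup (translate h f)"
    then have "lex_le (tau_of f) (s + h)" using A inf by (auto simp: is_lex_inf_def)
    then show "lex_le (tau_of f - h) s" using lex_le_translate[of "tau_of f" h "s + h"] by simp
  next
    fix z assume z: "\<forall>s\<in>argsup (translate h f). lex_le z s"
    have "lex_le (z + h) s" if "s \<in> argsup f" for s
    proof -
      have "s - h \<in> argsup (translate h f)" using A that by simp
      then have "lex_le z (s - h)" using z by blast
      then show ?thesis using lex_le_translate[of "z + h" h s] by simp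
    qed
    then have "lex_le (z + h) (tau_of f)" using inf by (auto simp: is_lex_inf_def)
    then show "lex_le z (tau_of f - h)" using lex_le_translate[of "z + h" h "tau_of f"] by simp
  qed
  then show ?thesis unfolding tau_of_def[of "translate h f"] by (rule lex_inf_eqI)
qed

lemma shape_translate:
  assumes f: "f \<in> Cvan" and pos: "0 < gamma_of f"
  shows "shape (translate h f) = shape f"
  unfolding shape_def by (simp add: tau_of_translate[OF assms] gamma_of_translate) (simp add: translate_def)

lemma Cvan_gamma_0:
  fixes f :: "real^('d::{finite,linorder}) \<Rightarrow> real"
  assumes "f \<in> Cvan" "gamma_of f = 0" shows "f = (\<lambda>_. 0)"
proof
  fix t
  have "0 \<le> f t" using assms(1) by (simp add: Cvan_def Cset_def)
  then show "f t = 0" using Cvan_max(3)[OF assms(1), of t] assms(2) by simp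
qed

text \<open>Recovers a function from its polar coordinates. It also holds for the zero function,
  where the unspecified location and the shape are multiplied by 0.\<close>

lemma Cvan_shape_mult:
  assumes "f \<in> Cvan" shows "gamma_of f * shape f (t - tau_of f) = f t"
  using Cvan_max(2)[OF assms] Cvan_gamma_0[OF assms] by (cases "gamma_of f = 0") (auto simp: shape_def)

section \<open>Measures on the function space determined by exceedances\<close>

lemma sets_Cspace_sublevel:
  fixes J :: "'a::metric_space set"
  assumes "finite J" shows "{f\<in>Cset. \<forall>t\<in>J. f t \<le> x t} \<in> sets Cspace"
proof -
  have "{f\<in>space Cspace. \<forall>t\<in>J. f t \<le> x t} \<in> sets Cspace"
    using assms by (rule sets_Collect_all_le) (rule measurable_eval_Cspace)
  then show ?thesis by simp
qed

text \<open>Only positive thresholds may be used, since only those have finite exceedance measure.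
  The level 0 is a countable intersection of positive ones, and negative levels give the empty set
  for non-negative functions.\<close>

lemma sets_Cspace_eq_pos_sublevels:
  "sets (Cspace :: ('a::{metric_space, second_countable_topology} \<Rightarrow> real) measure)
     = sigma_sets Cset {{f\<in>Cset. \<forall>t\<in>J. f t \<le> x t} | J x. finite J \<and> (\<forall>t. 0 < x t)}" (is "_ = sigma_sets Cset ?G")
proof (rule antisym)
  let ?N = "sigma (Cset :: ('a \<Rightarrow> real) set) ?G"
  have sub: "?G \<subseteq> Pow Cset" by auto
  have sN: "sets ?N = sigma_sets Cset ?G" "space ?N = Cset"
    using sub by (simp_all add: sets_measure_of space_measure_of)
  have "(\<lambda>f. f) \<in> measurable ?N Cspace"
  proof (rule measurable_CspaceI)
    show "f \<in> Cset" if "f \<in> space ?N" for f using that unfolding sN .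
    show "(\<lambda>f. f t) \<in> borel_measurable ?N" for t
    proof (subst borel_measurable_iff_le, intro allI)
      fix a :: real
      have pos: "{f \<in> Cset. f t \<le> b} \<in> sets ?N" if "0 < b" for b
        unfolding sN using that
        by (intro sigma_sets.Basic CollectI exI[of _ "{t}"] exI[of _ "\<lambda>_. b"]) simp
      consider "0 < a" | "a = 0" | "a < 0" by linarith
      then have "{f \<in> Cset. f t \<le> a} \<in> sets ?N"
      proof cases
        case 2
        have "{f \<in> Cset. f t \<le> a} = (\<Inter>n. {f \<in> Cset. f t \<le> 1 / real (Suc n)})"
        proof (intro set_eqI iffI)
          fix f :: "'a \<Rightarrow> real" assume f: "f \<in> (\<Inter>n. {f \<in> Cset. f t \<le> 1 / real (Suc n)})"
          have "f t \<le> 0"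
          proof (rule ccontr)
            assume "\<not> f t \<le> 0"
            then obtain n where "1 / real (Suc n) < f t" using nat_approx_posE[of "f t"] by auto
            then show False using f by (auto simp: not_le[symmetric])
          qed
          then show "f \<in> {f \<in> Cset. f t \<le> a}" using f 2 by auto
        qed (auto simp: 2 intro: order_trans)
        also have "\<dots> \<in> sets ?N" using pos by (intro sets.countable_INT) auto
        finally show ?thesis .
      next
        case 3
        then have "{f \<in> Cset. f t \<le> a} = {}" by (fastforce simp: Cset_def dest: order_trans)
        then show ?thesis by (simp only: sets.empty_sets)
      qed (rule pos)
      then show "{f \<in> space ?N. f t \<le> a} \<in> sets ?N" unfolding sN .
    qed
  qed
  from measurable_sets[OF this] sets.sets_into_space[of _ "Cspace :: ('a \<Rightarrow> real) measure"]
  show "sets Cspace \<subseteq> sigma_sets Cset ?G"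
    unfolding sN by (auto simp: Int_absorb2)
  have "?G \<subseteq> sets Cspace"
  proof safe
    fix J :: "'a set" and x :: "'a \<Rightarrow> real" assume "finite J"
    then show "{f\<in>Cset. \<forall>t\<in>J. f t \<le> x t} \<in> sets Cspace" by (rule sets_Cspace_sublevel)
  qed
  then show "sigma_sets Cset ?G \<subseteq> sets Cspace"
    using sets.sigma_sets_subset[of ?G Cspace] by simp
qed

text \<open>Two measures that agree on all \<open>{f. \<exists>t\<in>J. x t < f t}\<close> agree away from the zero function, where
  they may both be infinite: on \<open>{f. \<epsilon> < f s}\<close> they are finite and agree on the sublevel sets,
  which are closed under intersection.\<close>

lemma Cspace_measure_eqI_exceedances:
  fixes \<mu> \<nu> :: "('a::{metric_space, second_countable_topology} \<Rightarrow> real) measure"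
  assumes s: "sets \<mu> = sets Cspace" "sets \<nu> = sets Cspace"
    and eq: "\<And>J x. finite J \<Longrightarrow> (\<And>t. 0 < x t) \<Longrightarrow>
        emeasure \<mu> {f\<in>Cset. \<exists>t\<in>J. x t < f t} = emeasure \<nu> {f\<in>Cset. \<exists>t\<in>J. x t < f t}"
    and fin: "\<And>J x. finite J \<Longrightarrow> (\<And>t. 0 < x t) \<Longrightarrow> emeasure \<mu> {f\<in>Cset. \<exists>t\<in>J. x t < f t} < \<infinity>"
    and A: "A \<in> sets Cspace" "\<And>f. f \<in> A \<Longrightarrow> \<exists>t. 0 < f t"
  shows "emeasure \<mu> A = emeasure \<nu> A"
proof -
  define L :: "'a set \<Rightarrow> ('a \<Rightarrow> real) \<Rightarrow> ('a \<Rightarrow> real) set" where "L J x = {f\<in>Cset. \<exists>t\<in>J. x t < f t}" for J x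
  have X: "{f\<in>Cset. \<forall>t\<in>J. f t \<le> x t} \<in> sets Cspace" if "finite J" for J :: "'a set" and x
    using that by (rule sets_Cspace_sublevel)
  have Lsets: "L J x \<in> sets Cspace" if "finite J" for J x
  proof -
    have "L J x = space Cspace - {f\<in>Cset. \<forall>t\<in>J. f t \<le> x t}" by (auto simp: L_def not_le)
    then show ?thesis using sets.compl_sets[OF X[OF that, of x]] by simp
  qed
  define E :: "'a \<Rightarrow> real \<Rightarrow> ('a \<Rightarrow> real) set" where "E t \<epsilon> = {f\<in>Cset. \<epsilon> < f t}" for t \<epsilon>
  have E_L: "E t \<epsilon> = L {t} (\<lambda>_. \<epsilon>)" for t \<epsilon> by (auto simp: E_def L_def)
  have Esets: "E t \<epsilon> \<in> sets Cspace" for t \<epsilon> unfolding E_L by (rule Lsets) simp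
  have finL: "emeasure \<rho> (L J x) < \<infinity>" if "finite J" "\<And>t. 0 < x t" "\<rho> = \<mu> \<or> \<rho> = \<nu>" for J x \<rho>
    using that eq[of J x] fin[of J x] by (auto simp: L_def)
  have local: "emeasure \<mu> (E s \<epsilon> \<inter> B) = emeasure \<nu> (E s \<epsilon> \<inter> B)" if \<epsilon>: "0 < \<epsilon>" and B: "B \<in> sets Cspace" for s \<epsilon> B
  proof -
    let ?m = "\<lambda>\<rho>. density \<rho> (indicator (E s \<epsilon>))"
    have m: "emeasure (?m \<rho>) Y = emeasure \<rho> (E s \<epsilon> \<inter> Y)" if "Y \<in> sets Cspace" "\<rho> = \<mu> \<or> \<rho> = \<nu>" for \<rho> Y
    proof -
      have "sets \<rho> = sets Cspace" using that s by auto
      then show ?thesis using that Esets by (subst emeasure_density) (auto simp: indicator_inter_arith[symmetric])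
    qed
    \<comment> \<open>On a sublevel set, exceeding one of the new thresholds can only mean exceeding
      \<epsilon> at \<open>s\<close>. If \<open>s\<close> is in \<open>J\<close>, the threshold
      there is lowered to the minimum so that \<open>L J x\<close> stays inside the larger
      exceedance set and can be subtracted.\<close>
    have gen: "emeasure \<rho> (E s \<epsilon> \<inter> {f\<in>Cset. \<forall>t\<in>J. f t \<le> x t})
        = emeasure \<rho> (L (insert s J) (\<lambda>t. if t = s then (if s \<in> J then min \<epsilon> (x s) else \<epsilon>) else x t)) - emeasure \<rho> (L J x)"
      if "finite J" "\<And>t. 0 < x t" "\<rho> = \<mu> \<or> \<rho> = \<nu>" for J x \<rho>
    proof -
      have "sets \<rho> = sets Cspace" using that s by auto
      moreover have "E s \<epsilon> \<inter> {f\<in>Cset. \<forall>t\<in>J. f t \<le> x t}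
          = L (insert s J) (\<lambda>t. if t = s then (if s \<in> J then min \<epsilon> (x s) else \<epsilon>) else x t) - L J x"
        by (fastforce simp: E_def L_def not_less min_def split: if_splits)
      moreover have "L J x \<subseteq> L (insert s J) (\<lambda>t. if t = s then (if s \<in> J then min \<epsilon> (x s) else \<epsilon>) else x t)"
        by (force simp: L_def min_less_iff_disj)
      ultimately show ?thesis
        using that finL[of J x \<rho>] Lsets by (simp only:) (rule emeasure_Diff; simp add: less_top)
    qed
    have "?m \<mu> = ?m \<nu>"
    proof (rule measure_eqI_generator_eq[where \<Omega> = Cset and A = "\<lambda>_. Cset"
        and E = "{{f\<in>Cset. \<forall>t\<in>J. f t \<le> x t} | J x. finite J \<and> (\<forall>t. 0 < x t)}"])
      show "Int_stable {{f\<in>Cset. \<forall>t\<in>J. f t \<le> x t} | J (x :: 'a \<Rightarrow> real). finite J \<and> (\<forall>t. 0 < x t)}"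
      proof (rule Int_stableI)
        fix a b assume "a \<in> {{f\<in>Cset. \<forall>t\<in>J. f t \<le> x t} | J (x :: 'a \<Rightarrow> real). finite J \<and> (\<forall>t. 0 < x t)}"
          "b \<in> {{f\<in>Cset. \<forall>t\<in>J. f t \<le> x t} | J (x :: 'a \<Rightarrow> real). finite J \<and> (\<forall>t. 0 < x t)}"
        then obtain J x J' x' where *: "a = {f\<in>Cset. \<forall>t\<in>J. f t \<le> x t}" "finite J" "\<forall>t. 0 < x t"
          "b = {f\<in>Cset. \<forall>t\<in>J'. f t \<le> x' t}" "finite J'" "\<forall>t. 0 < x' t" by blast
        let ?x = "\<lambda>t. if t \<in> J then if t \<in> J' then min (x t) (x' t) else x t else x' t"
        have "a \<inter> b = {f\<in>Cset. \<forall>t\<in>J \<union> J'. f t \<le> ?x t}" unfolding * by auto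
        moreover have "\<forall>t. 0 < ?x t" using * by simp
        ultimately show "a \<inter> b \<in> {{f\<in>Cset. \<forall>t\<in>J. f t \<le> x t} | J (x :: 'a \<Rightarrow> real). finite J \<and> (\<forall>t. 0 < x t)}"
          using *(2,5) by (intro CollectI exI[of _ "J \<union> J'"] exI[of _ ?x]) simp
      qed
      show "emeasure (?m \<mu>) Y = emeasure (?m \<nu>) Y" if "Y \<in> {{f\<in>Cset. \<forall>t\<in>J. f t \<le> x t} | J (x :: 'a \<Rightarrow> real). finite J \<and> (\<forall>t. 0 < x t)}" for Y
      proof -
        obtain J x where Y: "Y = {f\<in>Cset. \<forall>t\<in>J. f t \<le> x t}" "finite J" "\<And>t. 0 < x t" using \<open>Y \<in> _\<close> by blast
        have Ys: "Y \<in> sets Cspace" unfolding Y by (rule X[OF Y(2)])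
        have "emeasure \<mu> (L (insert s J) (\<lambda>t. if t = s then (if s \<in> J then min \<epsilon> (x s) else \<epsilon>) else x t))
            = emeasure \<nu> (L (insert s J) (\<lambda>t. if t = s then (if s \<in> J then min \<epsilon> (x s) else \<epsilon>) else x t))"
          unfolding L_def using Y \<epsilon> by (intro eq) auto
        moreover have "emeasure \<mu> (L J x) = emeasure \<nu> (L J x)" unfolding L_def using Y by (intro eq) auto
        ultimately show ?thesis using m[OF Ys] gen[OF Y(2,3)] by (simp add: Y(1))
      qed
      show "range (\<lambda>_. Cset) \<subseteq> {{f\<in>Cset. \<forall>t\<in>J. f t \<le> x t} | J (x :: 'a \<Rightarrow> real). finite J \<and> (\<forall>t. 0 < x t)}"
        by (auto intro!: exI[of _ "{}"] exI[of _ "\<lambda>_. 1"])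
      show "emeasure (?m \<mu>) Cset \<noteq> \<infinity>"
      proof -
        have "emeasure (?m \<mu>) Cset = emeasure \<mu> (E s \<epsilon>)"
          using m[of Cset \<mu>] sets.top[of "Cspace :: ('a \<Rightarrow> real) measure"] by (simp add: E_def Int_def conj_commute)
        then show ?thesis using finL[of "{s}" "\<lambda>_. \<epsilon>" \<mu>] \<epsilon> by (simp add: E_L)
      qed
    qed (use s in \<open>auto simp: sets_Cspace_eq_pos_sublevels\<close>)
    then show ?thesis using m[OF B, of \<mu>] m[OF B, of \<nu>] by simp
  qed
  obtain D :: "'a set" where D: "countable D" "\<And>X. open X \<Longrightarrow> X \<noteq> {} \<Longrightarrow> \<exists>d\<in>D. d \<in> X"
    using countable_dense_setE by blast
  \<comment> \<open>A continuous function that is positive somewhere is positive at a point of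
    \<open>D\<close>, hence above some \<open>1 / Suc k\<close> there. These countably many sets
    cover \<open>A\<close>, and making them disjoint reduces the claim to
    \<open>local\<close>.\<close>
  define F where "F n = (case prod_decode n of (i, k) \<Rightarrow> E (from_nat_into D i) (1 / real (Suc k)))" for n
  have Fsets: "F n \<in> sets Cspace" for n by (auto simp: F_def Esets split: prod.split)
  define G where "G n = A \<inter> disjointed F n" for n
  have Gsub: "G n \<subseteq> F n" for n using disjointed_subset[of F n] by (auto simp: G_def)
  have Gsets: "G n \<in> sets Cspace" for n
    unfolding G_def using A(1) Fsets sets.range_disjointed_sets[of F Cspace] by auto
  have "A \<subseteq> (\<Union>n. F n)"
  proof
    fix f assume f: "f \<in> A"
    then have fC: "f \<in> Cset" using sets.sets_into_space[OF A(1)] by auto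
    obtain t where t: "0 < f t" using A(2)[OF f] by blast
    have "open (f -` {0<..})" using fC by (intro open_vimage) (auto simp: Cset_def)
    then obtain d where d: "d \<in> D" "0 < f d" using D(2)[of "f -` {0<..}"] t by auto
    obtain k where k: "1 / real (Suc k) < f d" using nat_approx_posE[OF d(2)] by auto
    obtain i where i: "from_nat_into D i = d" using from_nat_into_surj[OF D(1) d(1)] by blast
    have "f \<in> F (prod_encode (i, k))" using fC k by (simp add: F_def i E_def)
    then show "f \<in> (\<Union>n. F n)" by blast
  qed
  then have AG: "A = (\<Union>n. G n)" unfolding G_def using UN_disjointed_eq[of F] by auto
  have Gdisj: "disjoint_family G"
    using disjoint_family_disjointed[of F] unfolding G_def disjoint_family_on_def by blast
  have "emeasure \<mu> (G n) = emeasure \<nu> (G n)" for n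
  proof -
    obtain i k where "F n = E (from_nat_into D i) (1 / real (Suc k))"
      unfolding F_def by (cases "prod_decode n") simp
    then have "G n = E (from_nat_into D i) (1 / real (Suc k)) \<inter> G n" using Gsub[of n] by auto
    then show ?thesis using local[of "1 / real (Suc k)" "G n" "from_nat_into D i"] Gsets by simp
  qed
  then have "(\<Sum>n. emeasure \<mu> (G n)) = (\<Sum>n. emeasure \<nu> (G n))" by simp
  then show ?thesis
    unfolding AG using Gsets Gdisj s by (simp add: suminf_emeasure image_subset_iff)
qed

section \<open>Stationary max-stable processes\<close>

lemma measurable_pareto_intI:
  assumes "f \<in> borel_measurable N" "\<And>\<omega>. \<omega> \<in> space N \<Longrightarrow> 0 < f \<omega>"
  shows "f \<in> measurable N (pareto_int c)"
proof -
  have "f \<in> measurable N (restrict_space borel {0<..})"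
    using assms by (intro measurable_restrict_space2) auto
  then show ?thesis by (simp add: measurable_cong_sets[OF refl sets_pareto_int])
qed

text \<open>Marking takes the points as random elements of the space of \<open>pareto_int\<close>,
  the open half-line, whereas independence is assumed over the Borel sets of the line. The map
  \<open>r\<close> is measurable into the smaller space and fixes all values of \<open>X\<close>, so
  events can be pulled back along it; its value 1 at non-positive arguments is never taken by
  \<open>X\<close>.\<close>

lemma indep_rv2_pareto_int:
  fixes X :: "'w \<Rightarrow> 'i \<Rightarrow> real"
  assumes ind: "indep_rv2 M (\<Pi>\<^sub>M i\<in>UNIV. borel) X B Y"
    and pos: "\<And>\<omega> i. \<omega> \<in> space M \<Longrightarrow> 0 < X \<omega> i"
  shows "indep_rv2 M (\<Pi>\<^sub>M i\<in>UNIV. pareto_int 1) X B Y"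
proof -
  define r :: "('i \<Rightarrow> real) \<Rightarrow> 'i \<Rightarrow> real" where "r x i = (if 0 < x i then x i else 1)" for x i
  have "(\<lambda>x i. r x i) \<in> measurable (\<Pi>\<^sub>M i\<in>UNIV. borel) (\<Pi>\<^sub>M i\<in>UNIV. pareto_int 1)"
  proof (rule measurable_PiM_single')
    fix i :: 'i
    have [measurable]: "(\<lambda>x. x i) \<in> borel_measurable (\<Pi>\<^sub>M i\<in>UNIV. (borel :: real measure))"
      by (rule measurable_component_singleton) simp
    show "(\<lambda>x. r x i) \<in> measurable (\<Pi>\<^sub>M i\<in>UNIV. borel) (pareto_int 1)"
      unfolding r_def by (rule measurable_pareto_intI) auto
  qed (auto simp: r_def)
  then have r: "r \<in> measurable (\<Pi>\<^sub>M i\<in>UNIV. borel) (\<Pi>\<^sub>M i\<in>UNIV. pareto_int 1)" .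
  have X: "X \<in> measurable M (\<Pi>\<^sub>M i\<in>UNIV. borel)" and Y: "Y \<in> measurable M B"
    using ind by (auto simp: indep_rv2_def)
  have rX: "r (X \<omega>) = X \<omega>" if "\<omega> \<in> space M" for \<omega>
    using pos[OF that] by (auto simp: r_def)
  have "(\<lambda>\<omega>. r (X \<omega>)) \<in> measurable M (\<Pi>\<^sub>M i\<in>UNIV. pareto_int 1)"
    by (rule measurable_compose[OF X r])
  then have X': "X \<in> measurable M (\<Pi>\<^sub>M i\<in>UNIV. pareto_int 1)"
    by (rule measurable_cong[THEN iffD1, rotated]) (rule rX)
  have "measure M {\<omega>\<in>space M. X \<omega> \<in> A \<and> Y \<omega> \<in> C}
      = measure M {\<omega>\<in>space M. X \<omega> \<in> A} * measure M {\<omega>\<in>space M. Y \<omega> \<in> C}"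
    if A: "A \<in> sets (\<Pi>\<^sub>M i\<in>UNIV. pareto_int 1)" and C: "C \<in> sets B" for A C
  proof -
    let ?A = "r -` A \<inter> space (\<Pi>\<^sub>M i\<in>UNIV. borel)"
    have "?A \<in> sets (\<Pi>\<^sub>M i\<in>UNIV. borel)" by (rule measurable_sets[OF r A])
    then have "measure M {\<omega>\<in>space M. X \<omega> \<in> ?A \<and> Y \<omega> \<in> C}
      = measure M {\<omega>\<in>space M. X \<omega> \<in> ?A} * measure M {\<omega>\<in>space M. Y \<omega> \<in> C}"
      using ind C unfolding indep_rv2_def by blast
    moreover have eq: "X \<omega> \<in> ?A \<longleftrightarrow> X \<omega> \<in> A" if "\<omega> \<in> space M" for \<omega>
      using rX[OF that] measurable_space[OF X that] by auto
    have "{\<omega>\<in>space M. X \<omega> \<in> ?A \<and> Y \<omega> \<in> C} = {\<omega>\<in>space M. X \<omega> \<in> A \<and> Y \<omega> \<in> C}"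
      "{\<omega>\<in>space M. X \<omega> \<in> ?A} = {\<omega>\<in>space M. X \<omega> \<in> A}" using eq by blast+
    ultimately show ?thesis by (simp only:)
  qed
  then show ?thesis using X' Y by (auto simp: indep_rv2_def)
qed

locale stationary_max_stable = prob_space M for M :: "'w measure" +
  fixes U :: "nat \<Rightarrow> 'w \<Rightarrow> real"
    and W :: "nat \<Rightarrow> 'w \<Rightarrow> real^('d::{finite,linorder}) \<Rightarrow> real"
    and W0 :: "'w \<Rightarrow> real^('d::{finite,linorder}) \<Rightarrow> real"
  assumes U_ppp: "poisson_pp M (pareto_int 1) U"
    and U_pos: "\<And>i \<omega>. \<omega> \<in> space M \<Longrightarrow> 0 < U i \<omega>"
    and W0_meas: "W0 \<in> measurable M Cspace"
    and W_meas: "\<And>i. W i \<in> measurable M Cspace"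
    and W_copies: "\<And>i. distr M Cspace (W i) = distr M Cspace W0"
    and W_indep: "indep_vars (\<lambda>_. Cspace) W UNIV"
    and UW_indep: "indep_rv2 M (\<Pi>\<^sub>M i\<in>UNIV. borel) (\<lambda>\<omega> i. U i \<omega>)
                                           (\<Pi>\<^sub>M i\<in>UNIV. Cspace) (\<lambda>\<omega> i. W i \<omega>)"
    and W0_lim: "AE \<omega> in M. ((W0 \<omega>) \<longlongrightarrow> 0) at_infinity"
    and W0_mean: "\<And>t. integrable M (\<lambda>\<omega>. W0 \<omega> t)" "\<And>t. expectation (\<lambda>\<omega>. W0 \<omega> t) = 1"
    and W0_max: "\<And>K. compact K \<Longrightarrow> (\<integral>\<^sup>+\<omega>. ennreal (SUP t\<in>K. W0 \<omega> t) \<partial>M) < \<infinity>"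
    and stationary: "\<And>h T. finite T \<Longrightarrow>
        distr M (\<Pi>\<^sub>M t\<in>T. borel) (\<lambda>\<omega>. \<lambda>t\<in>T. SUP i. U i \<omega> * W i \<omega> (t + h))
      = distr M (\<Pi>\<^sub>M t\<in>T. borel) (\<lambda>\<omega>. \<lambda>t\<in>T. SUP i. U i \<omega> * W i \<omega> t)"
begin

definition PW :: "(real^('d::{finite,linorder}) \<Rightarrow> real) measure" where
  "PW = distr M Cspace W0"

sublocale PW: prob_space PW
  unfolding PW_def by (rule prob_space_distr) (rule W0_meas)

sublocale P1: sigma_finite_measure "pareto_int 1"
  by (rule sigma_finite_pareto_int) simp

sublocale P1W: pair_sigma_finite "pareto_int 1" PW ..

lemma sets_PW [simp, measurable_cong]: "sets PW = sets Cspace"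
  by (simp add: PW_def)

lemma space_PW [simp]: "space PW = Cset"
  by (simp add: PW_def)

lemma nn_integral_PW: "f \<in> borel_measurable Cspace \<Longrightarrow> (\<integral>\<^sup>+w. f w \<partial>PW) = (\<integral>\<^sup>+\<omega>. f (W0 \<omega>) \<partial>M)"
  unfolding PW_def by (rule nn_integral_distr[OF W0_meas]) simp

lemma AE_PW_Cvan: "AE w in PW. w \<in> Cvan"
proof -
  have "AE \<omega> in M. W0 \<omega> \<in> Cvan"
    using W0_lim AE_space
    by eventually_elim (use measurable_space[OF W0_meas] in \<open>auto simp: Cvan_def\<close>)
  moreover have "{w\<in>space Cspace. w \<in> Cvan} \<in> sets (Cspace :: (real^('d::{finite,linorder}) \<Rightarrow> real) measure)"
  proof -
    have "{w\<in>space Cspace. w \<in> Cvan} = (Cvan :: (real^('d::{finite,linorder}) \<Rightarrow> real) set)" by (auto simp: Cvan_def)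
    then show ?thesis by (simp only: sets_Cvan)
  qed
  ultimately show ?thesis 
    unfolding PW_def by (intro AE_distr_iff[OF W0_meas, THEN iffD2])
qed

lemma AE_M_Cvan: "AE \<omega> in M. W i \<omega> \<in> Cvan"
proof -
  have "AE w in distr M Cspace (W i). w \<in> Cvan" 
    using AE_PW_Cvan unfolding PW_def W_copies .
  moreover have "{w\<in>space Cspace. w \<in> Cvan} \<in> sets (Cspace :: (real^('d::{finite,linorder}) \<Rightarrow> real) measure)"
  proof -
    have "{w\<in>space Cspace. w \<in> Cvan} = (Cvan :: (real^('d::{finite,linorder}) \<Rightarrow> real) set)" by (auto simp: Cvan_def)
    then show ?thesis by (simp only: sets_Cvan)
  qed
  ultimately show ?thesis by (intro AE_distr_iff[OF W_meas, THEN iffD1])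
qed

lemma PW_mean: "(\<integral>\<^sup>+w. ennreal (w t) \<partial>PW) = 1"
proof -
  have "(\<integral>\<^sup>+w. ennreal (w t) \<partial>PW) = (\<integral>\<^sup>+\<omega>. ennreal (W0 \<omega> t) \<partial>M)"
    by (rule nn_integral_PW) (intro measurable_compose[OF measurable_eval_Cspace] measurable_ennreal)
  also have "\<dots> = ennreal (expectation (\<lambda>\<omega>. W0 \<omega> t))"
    using measurable_space[OF W0_meas]
    by (intro nn_integral_eq_integral W0_mean AE_I2) (auto simp: Cset_def)
  finally show ?thesis by (simp add: W0_mean)
qed

abbreviation PUW :: "(real \<times> (real^('d::{finite,linorder}) \<Rightarrow> real)) measure" where
  "PUW \<equiv> pareto_int 1 \<Otimes>\<^sub>M PW"

lemma measurable_P1W_eval [measurable]: "(\<lambda>p. fst p * snd p t) \<in> borel_measurable PUW"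
proof (rule borel_measurable_times)
  show "fst \<in> borel_measurable PUW"
    using measurable_compose[OF measurable_fst measurable_ident_pareto_int] .
  have "(\<lambda>p. snd p) \<in> measurable PUW Cspace" by measurable
  from measurable_compose[OF this measurable_eval_Cspace]
  show "(\<lambda>p. snd p t) \<in> borel_measurable PUW" .
qed

lemma space_P1W: "space PUW = {0<..} \<times> Cset"
  by (simp add: space_pair_measure)

lemma emeasure_P1W:
  assumes "{p\<in>{0<..} \<times> Cset. P (fst p) (snd p)} \<in> sets PUW"
  shows "emeasure PUW {p\<in>{0<..} \<times> Cset. P (fst p) (snd p)}
    = (\<integral>\<^sup>+w. emeasure (pareto_int 1) {u\<in>{0<..}. P u w} \<partial>PW)"
  by (subst P1W.emeasure_pair_measure_alt2[OF assms])
    (auto intro!: nn_integral_cong arg_cong[where f = "emeasure (pareto_int 1)"])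

lemma UW_poisson: "poisson_pp M PUW (\<lambda>i \<omega>. (U i \<omega>, W i \<omega>))"
proof -
  have UW: "indep_rv2 M (\<Pi>\<^sub>M i\<in>UNIV. pareto_int 1) (\<lambda>\<omega> i. U i \<omega>) (\<Pi>\<^sub>M i\<in>UNIV. Cspace) (\<lambda>\<omega> i. W i \<omega>)"
    by (rule indep_rv2_pareto_int[OF UW_indep]) (rule U_pos)
  have "poisson_pp M PUW (\<lambda>i \<omega>. (\<lambda>p. p) (U i \<omega>, W i \<omega>))"
  proof (rule poisson_pp_marking[OF U_ppp _ UW W_indep])
    show "distr M Cspace (W i) = PW" for i by (simp add: W_copies PW_def)
    have "{p \<in> space PUW. p \<in> A} = A" if "A \<in> sets PUW" for A
      using sets.sets_into_space[OF that] by auto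
    then show "{p \<in> space PUW. p \<in> A} \<in> sets PUW"
      "emeasure PUW A = emeasure PUW {p \<in> space PUW. p \<in> A}"
      if "A \<in> sets PUW" for A using that by simp_all
  qed (simp add: U_pos)
  then show ?thesis .
qed

text \<open>For fixed \<open>w\<close> the Pareto tail gives \<open>w t / x\<close>, and
  \<open>W\<close> has mean 1. In other words, \<xi> has unit Frechet marginals; this is the
  finiteness that \<open>poisson_sup\<close> asks for.\<close>

lemma exceed_measure: "0 < x \<Longrightarrow> emeasure PUW {p\<in>{0<..} \<times> Cset. x < fst p * snd p t} = ennreal (1 / x)"
proof -
  assume x: "0 < x"
  have S: "{p\<in>{0<..} \<times> Cset. x < fst p * snd p t} \<in> sets PUW"
    using measurable_P1W_eval[of t] by (simp add: borel_measurable_iff_greater space_P1W)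
  have "emeasure PUW {p\<in>{0<..} \<times> Cset. x < fst p * snd p t}
     = (\<integral>\<^sup>+w. emeasure (pareto_int 1) {u\<in>{0<..}. x < u * w t} \<partial>PW)"
    by (rule emeasure_P1W[OF S])
  also have "\<dots> = (\<integral>\<^sup>+w. ennreal (1 / x) * ennreal (w t) \<partial>PW)"
  proof (intro nn_integral_cong)
    fix w assume "w \<in> space PW"
    then have w: "0 \<le> w t" by (simp add: Cset_def)
    show "emeasure (pareto_int 1) {u\<in>{0<..}. x < u * w t} = ennreal (1 / x) * ennreal (w t)"
      unfolding emeasure_pareto_int_scaled_tail[OF x w] using x w by (simp flip: ennreal_mult)
  qed
  also have "\<dots> = ennreal (1 / x) * (\<integral>\<^sup>+w. ennreal (w t) \<partial>PW)"
    using measurable_eval_Cspace[of t] by (intro nn_integral_cmult) (simp cong: measurable_cong_sets)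
  finally show ?thesis by (simp add: PW_mean)
qed

text \<open>The shift \<open>h\<close> is built in so that both sides of the stationarity assumption
  are instances.\<close>

lemma UW_sup:
  assumes "finite T"
  shows "poisson_sup M PUW (\<lambda>i \<omega>. (U i \<omega>, W i \<omega>)) T (\<lambda>t p. fst p * snd p (t + h))"
proof
  show "(U i \<omega>, W i \<omega>) \<in> space PUW" if "\<omega> \<in> space M" for i \<omega>
    using U_pos[OF that] measurable_space[OF W_meas that] by (simp add: space_P1W)
  show "emeasure PUW {y \<in> space PUW. x < fst y * snd y (t + h)} < \<infinity>"
    if "0 < x" for t x using exceed_measure[OF that] by (simp add: space_P1W)
qed (use assms UW_poisson in \<open>auto simp: space_P1W Cset_def\<close>)

text \<open>The exponent measure of \<xi>, the intensity of the random functions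
  \<open>U i * W i\<close>. It has infinite mass at the zero function if \<open>W\<close> vanishes
  identically with positive probability.\<close>

definition spectral :: "(real^('d::{finite,linorder}) \<Rightarrow> real) measure" where
  "spectral = distr PUW Cspace (\<lambda>p t. fst p * snd p t)"

lemma measurable_P1W_mult [measurable]: "(\<lambda>p t. fst p * snd p t) \<in> measurable PUW Cspace"
  by (rule measurable_CspaceI) (auto simp: space_P1W intro: scale_Cset less_imp_le)

lemma sets_spectral [simp, measurable_cong]: "sets spectral = sets Cspace"
  by (simp add: spectral_def)

lemma space_spectral [simp]: "space spectral = Cset"
  by (simp add: spectral_def)

lemma emeasure_spectral:
  assumes "A \<in> sets Cspace"
  shows "emeasure spectral A = (\<integral>\<^sup>+w. emeasure (pareto_int 1) {u\<in>{0<..}. (\<lambda>t. u * w t) \<in> A} \<partial>PW)"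
proof -
  let ?S = "{p\<in>{0<..} \<times> Cset. (\<lambda>t. fst p * snd p t) \<in> A}"
  have eq: "(\<lambda>p t. fst p * snd p t) -` A \<inter> space PUW = ?S" by (auto simp: space_P1W)
  have S: "?S \<in> sets PUW"
    using measurable_sets[OF measurable_P1W_mult assms] by (simp only: eq)
  have "emeasure spectral A = emeasure PUW ?S"
    unfolding spectral_def using assms by (subst emeasure_distr[OF measurable_P1W_mult]) (simp_all only: eq)
  also have "\<dots> = (\<integral>\<^sup>+w. emeasure (pareto_int 1) {u\<in>{0<..}. (\<lambda>t. u * w t) \<in> A} \<partial>PW)"
    by (rule emeasure_P1W[OF S])
  finally show ?thesis .
qed

lemma sets_exceed: "finite J \<Longrightarrow> {f\<in>Cset. \<exists>t\<in>J. x t < f (t + h)} \<in> sets (Cspace :: (real^('d::{finite,linorder}) \<Rightarrow> real) measure)"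
proof -
  assume J: "finite J"
  have "{f\<in>space Cspace. \<exists>t\<in>J. x t < f (t + h)} \<in> sets (Cspace :: (real^('d::{finite,linorder}) \<Rightarrow> real) measure)"
    using measurable_eval_Cspace unfolding borel_measurable_iff_greater by (intro sets.sets_Collect_finite_Ex J) blast
  then show ?thesis by simp
qed

lemma spectral_exceed:
  assumes "finite J"
  shows "emeasure spectral {f\<in>Cset. \<exists>t\<in>J. x t < f (t + h)}
    = emeasure PUW {p\<in>space PUW. \<exists>t\<in>J. x t < fst p * snd p (t + h)}"
  unfolding spectral_def
  by (subst emeasure_distr[OF measurable_P1W_mult sets_exceed[OF assms]])
    (auto simp: space_P1W scale_Cset less_imp_le intro!: arg_cong[where f = "emeasure PUW"])

text \<open>Stationarity identifies exceedance measures of finitely many sites, and these determine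
  the measure away from the zero function; hence the condition that members of \<open>A\<close> are
  positive somewhere.\<close>

lemma spectral_translate:
  assumes A: "A \<in> sets Cspace" "\<And>f. f \<in> A \<Longrightarrow> \<exists>t. 0 < f t"
  shows "emeasure spectral {f\<in>Cset. translate h f \<in> A} = emeasure spectral A"
proof -
  have tm: "translate h \<in> measurable spectral Cspace" by measurable
  have "emeasure (distr spectral Cspace (translate h)) A = emeasure spectral A"
  proof (rule Cspace_measure_eqI_exceedances[OF _ _ _ _ A])
    fix J :: "(real^('d::{finite,linorder})) set" and x :: "real^('d::{finite,linorder}) \<Rightarrow> real" assume J: "finite J" and x: "\<And>t. 0 < x t"
    have "emeasure (distr spectral Cspace (translate h)) {f\<in>Cset. \<exists>t\<in>J. x t < f t} = emeasure spectral {f\<in>Cset. \<exists>t\<in>J. x t < f (t + h)}"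
    proof (subst emeasure_distr[OF tm])
      show "{f\<in>Cset. \<exists>t\<in>J. x t < f t} \<in> sets Cspace" using sets_exceed[OF J, of x 0] by simp
      have "translate h -` {f\<in>Cset. \<exists>t\<in>J. x t < f t} \<inter> space spectral = {f\<in>Cset. \<exists>t\<in>J. x t < f (t + h)}"
        by (auto simp: translate_Cset translate_apply)
      then show "emeasure spectral (translate h -` {f\<in>Cset. \<exists>t\<in>J. x t < f t} \<inter> space spectral)
        = emeasure spectral {f\<in>Cset. \<exists>t\<in>J. x t < f (t + h)}" by (simp only:)
    qed
    also have "\<dots> = emeasure PUW {p\<in>space PUW. \<exists>t\<in>J. x t < fst p * snd p (t + h)}"
      by (rule spectral_exceed[OF J])
    also have "\<dots> = emeasure PUW {p\<in>space PUW. \<exists>t\<in>J. x t < fst p * snd p (t + 0)}"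
      by (rule poisson_sup_distr_eqD[OF UW_sup[OF J] UW_sup[OF J] _ x])
        (use stationary[OF J, of h] in simp)
    also have "\<dots> = emeasure spectral {f\<in>Cset. \<exists>t\<in>J. x t < f (t + 0)}"
      by (rule spectral_exceed[OF J, symmetric])
    finally show *: "emeasure (distr spectral Cspace (translate h)) {f\<in>Cset. \<exists>t\<in>J. x t < f t} = emeasure spectral {f\<in>Cset. \<exists>t\<in>J. x t < f t}"
      by simp
    show "emeasure (distr spectral Cspace (translate h)) {f\<in>Cset. \<exists>t\<in>J. x t < f t} < \<infinity>"
      unfolding * using poisson_sup.exceed_ex_finite[OF UW_sup[OF J, of 0] order_refl x] spectral_exceed[OF J, of x 0] by simp
  qed simp_all
  moreover have "emeasure (distr spectral Cspace (translate h)) A = emeasure spectral {f\<in>Cset. translate h f \<in> A}"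
    using A(1) by (subst emeasure_distr[OF tm]) (auto intro!: arg_cong[where f = "emeasure spectral"])
  ultimately show ?thesis by simp
qed

end

section \<open>Polar coordinates: height, location and shape of the peak\<close>

context stationary_max_stable
begin

text \<open>Plays the role of an angular measure on locations and shapes. For fixed \<open>A\<close>
  it is a measure in \<open>B\<close>, and its translation invariance produces the Lebesgue
  factor.\<close>

definition angular :: "(real^('d::{finite,linorder}) \<Rightarrow> real) set \<Rightarrow> (real^('d::{finite,linorder})) set \<Rightarrow> ennreal" where
  "angular A B = (\<integral>\<^sup>+w. ennreal (gamma_of w) * indicator A (shape w) * indicator B (tau_of w) \<partial>PW)"

definition peaks :: "(real^('d::{finite,linorder}) \<Rightarrow> real) set \<Rightarrow> (real^('d::{finite,linorder})) set \<Rightarrow> (real^('d::{finite,linorder}) \<Rightarrow> real) set" where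
  "peaks A B = {f\<in>Cvan. 1 < gamma_of f \<and> tau_of f \<in> B \<and> shape f \<in> A}"

lemma nn_integral_PW_cong: "(\<And>w. w \<in> Cvan \<Longrightarrow> f w = g w) \<Longrightarrow> (\<integral>\<^sup>+w. f w \<partial>PW) = (\<integral>\<^sup>+w. g w \<partial>PW)"
  by (rule nn_integral_cong_AE) (rule eventually_mono[OF AE_PW_Cvan])

lemma Cset_sets [simp, measurable]: "Cset \<in> sets Cspace"
  using sets.top[of Cspace] by simp

lemma measurable_gamma_PW [measurable]: "gamma_of \<in> borel_measurable PW"
  using measurable_gamma_of by (simp cong: measurable_cong_sets)

lemma measurable_tau_PW [measurable]: "tau_of \<in> borel_measurable PW"
  using measurable_tau_of by (simp cong: measurable_cong_sets)

lemma measurable_shape_PW [measurable]: "shape \<in> measurable PW Cspace"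
  using measurable_shape by (simp cong: measurable_cong_sets)

lemma sets_peaks:
  assumes A: "A \<in> sets Cspace" and B: "B \<in> sets borel"
  shows "peaks A B \<in> sets Cspace"
proof -
  have g: "gamma_of -` {1<..} \<inter> space Cspace \<in> sets (Cspace :: (real^('d::{finite,linorder}) \<Rightarrow> real) measure)"
    by (rule measurable_sets[OF measurable_gamma_of]) simp
  have "peaks A B = Cvan \<inter> (gamma_of -` {1<..} \<inter> space Cspace) \<inter> (tau_of -` B \<inter> space Cspace) \<inter> (shape -` A \<inter> space Cspace)"
    by (auto simp: peaks_def Cvan_def)
  then show ?thesis
    using sets.Int[OF sets.Int[OF sets.Int[OF sets_Cvan g] measurable_sets[OF measurable_tau_of B]] measurable_sets[OF measurable_shape A]]
    by (simp only:)
qed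

text \<open>Multiplication by \<open>u\<close> changes neither location nor shape, so for fixed
  \<open>w\<close> only the condition \<open>1 < u * gamma_of w\<close> remains, whose Pareto mass
  is \<open>gamma_of w\<close>.\<close>

lemma angular_eq_spectral:
  assumes A: "A \<in> sets Cspace" and B: "B \<in> sets borel"
  shows "angular A B = emeasure spectral (peaks A B)"
proof -
  have "emeasure spectral (peaks A B) = (\<integral>\<^sup>+w. emeasure (pareto_int 1) {u\<in>{0<..}. (\<lambda>t. u * w t) \<in> peaks A B} \<partial>PW)"
    by (rule emeasure_spectral[OF sets_peaks[OF A B]])
  also have "\<dots> = (\<integral>\<^sup>+w. ennreal (gamma_of w) * indicator A (shape w) * indicator B (tau_of w) \<partial>PW)"
  proof (rule nn_integral_PW_cong)
    fix w :: "real^('d::{finite,linorder}) \<Rightarrow> real" assume elim: "w \<in> Cvan"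
    have iff: "(\<lambda>t. u * w t) \<in> peaks A B \<longleftrightarrow> 1 < u * gamma_of w \<and> tau_of w \<in> B \<and> shape w \<in> A" if "0 < u" for u
      using that elim by (simp add: peaks_def scale_Cvan gamma_of_scale tau_of_scale shape_scale Cvan_max(1))
    show "emeasure (pareto_int 1) {u\<in>{0<..}. (\<lambda>t. u * w t) \<in> peaks A B}
        = ennreal (gamma_of w) * indicator A (shape w) * indicator B (tau_of w)"
    proof (cases "tau_of w \<in> B \<and> shape w \<in> A")
      case True
      then have "{u\<in>{0<..}. (\<lambda>t. u * w t) \<in> peaks A B} = {u\<in>{0<..}. 1 < u * gamma_of w}" using iff by auto
      then show ?thesis
        using emeasure_pareto_int_scaled_tail[of 1 "gamma_of w"] Cvan_max(2)[OF elim] True by (simp only:) simp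
    next
      case False
      then have "{u\<in>{0<..}. (\<lambda>t. u * w t) \<in> peaks A B} = {}" using iff by auto
      moreover have "indicator A (shape w) * indicator B (tau_of w) = (0 :: ennreal)"
        using False by (auto simp: indicator_def)
      ultimately show ?thesis by (simp only: emeasure_empty mult.assoc mult_zero_right)
    qed
  qed
  finally show ?thesis by (simp add: angular_def)
qed

text \<open>Height and shape are unaffected by translation while the location shifts, so only
  \<open>B\<close> moves.\<close>

lemma peaks_translate: "{f\<in>Cset. translate h f \<in> peaks A B} = peaks A {x. x - h \<in> B}"
proof -
  have "translate h f \<in> peaks A B \<longleftrightarrow> f \<in> peaks A {x. x - h \<in> B}" if "f \<in> Cset" for f
    using translate_Cvan_iff[OF that, of h] tau_of_translate[of f h] shape_translate[of f h]
    by (auto simp: peaks_def gamma_of_translate)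
  moreover have "peaks A {x. x - h \<in> B} \<subseteq> Cset" by (auto simp: peaks_def Cvan_def)
  ultimately show ?thesis by blast
qed

lemma angular_translate:
  assumes A: "A \<in> sets Cspace" and B: "B \<in> sets borel"
  shows "angular A {x. x - h \<in> B} = angular A B"
proof -
  have B': "{x. x - h \<in> B} \<in> sets borel"
    using measurable_sets[of "\<lambda>x. x - h" borel borel B] B by (simp add: vimage_def)
  \<comment> \<open>Functions in \<open>peaks A B\<close> exceed 1 at their location, so they avoid
    the zero function and \<open>spectral_translate\<close> applies.\<close>
  have "\<exists>t. 0 < f t" if "f \<in> peaks A B" for f
  proof -
    have "f \<in> Cvan" "0 < gamma_of f" using that by (auto simp: peaks_def)
    then show ?thesis using Cvan_max(5)[of f] by metis
  qed
  then have "emeasure spectral {f\<in>Cset. translate h f \<in> peaks A B} = emeasure spectral (peaks A B)"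
    by (rule spectral_translate[OF sets_peaks[OF A B]])
  then show ?thesis by (simp add: peaks_translate angular_eq_spectral[OF A B] angular_eq_spectral[OF A B'])
qed

lemma angular_finite:
  assumes "compact K" shows "angular A K < \<infinity>"
proof -
  have K [measurable]: "K \<in> sets borel" using assms by (auto intro: borel_closed compact_imp_closed)
  have "angular A K \<le> (\<integral>\<^sup>+w. ennreal (gamma_of w) * indicator K (tau_of w) \<partial>PW)"
    unfolding angular_def by (intro nn_integral_mono) (auto simp: indicator_def)
  also have "\<dots> = (\<integral>\<^sup>+\<omega>. ennreal (gamma_of (W0 \<omega>)) * indicator K (tau_of (W0 \<omega>)) \<partial>M)"
    by (rule nn_integral_PW) measurable
  also have "\<dots> \<le> (\<integral>\<^sup>+\<omega>. ennreal (SUP t\<in>K. W0 \<omega> t) \<partial>M)"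
  proof (rule nn_integral_mono_AE)
    have "AE w in distr M Cspace W0. w \<in> Cvan" using AE_PW_Cvan unfolding PW_def .
    then have "AE \<omega> in M. W0 \<omega> \<in> Cvan" by (rule AE_distrD[OF W0_meas])
    then show "AE \<omega> in M. ennreal (gamma_of (W0 \<omega>)) * indicator K (tau_of (W0 \<omega>)) \<le> ennreal (SUP t\<in>K. W0 \<omega> t)"
    proof eventually_elim
      case (elim \<omega>)
      show ?case
      proof (cases "tau_of (W0 \<omega>) \<in> K \<and> 0 < gamma_of (W0 \<omega>)")
        case True
        have "gamma_of (W0 \<omega>) = W0 \<omega> (tau_of (W0 \<omega>))" using Cvan_max(5)[OF elim] True by simp
        also have "\<dots> \<le> (SUP t\<in>K. W0 \<omega> t)"
          using True Cvan_max(1)[OF elim] by (intro cSUP_upper) (auto intro: bdd_above_mono)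
        finally show ?thesis using True by (simp add: ennreal_leI)
      next
        case False
        then show ?thesis using Cvan_max(2)[OF elim] by (auto simp: indicator_def not_less)
      qed
    qed
  qed
  also have "\<dots> < \<infinity>" by (rule W0_max[OF assms])
  finally show ?thesis .
qed

abbreviation unit_box :: "(real^('d::{finite,linorder})) set" where
  "unit_box \<equiv> cbox 0 One"

text \<open>Realises \<open>angular A\<close> as the law of the location under a weighted measure,
  so that the uniqueness of Lebesgue measure can be applied to it.\<close>

lemma emeasure_angular:
  assumes A: "A \<in> sets Cspace" and B: "B \<in> sets borel"
  shows "emeasure (distr (density PW (\<lambda>w. ennreal (gamma_of w) * indicator A (shape w))) borel tau_of) B = angular A B"
proof -
  have [measurable]: "(\<lambda>w. ennreal (gamma_of w) * indicator A (shape w)) \<in> borel_measurable PW"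
    using A[measurable] by measurable
  have tm: "tau_of \<in> measurable (density PW (\<lambda>w. ennreal (gamma_of w) * indicator A (shape w))) borel" by simp
  have S: "tau_of -` B \<inter> Cset \<in> sets PW" using measurable_sets[OF measurable_tau_PW B] by simp
  show ?thesis
    unfolding angular_def using S B
    by (subst emeasure_distr[OF tm])
      (simp_all add: emeasure_density, auto simp: indicator_def intro!: nn_integral_cong)
qed

text \<open>Comparison with the unit box identifies the multiple, since its Lebesgue measure is
  1.\<close>

lemma angular_lborel:
  assumes A: "A \<in> sets Cspace" and B: "B \<in> sets borel"
  shows "angular A B = angular A unit_box * emeasure lborel B"
proof -
  let ?m = "distr (density PW (\<lambda>w. ennreal (gamma_of w) * indicator A (shape w))) borel tau_of"
  have "emeasure ?m B * emeasure lborel unit_box = emeasure ?m unit_box * emeasure lborel B"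
  proof (rule translation_invariant_measure_eq_lborel)
    show "sigma_finite_measure ?m"
    proof
      show "\<exists>S. countable S \<and> S \<subseteq> sets ?m \<and> \<Union> S = space ?m \<and> (\<forall>a\<in>S. emeasure ?m a \<noteq> \<infinity>)"
      proof (intro exI[of _ "range (\<lambda>n::nat. cball 0 (real n))"] conjI ballI)
        have "\<exists>n::nat. norm x \<le> real n" for x :: "real^('d::{finite,linorder})" by (rule real_arch_simple)
        then show "\<Union> (range (\<lambda>n::nat. cball 0 (real n))) = space ?m" by auto
        fix a assume "a \<in> range (\<lambda>n::nat. cball (0 :: real^('d::{finite,linorder})) (real n))"
        then obtain n where a: "a = cball 0 (real n)" by blast
        show "emeasure ?m a \<noteq> \<infinity>"
          unfolding a using emeasure_angular[OF A, of "cball 0 (real n)"] angular_finite[of "cball 0 (real n)" A] by simp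
      qed auto
    qed
    show "emeasure ?m {x. x - h \<in> B'} = emeasure ?m B'" if B': "B' \<in> sets borel" for h B'
    proof -
      have "{x. x - h \<in> B'} \<in> sets borel"
        using measurable_sets[of "\<lambda>x. x - h" borel borel B'] B' by (simp add: vimage_def)
      then show ?thesis using angular_translate[OF A B', of h] by (simp only: emeasure_angular[OF A] B')
    qed
  qed (use B in auto)
  then show ?thesis using B by (simp add: emeasure_angular[OF A] emeasure_lborel_cbox_eq inner_Basis_inf_left cong: prod.cong)
qed

text \<open>The constant \<open>c\<close>: the expected number of peaks above level 1 per unit
  volume, equivalently the density of the location under the law of \<open>W\<close> weighted by
  \<open>gamma_of\<close>.\<close>

definition peak_rate :: real where "peak_rate = enn2real (angular Cset unit_box)"

lemma angular_peak_rate: "angular Cset unit_box = ennreal peak_rate"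
  using angular_finite[of unit_box Cset] by (simp add: peak_rate_def)

text \<open>Otherwise \<open>angular Cset\<close> would vanish on the whole space, so
  \<open>gamma_of\<close> and with it \<open>W\<close> would be 0 almost surely, against the mean
  1.\<close>

lemma peak_rate_pos: "0 < peak_rate"
proof (rule ccontr)
  assume "\<not> 0 < peak_rate"
  then have "peak_rate = 0" using enn2real_nonneg[of "angular Cset unit_box"] by (simp only: peak_rate_def not_less antisym)
  then have "angular Cset UNIV = 0"
    using angular_lborel[of Cset UNIV] by (simp add: angular_peak_rate)
  then have "AE w in PW. ennreal (gamma_of w) * indicator Cset (shape w) * indicator UNIV (tau_of w) = 0"
    unfolding angular_def by (subst (asm) nn_integral_0_iff_AE) measurable
  then have "AE w in PW. w 0 = 0"
    using AE_PW_Cvan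
  proof eventually_elim
    case (elim w)
    then have "shape w \<in> Cset" by (intro shape_Cset) (simp add: Cvan_def)
    then have "gamma_of w = 0" using elim Cvan_max(2)[OF elim(2)] by simp
    then show ?case using Cvan_gamma_0[OF elim(2)] by simp
  qed
  then have "(\<integral>\<^sup>+w. ennreal (w 0) \<partial>PW) = (\<integral>\<^sup>+w. 0 \<partial>PW)" by (intro nn_integral_cong_AE) auto
  then show False by (simp add: PW_mean)
qed

text \<open>The formula for the shape law with \<open>K\<close> the unit box, whose denominator is
  \<open>peak_rate\<close>. \<open>PF_ratio\<close> shows that every other \<open>K\<close> gives
  the same law.\<close>

definition PF :: "(real^('d::{finite,linorder}) \<Rightarrow> real) measure" where
  "PF = distr (density PW (\<lambda>w. ennreal (1 / peak_rate) * (ennreal (gamma_of w) * indicator unit_box (tau_of w)))) Cspace shape"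

lemma sets_PF [simp, measurable_cong]: "sets PF = sets Cspace"
  by (simp add: PF_def)

lemma space_PF [simp]: "space PF = Cset"
  by (simp add: PF_def)

lemma emeasure_PF:
  assumes A: "A \<in> sets Cspace" shows "emeasure PF A = ennreal (1 / peak_rate) * angular A unit_box"
proof -
  let ?g = "\<lambda>w. ennreal (1 / peak_rate) * (ennreal (gamma_of w) * indicator unit_box (tau_of w))"
  have [measurable]: "?g \<in> borel_measurable PW" by measurable
  have sm: "shape \<in> measurable (density PW ?g) Cspace" by simp
  have S: "shape -` A \<inter> Cset \<in> sets PW" using measurable_sets[OF measurable_shape_PW A] by simp
  have "emeasure PF A = (\<integral>\<^sup>+w. ennreal (1 / peak_rate) * (ennreal (gamma_of w) * indicator A (shape w) * indicator unit_box (tau_of w)) \<partial>PW)"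
    unfolding PF_def using S A
    by (subst emeasure_distr[OF sm])
      (simp_all add: emeasure_density, auto simp: indicator_def intro!: nn_integral_cong)
  also have "\<dots> = ennreal (1 / peak_rate) * angular A unit_box"
    unfolding angular_def using A[measurable] by (intro nn_integral_cmult) measurable
  finally show ?thesis .
qed

sublocale PF: prob_space PF
proof
  show "emeasure PF (space PF) = 1"
    using peak_rate_pos by (simp add: emeasure_PF angular_peak_rate flip: ennreal_mult)
qed

lemma angular_PF:
  assumes A: "A \<in> sets Cspace" and B: "B \<in> sets borel"
  shows "angular A B = ennreal peak_rate * (emeasure lborel B * emeasure PF A)"
proof -
  have "ennreal peak_rate * ennreal (1 / peak_rate) = 1" using peak_rate_pos by (simp flip: ennreal_mult)
  then have "angular A unit_box = ennreal peak_rate * emeasure PF A"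
    by (simp add: emeasure_PF[OF A] mult.assoc[symmetric])
  then show ?thesis using angular_lborel[OF A B] by (simp add: mult_ac)
qed

text \<open>Under the law of \<open>W\<close> weighted by \<open>gamma_of\<close>, location and
  shape separate into \<open>peak_rate\<close> times Lebesgue measure and \<open>PF\<close>. This
  change of variables gives the intensity of the polar process, the value of \<open>c\<close> and
  the exceedances of the moving maxima.\<close>

lemma nn_integral_lborel_PF:
  assumes g: "g \<in> borel_measurable (borel \<Otimes>\<^sub>M Cspace)"
  shows "(\<integral>\<^sup>+w. ennreal (gamma_of w) * g (tau_of w, shape w) \<partial>PW) = ennreal peak_rate * (\<integral>\<^sup>+p. g p \<partial>(lborel \<Otimes>\<^sub>M PF))"
proof -
  let ?D = "density PW (\<lambda>w. ennreal (gamma_of w))"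
  let ?Q = "distr ?D (borel \<Otimes>\<^sub>M Cspace) (\<lambda>w. (tau_of w, shape w))"
  have pm: "(\<lambda>w. (tau_of w, shape w)) \<in> measurable ?D (borel \<Otimes>\<^sub>M Cspace)" by (simp add: measurable_Pair)
  have "lborel \<Otimes>\<^sub>M PF = scale_measure (ennreal (1 / peak_rate)) ?Q"
  proof (rule pair_measure_eqI)
    show "sets (lborel \<Otimes>\<^sub>M PF) = sets (scale_measure (ennreal (1 / peak_rate)) ?Q)"
      by (simp cong: sets_pair_measure_cong)
    fix B :: "(real^('d::{finite,linorder})) set" and A assume "B \<in> sets lborel" "A \<in> sets PF"
    then have B: "B \<in> sets borel" and A: "A \<in> sets Cspace" by simp_all
    have S: "(\<lambda>w. (tau_of w, shape w)) -` (B \<times> A) \<inter> Cset \<in> sets PW"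
      using measurable_sets[OF pm, of "B \<times> A"] A B by simp
    have "emeasure ?Q (B \<times> A) = angular A B"
      unfolding angular_def using S A B
      by (subst emeasure_distr[OF pm])
        (simp_all add: emeasure_density, auto simp: indicator_def intro!: nn_integral_cong)
    also have "\<dots> = ennreal peak_rate * (emeasure lborel B * emeasure PF A)" by (rule angular_PF[OF A B])
    finally have "emeasure (scale_measure (ennreal (1 / peak_rate)) ?Q) (B \<times> A) = ennreal (1 / peak_rate) * (ennreal peak_rate * (emeasure lborel B * emeasure PF A))"
      by simp
    also have "\<dots> = emeasure lborel B * emeasure PF A"
    proof -
      have "ennreal (1 / peak_rate) * ennreal peak_rate = 1" using peak_rate_pos by (simp flip: ennreal_mult)
      then show ?thesis by (simp add: mult.assoc[symmetric])
    qed
    finally show "emeasure lborel B * emeasure PF A = emeasure (scale_measure (ennreal (1 / peak_rate)) ?Q) (B \<times> A)" by simp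
  qed (unfold_locales)
  then have "(\<integral>\<^sup>+p. g p \<partial>(lborel \<Otimes>\<^sub>M PF)) = ennreal (1 / peak_rate) * (\<integral>\<^sup>+p. g p \<partial>?Q)"
    using g by (simp add: nn_integral_scale_measure)
  also have "(\<integral>\<^sup>+p. g p \<partial>?Q) = (\<integral>\<^sup>+w. g (tau_of w, shape w) \<partial>?D)"
    using g by (intro nn_integral_distr[OF pm]) simp
  also have "\<dots> = (\<integral>\<^sup>+w. ennreal (gamma_of w) * g (tau_of w, shape w) \<partial>PW)"
  proof (rule nn_integral_density)
    show "(\<lambda>w. g (tau_of w, shape w)) \<in> borel_measurable PW"
      using measurable_compose[OF pm g] by simp
  qed measurable
  finally have "ennreal peak_rate * (\<integral>\<^sup>+p. g p \<partial>(lborel \<Otimes>\<^sub>M PF))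
      = (ennreal peak_rate * ennreal (1 / peak_rate)) * (\<integral>\<^sup>+w. ennreal (gamma_of w) * g (tau_of w, shape w) \<partial>PW)"
    by (simp add: mult.assoc)
  also have "ennreal peak_rate * ennreal (1 / peak_rate) = 1" using peak_rate_pos by (simp flip: ennreal_mult)
  finally show ?thesis by simp
qed

text \<open>After the reflection of \<open>t\<close> the left side is, up to the factor
  \<open>peak_rate\<close>, the mean of \<open>gamma_of w * shape w (- tau_of w)\<close>. This
  product is \<open>w 0\<close>, which has mean 1.\<close>

lemma nn_integral_PF_total: "(\<integral>\<^sup>+t. (\<integral>\<^sup>+f. ennreal (f t) \<partial>PF) \<partial>lborel) = ennreal (1 / peak_rate)"
proof -
  have em: "(\<lambda>p. snd p (fst p)) \<in> borel_measurable (borel \<Otimes>\<^sub>M (Cspace :: (real^('d::{finite,linorder}) \<Rightarrow> real) measure))"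
    using measurable_eval_pair_Cspace by (simp add: split_beta')
  have em': "(\<lambda>p. ennreal (snd p (fst p))) \<in> borel_measurable (borel \<Otimes>\<^sub>M (Cspace :: (real^('d::{finite,linorder}) \<Rightarrow> real) measure))"
    using em by measurable
  have em'': "(\<lambda>p. ennreal (snd p (fst p))) \<in> borel_measurable (borel \<Otimes>\<^sub>M PF)"
    using em' by (simp cong: measurable_cong_sets sets_pair_measure_cong)
  let ?H = "\<lambda>t. \<integral>\<^sup>+f. ennreal (f t) \<partial>PF"
  have H: "?H \<in> borel_measurable borel"
    using PF.borel_measurable_nn_integral_fst[OF em''] by simp
  have gm: "(\<lambda>p. ennreal (snd p (0 - fst p))) \<in> borel_measurable (borel \<Otimes>\<^sub>M (Cspace :: (real^('d::{finite,linorder}) \<Rightarrow> real) measure))"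
    by (rule measurable_compose[OF measurable_apply_Cspace[where F = snd and T = "\<lambda>p. 0 - fst p"] measurable_ennreal]) measurable
  have gm': "(\<lambda>p. ennreal (snd p (0 - fst p))) \<in> borel_measurable (lborel \<Otimes>\<^sub>M PF)"
    using gm by (simp cong: measurable_cong_sets sets_pair_measure_cong)
  have "(\<integral>\<^sup>+t. ?H t \<partial>lborel) = (\<integral>\<^sup>+t. ?H (0 - t) \<partial>lborel)"
    by (rule nn_integral_lborel_reflect[OF H, symmetric])
  also have "\<dots> = (\<integral>\<^sup>+p. ennreal (snd p (0 - fst p)) \<partial>(lborel \<Otimes>\<^sub>M PF))"
    using PF.nn_integral_fst[OF gm'] by simp
  finally have "ennreal peak_rate * (\<integral>\<^sup>+t. ?H t \<partial>lborel) = (\<integral>\<^sup>+w. ennreal (gamma_of w) * ennreal (shape w (0 - tau_of w)) \<partial>PW)"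
    using nn_integral_lborel_PF[OF gm] by simp
  also have "\<dots> = (\<integral>\<^sup>+w. ennreal (w 0) \<partial>PW)"
  proof (rule nn_integral_PW_cong)
    fix w :: "real^('d::{finite,linorder}) \<Rightarrow> real" assume elim: "w \<in> Cvan"
    have "0 \<le> shape w (0 - tau_of w)" using shape_Cset[of w] elim by (simp add: Cvan_def Cset_def)
    then show "ennreal (gamma_of w) * ennreal (shape w (0 - tau_of w)) = ennreal (w 0)"
      using Cvan_shape_mult[OF elim, of 0] Cvan_max(2)[OF elim] by (simp flip: ennreal_mult)
  qed
  finally have "ennreal peak_rate * (\<integral>\<^sup>+t. ?H t \<partial>lborel) = 1" by (simp add: PW_mean)
  then have "ennreal (1 / peak_rate) * (ennreal peak_rate * (\<integral>\<^sup>+t. ?H t \<partial>lborel)) = ennreal (1 / peak_rate)" by simp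
  moreover have "ennreal (1 / peak_rate) * ennreal peak_rate = 1" using peak_rate_pos by (simp flip: ennreal_mult)
  ultimately show ?thesis by (simp add: mult.assoc[symmetric])
qed

end

lemma emeasure_pareto_int_scale:
  assumes S: "{u\<in>{0<..}. P u} \<in> sets (pareto_int 1)" and a: "0 < a"
  shows "emeasure (pareto_int 1) {u\<in>{0<..}. P (a * u)} = ennreal a * emeasure (pareto_int 1) {u\<in>{0<..}. P u}"
proof -
  let ?i = "indicator {u\<in>{0<..}. P u} :: real \<Rightarrow> ennreal"
  have im: "?i \<in> borel_measurable (pareto_int 1)" using S by (rule borel_measurable_indicator)
  have eq: "?i (a * u) = indicator {u\<in>{0<..}. P (a * u)} u" for u
    using a by (simp add: indicator_def zero_less_mult_iff)
  have "(\<lambda>u. ?i (a * u)) \<in> borel_measurable (pareto_int 1)" by (rule measurable_pareto_int_scale[OF im a])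
  then have S': "{u\<in>{0<..}. P (a * u)} \<in> sets (pareto_int 1)"
    unfolding eq by (subst (asm) borel_measurable_indicator_iff) (simp add: Int_absorb2 subset_eq)
  have "(\<integral>\<^sup>+u. ?i (a * u) \<partial>pareto_int 1) = ennreal a * (\<integral>\<^sup>+u. ?i u \<partial>pareto_int 1)"
    by (rule nn_integral_pareto_int_scale[OF im a])
  then show ?thesis using S S' by (simp only: eq nn_integral_indicator)
qed

section \<open>The polar point process and the moving maxima\<close>

context stationary_max_stable
begin

lemma lex_inf_exists:
  "AE \<omega> in M. bdd_above (range (W i \<omega>)) \<and> (0 < gamma_of (W i \<omega>) \<longrightarrow> (\<exists>x. is_lex_inf (argsup (W i \<omega>)) x))"
  using AE_M_Cvan[of i] by eventually_elim (metis Cvan_max(1) Cvan_max(4))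

text \<open>Marking with the polar map. Points with \<open>gamma_of\<close> not positive have a
  non-positive first coordinate, so they lie in no measurable set of the target space and are not
  counted; this makes the plain division by \<open>gamma_of\<close> harmless.\<close>

lemma polar_poisson:
  "poisson_pp M (pareto_int peak_rate \<Otimes>\<^sub>M lborel \<Otimes>\<^sub>M PF)
     (\<lambda>i \<omega>. (U i \<omega> * gamma_of (W i \<omega>), tau_of (W i \<omega>), \<lambda>t. W i \<omega> (t + tau_of (W i \<omega>)) / gamma_of (W i \<omega>)))"
proof -
  define \<Psi> where "\<Psi> p = (fst p * gamma_of (snd p), tau_of (snd p), \<lambda>t. snd p (t + tau_of (snd p)) / gamma_of (snd p))"
    for p :: "real \<times> (real^('d::{finite,linorder}) \<Rightarrow> real)"
  \<comment> \<open>\<open>\<Psi>'\<close> is measurable into the target space and agrees with \<open>\<Psi>\<close> whenever \<open>\<Psi>\<close> takes its values there.\<close>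
  define \<Psi>' where "\<Psi>' p = (if 0 < fst p * gamma_of (snd p) then fst p * gamma_of (snd p) else 1, tau_of (snd p), shape (snd p))"
    for p :: "real \<times> (real^('d::{finite,linorder}) \<Rightarrow> real)"
  let ?N = "(lborel :: (real^('d::{finite,linorder})) measure) \<Otimes>\<^sub>M PF"
  let ?\<eta> = "pareto_int peak_rate \<Otimes>\<^sub>M ?N"
  interpret Pc: sigma_finite_measure "pareto_int peak_rate" using peak_rate_pos by (intro sigma_finite_pareto_int) simp
  interpret lF: pair_sigma_finite "lborel :: (real^('d::{finite,linorder})) measure" PF ..
  interpret N: sigma_finite_measure ?N by unfold_locales
  interpret cN: pair_sigma_finite "pareto_int peak_rate" ?N ..
  have sp\<eta>: "space ?\<eta> = {0<..} \<times> UNIV \<times> Cset" by (simp add: space_pair_measure)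
  have sets\<eta>: "sets ?\<eta> = sets (pareto_int 1 \<Otimes>\<^sub>M ?N)"
    by (intro sets_pair_measure_cong refl) (simp add: sets_pareto_int)
  have fstm: "fst \<in> borel_measurable PUW"
    using measurable_compose[OF measurable_fst measurable_ident_pareto_int] .
  have gm [measurable]: "(\<lambda>p. gamma_of (snd p)) \<in> borel_measurable PUW"
    by (rule measurable_compose[OF measurable_snd measurable_gamma_PW])
  note hm = borel_measurable_times[OF fstm gm]
  have tm: "(\<lambda>p. tau_of (snd p)) \<in> borel_measurable PUW"
    by (rule measurable_compose[OF measurable_snd measurable_tau_PW])
  have sm: "(\<lambda>p. shape (snd p)) \<in> measurable PUW Cspace"
    by (rule measurable_compose[OF measurable_snd measurable_shape_PW])
  have \<Psi>'m: "\<Psi>' \<in> measurable PUW ?\<eta>"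
    unfolding \<Psi>'_def
  proof (intro measurable_Pair)
    show "(\<lambda>p. if 0 < fst p * gamma_of (snd p) then fst p * gamma_of (snd p) else 1) \<in> measurable PUW (pareto_int peak_rate)"
    proof (rule measurable_pareto_intI)
      have "(\<lambda>x::real. if 0 < x then x else 1) \<in> borel_measurable borel" by measurable
      from measurable_compose[OF hm this]
      show "(\<lambda>p. if 0 < fst p * gamma_of (snd p) then fst p * gamma_of (snd p) else 1) \<in> borel_measurable PUW" .
    qed simp
    show "(\<lambda>p. tau_of (snd p)) \<in> measurable PUW lborel" using tm by simp
    show "(\<lambda>p. shape (snd p)) \<in> measurable PUW PF"
      using sm measurable_cong_sets[OF refl sets_PF] by blast
  qed
  have iff: "\<Psi> p \<in> A \<longleftrightarrow> 0 < gamma_of (snd p) \<and> \<Psi>' p \<in> A"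
    if A: "A \<in> sets ?\<eta>" and p: "p \<in> space PUW" for A p
  proof -
    have u: "0 < fst p" using p by (auto simp: space_P1W)
    have "\<Psi> p = \<Psi>' p" if "0 < gamma_of (snd p)"
      using u that by (simp add: \<Psi>_def \<Psi>'_def shape_def)
    moreover have "0 < gamma_of (snd p)" if "\<Psi> p \<in> A"
    proof -
      have "\<Psi> p \<in> space ?\<eta>" using sets.sets_into_space[OF A] that by blast
      then have "0 < fst p * gamma_of (snd p)" by (simp add: sp\<eta> \<Psi>_def)
      then show ?thesis using u by (simp add: zero_less_mult_iff)
    qed
    ultimately show ?thesis by auto
  qed
  have Seq: "{p \<in> space PUW. \<Psi> p \<in> A}
      = {p \<in> space PUW. 0 < gamma_of (snd p)} \<inter> (\<Psi>' -` A \<inter> space PUW)"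
    if "A \<in> sets ?\<eta>" for A using iff[OF that] by blast
  have S: "{p \<in> space PUW. \<Psi> p \<in> A} \<in> sets PUW" if "A \<in> sets ?\<eta>" for A
    unfolding Seq[OF that] by (intro sets.Int measurable_sets[OF \<Psi>'m that]) measurable
  have UW: "indep_rv2 M (\<Pi>\<^sub>M i\<in>UNIV. pareto_int 1) (\<lambda>\<omega> i. U i \<omega>) (\<Pi>\<^sub>M i\<in>UNIV. Cspace) (\<lambda>\<omega> i. W i \<omega>)"
    by (rule indep_rv2_pareto_int[OF UW_indep]) (rule U_pos)
  have "poisson_pp M ?\<eta> (\<lambda>i \<omega>. \<Psi> (U i \<omega>, W i \<omega>))"
  proof (rule poisson_pp_marking[OF U_ppp _ UW W_indep])
    show "distr M Cspace (W i) = PW" for i by (simp add: W_copies PW_def)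
    show "U i \<omega> \<in> space (pareto_int 1)" if "\<omega> \<in> space M" for i \<omega> using U_pos[OF that] by simp
    fix A assume A: "A \<in> sets ?\<eta>"
    show "{p \<in> space PUW. \<Psi> p \<in> A} \<in> sets PUW" by (rule S[OF A])
    have A1: "A \<in> sets (pareto_int 1 \<Otimes>\<^sub>M ?N)" using A sets\<eta> by simp
    \<comment> \<open>The Pareto mass of the section of \<open>A\<close> at a given location and
      shape, as a function to which \<open>nn_integral_lborel_PF\<close> applies.\<close>
    define G where "G q = (\<integral>\<^sup>+v. indicator A (v, q) \<partial>pareto_int 1)" for q
    have sec: "(\<lambda>v. indicator A (v, q) :: ennreal) \<in> borel_measurable (pareto_int 1)" if "q \<in> space ?N" for q
      by (rule measurable_compose[OF measurable_Pair2'[OF that] borel_measurable_indicator[OF A1]])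
    have "(\<lambda>(q, v). indicator A (v, q) :: ennreal) \<in> borel_measurable (?N \<Otimes>\<^sub>M pareto_int 1)"
      using measurable_pair_swap[OF borel_measurable_indicator[OF A1]] by (simp add: split_beta')
    from P1.borel_measurable_nn_integral[OF this] have "G \<in> borel_measurable ?N"
      unfolding G_def[abs_def] .
    then have Gm: "G \<in> borel_measurable (borel \<Otimes>\<^sub>M Cspace)"
      by (simp cong: measurable_cong_sets sets_pair_measure_cong)
    have seteq: "{p \<in> space PUW. \<Psi> p \<in> A} = {p\<in>{0<..} \<times> Cset. \<Psi> (fst p, snd p) \<in> A}"
      by (simp add: space_P1W)
    have "emeasure PUW {p\<in>{0<..} \<times> Cset. \<Psi> (fst p, snd p) \<in> A}
       = (\<integral>\<^sup>+w. emeasure (pareto_int 1) {u\<in>{0<..}. \<Psi> (u, w) \<in> A} \<partial>PW)"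
      using S[OF A] unfolding seteq by (rule emeasure_P1W)
    also have "\<dots> = (\<integral>\<^sup>+w. ennreal (gamma_of w) * G (tau_of w, shape w) \<partial>PW)"
    proof (rule nn_integral_PW_cong)
      fix w :: "real^('d::{finite,linorder}) \<Rightarrow> real" assume w: "w \<in> Cvan"
      then have wC: "w \<in> Cset" by (simp add: Cvan_def)
      have q: "(tau_of w, shape w) \<in> space ?N" using shape_Cset[OF wC] by (simp add: space_pair_measure)
      \<comment> \<open>For fixed \<open>w\<close> location and shape do not depend on
        \<open>u\<close>, and the first coordinate is a multiple of \<open>u\<close>. Substituting
        it for \<open>u\<close> yields the weight \<open>gamma_of w\<close>.\<close>
      have iffw: "\<Psi> (u, w) \<in> A \<longleftrightarrow> 0 < gamma_of w \<and> (gamma_of w * u, tau_of w, shape w) \<in> A" if "0 < u" for u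
        using iff[OF A, of "(u, w)"] that wC by (auto simp: space_P1W \<Psi>'_def mult.commute)
      show "emeasure (pareto_int 1) {u\<in>{0<..}. \<Psi> (u, w) \<in> A} = ennreal (gamma_of w) * G (tau_of w, shape w)"
      proof (cases "0 < gamma_of w")
        case True
        have "{v\<in>{0<..}. (v, tau_of w, shape w) \<in> A} = (\<lambda>v. (v, tau_of w, shape w)) -` A \<inter> space (pareto_int 1)" by auto
        also have "\<dots> \<in> sets (pareto_int 1)" by (rule measurable_sets[OF measurable_Pair2'[OF q] A1])
        finally have V: "{v\<in>{0<..}. (v, tau_of w, shape w) \<in> A} \<in> sets (pareto_int 1)" .
        have "G (tau_of w, shape w) = (\<integral>\<^sup>+v. indicator {v\<in>{0<..}. (v, tau_of w, shape w) \<in> A} v \<partial>pareto_int 1)"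
          unfolding G_def by (intro nn_integral_cong) (simp add: indicator_def)
        also have "\<dots> = emeasure (pareto_int 1) {v\<in>{0<..}. (v, tau_of w, shape w) \<in> A}"
          using V by (rule nn_integral_indicator)
        finally have "ennreal (gamma_of w) * G (tau_of w, shape w)
            = emeasure (pareto_int 1) {u\<in>{0<..}. (gamma_of w * u, tau_of w, shape w) \<in> A}"
          using emeasure_pareto_int_scale[OF V True] by simp
        moreover have "{u\<in>{0<..}. \<Psi> (u, w) \<in> A} = {u\<in>{0<..}. (gamma_of w * u, tau_of w, shape w) \<in> A}"
          using iffw True by auto
        ultimately show ?thesis by (simp only:)
      next
        case False
        then have "{u\<in>{0<..}. \<Psi> (u, w) \<in> A} = {}" "gamma_of w = 0" using iffw Cvan_max(2)[OF w] by auto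
        then show ?thesis by (simp only: emeasure_empty) simp
      qed
    qed
    also have "\<dots> = ennreal peak_rate * (\<integral>\<^sup>+q. G q \<partial>?N)" by (rule nn_integral_lborel_PF[OF Gm])
    also have "\<dots> = (\<integral>\<^sup>+q. ennreal peak_rate * G q \<partial>?N)"
      using Gm by (intro nn_integral_cmult[symmetric]) (simp cong: measurable_cong_sets sets_pair_measure_cong)
    also have "\<dots> = (\<integral>\<^sup>+q. (\<integral>\<^sup>+v. indicator A (v, q) \<partial>pareto_int peak_rate) \<partial>?N)"
    proof (rule nn_integral_cong)
      fix q assume "q \<in> space ?N"
      from nn_integral_pareto_int_cmult[OF sec[OF this], of peak_rate] peak_rate_pos
      show "ennreal peak_rate * G q = (\<integral>\<^sup>+v. indicator A (v, q) \<partial>pareto_int peak_rate)" by (simp only: G_def less_imp_le)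
    qed
    also have "\<dots> = emeasure ?\<eta> A"
      using cN.nn_integral_snd[OF borel_measurable_indicator[OF A]] A by simp
    finally show "emeasure ?\<eta> A = emeasure PUW {p \<in> space PUW. \<Psi> p \<in> A}"
      unfolding seteq by simp
  qed
  then show ?thesis by (simp add: \<Psi>_def)
qed

text \<open>Disintegration over \<open>gamma = y\<close> would give the integral of \<open>y\<close>
  against conditional probabilities; the left side is that integral as an expectation weighted by
  \<open>gamma_of\<close>. Where \<open>gamma_of\<close> is not positive, dividing by it may differ
  from \<open>shape\<close>, but the weight is then 0.\<close>

lemma angular_eq_M:
  assumes A: "A \<in> sets Cspace" and B: "B \<in> sets borel"
  shows "(\<integral>\<^sup>+\<omega>. ennreal (gamma_of (W0 \<omega>)) *
      indicator {\<omega>. (\<lambda>t. W0 \<omega> (t + tau_of (W0 \<omega>)) / gamma_of (W0 \<omega>)) \<in> A \<and> tau_of (W0 \<omega>) \<in> B} \<omega> \<partial>M) = angular A B"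
proof -
  note A [measurable] B [measurable]
  have "angular A B = (\<integral>\<^sup>+\<omega>. ennreal (gamma_of (W0 \<omega>)) * indicator A (shape (W0 \<omega>)) * indicator B (tau_of (W0 \<omega>)) \<partial>M)"
    unfolding angular_def by (rule nn_integral_PW) measurable
  also have "\<dots> = (\<integral>\<^sup>+\<omega>. ennreal (gamma_of (W0 \<omega>)) *
      indicator {\<omega>. (\<lambda>t. W0 \<omega> (t + tau_of (W0 \<omega>)) / gamma_of (W0 \<omega>)) \<in> A \<and> tau_of (W0 \<omega>) \<in> B} \<omega> \<partial>M)"
  proof (rule nn_integral_cong)
    fix \<omega>
    show "ennreal (gamma_of (W0 \<omega>)) * indicator A (shape (W0 \<omega>)) * indicator B (tau_of (W0 \<omega>))
      = ennreal (gamma_of (W0 \<omega>)) * indicator {\<omega>. (\<lambda>t. W0 \<omega> (t + tau_of (W0 \<omega>)) / gamma_of (W0 \<omega>)) \<in> A \<and> tau_of (W0 \<omega>) \<in> B} \<omega>"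
      by (cases "0 < gamma_of (W0 \<omega>)") (auto simp: shape_def indicator_def ennreal_neg)
  qed
  finally show ?thesis by simp
qed

lemma angular_Cset_eq_M:
  assumes B: "B \<in> sets borel"
  shows "(\<integral>\<^sup>+\<omega>. ennreal (gamma_of (W0 \<omega>)) * indicator {\<omega>. tau_of (W0 \<omega>) \<in> B} \<omega> \<partial>M) = angular Cset B"
proof -
  note B [measurable]
  have "angular Cset B = (\<integral>\<^sup>+\<omega>. ennreal (gamma_of (W0 \<omega>)) * indicator Cset (shape (W0 \<omega>)) * indicator B (tau_of (W0 \<omega>)) \<partial>M)"
    unfolding angular_def by (rule nn_integral_PW) measurable
  also have "\<dots> = (\<integral>\<^sup>+\<omega>. ennreal (gamma_of (W0 \<omega>)) * indicator {\<omega>. tau_of (W0 \<omega>) \<in> B} \<omega> \<partial>M)"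
  proof (rule nn_integral_cong)
    fix \<omega> assume "\<omega> \<in> space M"
    then have "shape (W0 \<omega>) \<in> Cset" using measurable_space[OF W0_meas] by (intro shape_Cset) auto
    then show "ennreal (gamma_of (W0 \<omega>)) * indicator Cset (shape (W0 \<omega>)) * indicator B (tau_of (W0 \<omega>))
      = ennreal (gamma_of (W0 \<omega>)) * indicator {\<omega>. tau_of (W0 \<omega>) \<in> B} \<omega>"
      by (simp add: indicator_def)
  qed
  finally show ?thesis by simp
qed

text \<open>Both \<open>angular A K\<close> and \<open>angular Cset K\<close> contain the factor
  \<open>peak_rate\<close> times the volume of \<open>K\<close>, which cancels because it is
  positive and finite.\<close>

lemma PF_ratio:
  assumes A: "A \<in> sets Cspace" and K: "compact K" "0 < emeasure lborel K"
  shows "0 < angular Cset K" "angular Cset K < \<infinity>" "emeasure PF A = angular A K / angular Cset K"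
proof -
  have Kb: "K \<in> sets borel" using K(1) by (auto intro: borel_closed compact_imp_closed)
  have den: "angular Cset K = ennreal peak_rate * emeasure lborel K"
    using angular_PF[OF Cset_sets Kb] PF.emeasure_space_1 by simp
  show "angular Cset K < \<infinity>" by (rule angular_finite[OF K(1)])
  show pos: "0 < angular Cset K" using K(2) peak_rate_pos by (simp add: den ennreal_zero_less_mult_iff)
  have "angular A K = emeasure PF A * angular Cset K"
    by (simp add: den angular_PF[OF A Kb] mult_ac)
  then show "emeasure PF A = angular A K / angular Cset K"
    using pos angular_finite[OF K(1), of Cset] by (simp add: ennreal_mult_divide_eq)
qed

lemma measurable_mmm_eval:
  "(\<lambda>y. fst y * snd (snd y) (t - fst (snd y)))
     \<in> borel_measurable (pareto_int 1 \<Otimes>\<^sub>M borel \<Otimes>\<^sub>M (Cspace :: (real^('d::{finite,linorder}) \<Rightarrow> real) measure))"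
proof (rule borel_measurable_times)
  let ?N = "pareto_int 1 \<Otimes>\<^sub>M borel \<Otimes>\<^sub>M (Cspace :: (real^('d::{finite,linorder}) \<Rightarrow> real) measure)"
  show "fst \<in> borel_measurable ?N"
    using measurable_compose[OF measurable_fst measurable_ident_pareto_int] .
  show "(\<lambda>y. snd (snd y) (t - fst (snd y))) \<in> borel_measurable ?N"
    by (rule measurable_apply_Cspace) measurable
qed

text \<open>By homogeneity, multiplying the shapes by \<open>peak_rate\<close> has the same effect
  on exceedances as multiplying the Pareto intensity by it. The change of variables then absorbs
  this factor, and \<open>gamma_of w * shape w (t - tau_of w) = w t\<close> returns the exceedance
  measure of \<xi>.\<close>

lemma mmm_exceed:
  assumes J: "finite J" and x: "\<And>t. t \<in> J \<Longrightarrow> 0 < x t"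
  defines "\<mu>' \<equiv> pareto_int 1 \<Otimes>\<^sub>M lborel \<Otimes>\<^sub>M distr PF Cspace (\<lambda>f t. peak_rate * f t)"
  shows "emeasure \<mu>' {y\<in>space \<mu>'. \<exists>t\<in>J. x t < fst y * snd (snd y) (t - fst (snd y))}
    = emeasure PUW {p\<in>space PUW. \<exists>t\<in>J. x t < fst p * snd p (t + 0)}"
proof -
  let ?PF' = "distr PF Cspace (\<lambda>f t. peak_rate * f t)"
  let ?N = "(lborel :: (real^('d::{finite,linorder})) measure) \<Otimes>\<^sub>M PF" and ?N' = "(lborel :: (real^('d::{finite,linorder})) measure) \<Otimes>\<^sub>M ?PF'"
  have scm: "(\<lambda>f t. peak_rate * f t) \<in> measurable PF Cspace"
    using measurable_scale_Cspace[of peak_rate] peak_rate_pos by (simp cong: measurable_cong_sets)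
  interpret PF': prob_space ?PF' by (rule PF.prob_space_distr[OF scm])
  interpret lF': pair_sigma_finite "lborel :: (real^('d::{finite,linorder})) measure" ?PF' ..
  interpret N': sigma_finite_measure ?N' by unfold_locales
  interpret c: pair_sigma_finite "pareto_int 1" ?N' ..
  let ?E = "\<lambda>b. {u\<in>{0<..}. \<exists>t\<in>J. x t < u * b t}"
  have E: "?E b \<in> sets (pareto_int 1)" for b :: "_ \<Rightarrow> real"
  proof -
    have "{u \<in> space borel. \<exists>t\<in>J. x t < u * b t} \<in> sets borel"
      using J by (intro sets.sets_Collect_finite_Ex) measurable
    then have "{0<..} \<inter> {u. \<exists>t\<in>J. x t < u * b t} \<in> sets borel" by (intro sets.Int) auto
    moreover have "{0<..} \<inter> {u. \<exists>t\<in>J. x t < u * b t} = ?E b" by auto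
    ultimately show ?thesis unfolding sets_pareto_int_eq by auto
  qed
  define g where "g q = emeasure (pareto_int 1) (?E (\<lambda>t. snd q (t - fst q)))" for q :: "(real^('d::{finite,linorder})) \<times> (real^('d::{finite,linorder}) \<Rightarrow> real)"
  let ?S = "{y\<in>space \<mu>'. \<exists>t\<in>J. x t < fst y * snd (snd y) (t - fst (snd y))}"
  have sets\<mu>': "sets \<mu>' = sets (pareto_int 1 \<Otimes>\<^sub>M borel \<Otimes>\<^sub>M Cspace)"
    unfolding \<mu>'_def by (intro sets_pair_measure_cong) simp_all
  have sp\<mu>': "space \<mu>' = {0<..} \<times> UNIV \<times> Cset" unfolding \<mu>'_def by (simp add: space_pair_measure)
  have S: "?S \<in> sets \<mu>'"
    using measurable_mmm_eval J unfolding borel_measurable_iff_greater sets\<mu>' sets_eq_imp_space_eq[OF sets\<mu>']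
    by (intro sets.sets_Collect_finite_Ex) blast+
  have gm: "g \<in> borel_measurable (borel \<Otimes>\<^sub>M Cspace)"
  proof -
    let ?B = "borel \<Otimes>\<^sub>M (Cspace :: (real^('d::{finite,linorder}) \<Rightarrow> real) measure)"
    have "(\<lambda>(v, q). indicator ?S (v, q) :: ennreal) \<in> borel_measurable (pareto_int 1 \<Otimes>\<^sub>M ?B)"
      using S unfolding sets\<mu>' by simp
    from measurable_pair_swap[OF this]
    have "(\<lambda>(q, v). indicator ?S (v, q) :: ennreal) \<in> borel_measurable (?B \<Otimes>\<^sub>M pareto_int 1)"
      by (simp add: split_beta')
    from P1.borel_measurable_nn_integral[OF this]
    have "(\<lambda>q. \<integral>\<^sup>+v. indicator ?S (v, q) \<partial>pareto_int 1) \<in> borel_measurable ?B" .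
    moreover have "(\<integral>\<^sup>+v. indicator ?S (v, q) \<partial>pareto_int 1) = g q" if q: "q \<in> space ?B" for q
    proof -
      have "(\<integral>\<^sup>+v. indicator ?S (v, q) \<partial>pareto_int 1) = (\<integral>\<^sup>+v. indicator (?E (\<lambda>t. snd q (t - fst q))) v \<partial>pareto_int 1)"
        using q by (intro nn_integral_cong) (auto simp: indicator_def sp\<mu>' space_pair_measure)
      then show ?thesis using E by (simp only: nn_integral_indicator g_def)
    qed
    ultimately show ?thesis by (rule measurable_cong[THEN iffD1, rotated])
  qed
  \<comment> \<open>The product of Lebesgue measure with the law of the scaled shape is the image of
    the product with \<open>PF\<close>, so the scaling can be moved into the integrand.\<close>
  have dN: "?N' = distr ?N (lborel \<Otimes>\<^sub>M Cspace) (\<lambda>(s, f). (s, \<lambda>t. peak_rate * f t))"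
    using pair_measure_distr[OF measurable_ident scm PF'.sigma_finite_measure_axioms, of lborel]
    by (simp add: distr_id id_def)
  have pm: "(\<lambda>(s, f). (s, \<lambda>t. peak_rate * f t)) \<in> measurable ?N (lborel \<Otimes>\<^sub>M Cspace)"
    using measurable_compose[OF measurable_snd scm, of lborel] unfolding split_beta' by (intro measurable_Pair) auto
  have "emeasure \<mu>' ?S = (\<integral>\<^sup>+q. emeasure (pareto_int 1) ((\<lambda>u. (u, q)) -` ?S) \<partial>?N')"
    using S unfolding \<mu>'_def by (rule c.emeasure_pair_measure_alt2)
  also have "\<dots> = (\<integral>\<^sup>+q. g q \<partial>?N')"
    unfolding g_def by (intro nn_integral_cong arg_cong[where f = "emeasure (pareto_int 1)"])
      (auto simp: sp\<mu>' space_pair_measure)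
  also have "\<dots> = (\<integral>\<^sup>+q. g (fst q, \<lambda>t. peak_rate * snd q t) \<partial>?N)"
    unfolding dN using gm by (subst nn_integral_distr[OF pm]) (simp_all add: split_beta' cong: measurable_cong_sets sets_pair_measure_cong)
  \<comment> \<open>A factor on the shape acts as a factor on \<open>u\<close>, where it comes out
    of the Pareto measure.\<close>
  also have "\<dots> = (\<integral>\<^sup>+q. ennreal peak_rate * g q \<partial>?N)"
  proof (rule nn_integral_cong)
    fix q
    show "g (fst q, \<lambda>t. peak_rate * snd q t) = ennreal peak_rate * g q"
      using emeasure_pareto_int_scale[OF E peak_rate_pos, of "\<lambda>t. snd q (t - fst q)"]
      by (simp add: g_def mult_ac)
  qed
  also have "\<dots> = ennreal peak_rate * (\<integral>\<^sup>+q. g q \<partial>?N)"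
    using gm by (intro nn_integral_cmult) (simp cong: measurable_cong_sets sets_pair_measure_cong)
  also have "\<dots> = (\<integral>\<^sup>+w. ennreal (gamma_of w) * g (tau_of w, shape w) \<partial>PW)"
    by (rule nn_integral_lborel_PF[OF gm, symmetric])
  also have "\<dots> = (\<integral>\<^sup>+w. emeasure (pareto_int 1) (?E w) \<partial>PW)"
  proof (rule nn_integral_PW_cong)
    fix w :: "real^('d::{finite,linorder}) \<Rightarrow> real" assume w: "w \<in> Cvan"
    show "ennreal (gamma_of w) * g (tau_of w, shape w) = emeasure (pareto_int 1) (?E w)"
    proof (cases "gamma_of w = 0")
      case True
      then have "w = (\<lambda>_. 0)" by (rule Cvan_gamma_0[OF w])
      \<comment> \<open>All thresholds are positive, so the zero function exceeds none of them and
        both sides vanish.\<close>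
      then have "?E w = {}" using x by (auto simp: not_less less_imp_le)
      then show ?thesis using True by (simp only: emeasure_empty) simp
    next
      case False
      then have pos: "0 < gamma_of w" using Cvan_max(2)[OF w] by simp
      have "gamma_of w * u * shape w (t - tau_of w) = u * w t" for u t
        using Cvan_shape_mult[OF w, of t] by (simp add: mult_ac)
      then have eq: "{u\<in>{0<..}. \<exists>t\<in>J. x t < gamma_of w * u * shape w (t - tau_of w)} = ?E w" by (simp only:)
      have "emeasure (pareto_int 1) {u\<in>{0<..}. \<exists>t\<in>J. x t < gamma_of w * u * shape w (t - tau_of w)}
          = ennreal (gamma_of w) * emeasure (pareto_int 1) (?E (\<lambda>t. shape w (t - tau_of w)))"
        by (rule emeasure_pareto_int_scale[OF E pos])
      then show ?thesis by (simp only: eq g_def fst_conv snd_conv)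
    qed
  qed
  also have "\<dots> = emeasure PUW {p\<in>{0<..} \<times> Cset. \<exists>t\<in>J. x t < fst p * snd p t}"
  proof (rule emeasure_P1W[symmetric])
    have "{p\<in>space PUW. \<exists>t\<in>J. x t < fst p * snd p (t + 0)} \<in> sets PUW"
      by (rule poisson_sup.exceed_ex_sets[OF UW_sup[OF J] order_refl])
    then show "{p\<in>{0<..} \<times> Cset. \<exists>t\<in>J. x t < fst p * snd p t} \<in> sets PUW"
      by (simp add: space_P1W)
  qed
  finally show ?thesis by (simp add: space_P1W)
qed

text \<open>Both suprema have finite-dimensional laws determined by their exceedance measures, and
  \<open>mmm_exceed\<close> identifies these. Hence every Poisson process with the stated intensity
  gives the same law, on whatever probability space it lives.\<close>

lemma mixed_moving_maxima:
  fixes M' :: "'v measure" and U' :: "nat \<Rightarrow> 'v \<Rightarrow> real" and T' :: "nat \<Rightarrow> 'v \<Rightarrow> real^('d::{finite,linorder})"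
  assumes pp: "poisson_pp M' (pareto_int 1 \<Otimes>\<^sub>M lborel \<Otimes>\<^sub>M distr PF Cspace (\<lambda>f t. peak_rate * f t)) (\<lambda>i \<omega>. (U' i \<omega>, T' i \<omega>, F i \<omega>))"
    and pos: "\<And>i \<omega>. \<omega> \<in> space M' \<Longrightarrow> 0 < U' i \<omega> \<and> F i \<omega> \<in> Cset"
    and T: "finite T"
  shows "distr M (\<Pi>\<^sub>M t\<in>T. borel) (\<lambda>\<omega>. \<lambda>t\<in>T. SUP i. U i \<omega> * W i \<omega> t)
    = distr M' (\<Pi>\<^sub>M t\<in>T. borel) (\<lambda>\<omega>. \<lambda>t\<in>T. SUP i. U' i \<omega> * F i \<omega> (t - T' i \<omega>))"
proof -
  let ?\<mu> = "pareto_int 1 \<Otimes>\<^sub>M lborel \<Otimes>\<^sub>M distr PF Cspace (\<lambda>f t. peak_rate * f t)"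
  let ?\<phi> = "\<lambda>t y. fst y * snd (snd y) (t - fst (snd y))"
  have sets\<mu>: "sets ?\<mu> = sets (pareto_int 1 \<Otimes>\<^sub>M borel \<Otimes>\<^sub>M Cspace)"
    by (intro sets_pair_measure_cong) simp_all
  have sup': "poisson_sup M' ?\<mu> (\<lambda>i \<omega>. (U' i \<omega>, T' i \<omega>, F i \<omega>)) T ?\<phi>"
  proof
    show "poisson_pp M' ?\<mu> (\<lambda>i \<omega>. (U' i \<omega>, T' i \<omega>, F i \<omega>))" by (rule pp)
    show "(U' i \<omega>, T' i \<omega>, F i \<omega>) \<in> space ?\<mu>" if "\<omega> \<in> space M'" for i \<omega>
      using pos[OF that] by (simp add: space_pair_measure)
    show "?\<phi> t \<in> borel_measurable ?\<mu>" for t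
      using measurable_mmm_eval[of t] measurable_cong_sets[OF sets\<mu> refl] by blast
    show "0 \<le> ?\<phi> t y" if "y \<in> space ?\<mu>" for t y
      using that by (auto simp: space_pair_measure Cset_def)
    \<comment> \<open>At a single site the exceedance measure is that of \<xi>, namely
      \<open>1 / x\<close>.\<close>
    fix t and x :: real assume "0 < x"
    then show "emeasure ?\<mu> {y \<in> space ?\<mu>. x < ?\<phi> t y} < \<infinity>"
      using mmm_exceed[of "{t}" "\<lambda>_. x"] exceed_measure[of x t] by (simp add: space_P1W)
  qed (rule T)
  have "distr M (\<Pi>\<^sub>M t\<in>T. borel) (\<lambda>\<omega>. \<lambda>t\<in>T. SUP i. fst (U i \<omega>, W i \<omega>) * snd (U i \<omega>, W i \<omega>) (t + 0))
    = distr M' (\<Pi>\<^sub>M t\<in>T. borel) (\<lambda>\<omega>. \<lambda>t\<in>T. SUP i. ?\<phi> t (U' i \<omega>, T' i \<omega>, F i \<omega>))"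
    by (rule poisson_sup_distr_eqI[OF UW_sup[OF T] sup']) (rule mmm_exceed[OF T, symmetric])
  then show ?thesis by simp
qed

end

theorem theorem4p5:
  fixes M :: "'w measure"
    and U :: "nat \<Rightarrow> 'w \<Rightarrow> real"
    and W :: "nat \<Rightarrow> 'w \<Rightarrow> real^('d::{finite,linorder}) \<Rightarrow> real"
    and W0 :: "'w \<Rightarrow> real^('d::{finite,linorder}) \<Rightarrow> real"
  defines "\<xi> \<equiv> (\<lambda>t \<omega>. SUP i. U i \<omega> * W i \<omega> t)"
  assumes M: "prob_space M"
    and U_ppp: "poisson_pp M (pareto_int 1) U"
    and U_pos: "\<forall>i. \<forall>\<omega>\<in>space M. 0 < U i \<omega>"
    and W0_meas: "W0 \<in> measurable M Cspace"
    and W_meas: "\<forall>i. W i \<in> measurable M Cspace"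
    and W_copies: "\<forall>i. distr M Cspace (W i) = distr M Cspace W0"
    and W_indep: "prob_space.indep_vars M (\<lambda>_. Cspace) W UNIV"
    and UW_indep: "indep_rv2 M (\<Pi>\<^sub>M i\<in>UNIV. borel) (\<lambda>\<omega> i. U i \<omega>)
                                           (\<Pi>\<^sub>M i\<in>UNIV. Cspace) (\<lambda>\<omega> i. W i \<omega>)"
    and W0_lim: "AE \<omega> in M. ((W0 \<omega>) \<longlongrightarrow> 0) at_infinity"
    and W0_mean: "\<forall>t. integrable M (\<lambda>\<omega>. W0 \<omega> t) \<and> prob_space.expectation M (\<lambda>\<omega>. W0 \<omega> t) = 1"
    and W0_max: "\<forall>K. compact K \<longrightarrow> (\<integral>\<^sup>+\<omega>. ennreal (SUP t\<in>K. W0 \<omega> t) \<partial>M) < \<infinity>"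
    and stationary: "\<forall>h T. finite T \<longrightarrow>
        distr M (\<Pi>\<^sub>M t\<in>T. borel) (\<lambda>\<omega>. \<lambda>t\<in>T. \<xi> (t + h) \<omega>)
      = distr M (\<Pi>\<^sub>M t\<in>T. borel) (\<lambda>\<omega>. \<lambda>t\<in>T. \<xi> t \<omega>)"
  shows "(\<forall>i. AE \<omega> in M. bdd_above (range (W i \<omega>)) \<and>
              (0 < gamma_of (W i \<omega>) \<longrightarrow> (\<exists>x. is_lex_inf (argsup (W i \<omega>)) x)))
    \<and> (\<exists>(c::real) (PF :: (real^('d::{finite,linorder}) \<Rightarrow> real) measure).
         0 < c \<and> prob_space PF \<and> sets PF = sets Cspace \<and> space PF = space Cspace
       \<and> poisson_pp M (pareto_int c \<Otimes>\<^sub>M lborel \<Otimes>\<^sub>M PF)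
           (\<lambda>i \<omega>. (U i \<omega> * gamma_of (W i \<omega>), tau_of (W i \<omega>),
                    \<lambda>t. W i \<omega> (t + tau_of (W i \<omega>)) / gamma_of (W i \<omega>)))
       \<and> (\<integral>\<^sup>+t. (\<integral>\<^sup>+f. ennreal (f t) \<partial>PF) \<partial>lborel) = ennreal (1 / c)
       \<and> (\<forall>A\<in>sets Cspace. \<forall>K. compact K \<and> 0 < emeasure lborel K \<longrightarrow>
            (let num = (\<integral>\<^sup>+\<omega>. ennreal (gamma_of (W0 \<omega>)) *
                          indicator {\<omega>. (\<lambda>t. W0 \<omega> (t + tau_of (W0 \<omega>)) / gamma_of (W0 \<omega>)) \<in> A
                                         \<and> tau_of (W0 \<omega>) \<in> K} \<omega> \<partial>M);
                 den = (\<integral>\<^sup>+\<omega>. ennreal (gamma_of (W0 \<omega>)) *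
                          indicator {\<omega>. tau_of (W0 \<omega>) \<in> K} \<omega> \<partial>M)
             in 0 < den \<and> den < \<infinity> \<and> emeasure PF A = num / den))
       \<and> (\<forall>(M' :: 'v measure) (U' :: nat \<Rightarrow> 'v \<Rightarrow> real) (T' :: nat \<Rightarrow> 'v \<Rightarrow> real^('d::{finite,linorder})) F.
            poisson_pp M' (pareto_int 1 \<Otimes>\<^sub>M lborel \<Otimes>\<^sub>M distr PF Cspace (\<lambda>f t. c * f t))
                       (\<lambda>i \<omega>. (U' i \<omega>, T' i \<omega>, F i \<omega>))
          \<and> (\<forall>i. \<forall>\<omega>\<in>space M'. 0 < U' i \<omega> \<and> F i \<omega> \<in> Cset) \<longrightarrow>
            (\<forall>T. finite T \<longrightarrow>
               distr M (\<Pi>\<^sub>M t\<in>T. borel) (\<lambda>\<omega>. \<lambda>t\<in>T. \<xi> t \<omega>)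
             = distr M' (\<Pi>\<^sub>M t\<in>T. borel)
                 (\<lambda>\<omega>. \<lambda>t\<in>T. SUP i. U' i \<omega> * F i \<omega> (t - T' i \<omega>)))))"
proof -
  have sms: "stationary_max_stable M U W W0"
    unfolding stationary_max_stable_def stationary_max_stable_axioms_def
    using assms(2-) unfolding \<xi>_def by blast
  interpret stationary_max_stable M U W W0 by (rule sms)
  show ?thesis
  proof (intro conjI allI exI[of _ peak_rate] exI[of _ PF] ballI impI)
    show "AE \<omega> in M. bdd_above (range (W i \<omega>)) \<and>
        (0 < gamma_of (W i \<omega>) \<longrightarrow> (\<exists>x. is_lex_inf (argsup (W i \<omega>)) x))" for i
      by (rule lex_inf_exists)
    show "let num = (\<integral>\<^sup>+\<omega>. ennreal (gamma_of (W0 \<omega>)) *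
                  indicator {\<omega>. (\<lambda>t. W0 \<omega> (t + tau_of (W0 \<omega>)) / gamma_of (W0 \<omega>)) \<in> A
                                 \<and> tau_of (W0 \<omega>) \<in> K} \<omega> \<partial>M);
              den = (\<integral>\<^sup>+\<omega>. ennreal (gamma_of (W0 \<omega>)) * indicator {\<omega>. tau_of (W0 \<omega>) \<in> K} \<omega> \<partial>M)
          in 0 < den \<and> den < \<infinity> \<and> emeasure PF A = num / den"
      if A: "A \<in> sets Cspace" and K: "compact K \<and> 0 < emeasure lborel K" for A K
    proof -
      have "K \<in> sets borel" using K by (auto intro: borel_closed compact_imp_closed)
      then show ?thesis
        unfolding Let_def angular_eq_M[OF A \<open>K \<in> sets borel\<close>] angular_Cset_eq_M[OF \<open>K \<in> sets borel\<close>]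
        using PF_ratio[OF A, of K] K by blast
    qed
    show "distr M (\<Pi>\<^sub>M t\<in>T. borel) (\<lambda>\<omega>. \<lambda>t\<in>T. \<xi> t \<omega>)
        = distr M' (\<Pi>\<^sub>M t\<in>T. borel) (\<lambda>\<omega>. \<lambda>t\<in>T. SUP i. U' i \<omega> * F i \<omega> (t - T' i \<omega>))"
      if h: "poisson_pp M' (pareto_int 1 \<Otimes>\<^sub>M lborel \<Otimes>\<^sub>M distr PF Cspace (\<lambda>f t. peak_rate * f t))
               (\<lambda>i \<omega>. (U' i \<omega>, T' i \<omega>, F i \<omega>))
          \<and> (\<forall>i. \<forall>\<omega>\<in>space M'. 0 < U' i \<omega> \<and> F i \<omega> \<in> Cset)" and T: "finite T"
      for M' :: "'v measure" and U' T' F T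
      unfolding \<xi>_def by (rule mixed_moving_maxima[OF _ _ T]) (use h in auto)
  qed (simp_all add: peak_rate_pos PF.prob_space_axioms polar_poisson nn_integral_PF_total)
qed

end
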